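(* Let $n\ge 2$, $N\ge 1$ and $0<\alpha<1$. Let $Lu=\sum_{i,j=1}^n a^{ij}(x)D_{ij}u$ be an elliptic operator on $\mathbb{R}^n$, where the coefficients $a^{ij}$ are of class $C^{1,\alpha}$ and there is a constant $\lambda>0$ with $\sum_{i,j}a^{ij}(x)\xi_i\xi_j\ge\lambda|\xi|^2$ for all $x$ and all $\xi\in\mathbb{R}^n$. Let $a(x,p,q,r)=(a_1,\dots,a_N)(x,p,q,r)$ be of class $C^2_{loc}$ in $x\in\mathbb{R}^n$, $p\in\mathbb{R}^N$, $q\in\mathbb{R}^n\otimes\mathbb{R}^N$, $r\in\mathrm{Sym}(n)\otimes\mathbb{R}^N$, and assume $a(0)=0$, $\nabla_r a(0)=0$ and $\nabla_r^2a(0)=0$. Then for all sufficiently small $R>0$ the system for $u=(u_1,\dots,u_N):\{|x|\le R\}\to\mathbb{R}^N$ $$Lu(x)=a(x,u(x),\nabla u(x),\nabla^2u(x))$$ has infinitely many solutions in $C^{2+\alpha}(\{|x|\le R\})$ of vanishing order two at the origin. Moreover, all these solutions are not radially symmetric.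
   Context: $L$ acts componentwise. $\mathrm{Sym}(n)$ is the set of real symmetric $n\times n$ matrices; $\nabla_r$ denotes derivatives with respect to the variables $r$; $a(0)$, $\nabla_ra(0)$, $\nabla_r^2a(0)$ mean values at $(x,p,q,r)=(0,0,0,0)$. A solution $u$ is of vanishing order two at the origin if $u(0)=0$, $\nabla u(0)=0$ and $\nabla^2u(0)\ne0$. A map $u$ on the ball is radially symmetric if $u(x)$ depends only on $|x|$. $C^{2+\alpha}$ denotes functions whose second order partial derivatives exist and are Hölder continuous with exponent $\alpha$. *)

theory Defs
  imports "HOL-Analysis.Analysis"
begin

text \<open>
  All derivatives are Frechet derivatives relative to a set \<open>S\<close> containing the origin, which will be
  a closed ball of positive radius or a linear subspace.  For such \<open>S\<close> the
  value \<open>dirderiv S v f x\<close> is uniquely determined by \<open>f\<close> on \<open>S\<close> whenever \<open>x \<in> S\<close>, \<open>v \<in> span S\<close> and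
  \<open>f\<close> is differentiable at \<open>x\<close> within \<open>S\<close>; for \<open>v \<notin> span S\<close> it carries no information.  This is why
  only directions in \<open>span S\<close> occur below.
\<close>

definition dirderiv ::
  "'a::euclidean_space set \<Rightarrow> 'a \<Rightarrow> ('a \<Rightarrow> 'b::real_normed_vector) \<Rightarrow> 'a \<Rightarrow> 'b" where
  "dirderiv S v f x = frechet_derivative f (at x within S) v"

primrec Ck_on ::
  "nat \<Rightarrow> 'a::euclidean_space set \<Rightarrow> ('a \<Rightarrow> 'b::real_normed_vector) \<Rightarrow> bool" where
  "Ck_on 0 S f \<longleftrightarrow> continuous_on S f"
| "Ck_on (Suc k) S f \<longleftrightarrow> f differentiable_on S \<and> (\<forall>v\<in>span S. Ck_on k S (dirderiv S v f))"

definition holder_on ::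
  "real \<Rightarrow> 'a::metric_space set \<Rightarrow> ('a \<Rightarrow> 'b::metric_space) \<Rightarrow> bool" where
  "holder_on \<alpha> S f \<longleftrightarrow> (\<exists>C. \<forall>x\<in>S. \<forall>y\<in>S. dist (f x) (f y) \<le> C * dist x y powr \<alpha>)"

primrec Ck_holder_on ::
  "nat \<Rightarrow> real \<Rightarrow> 'a::euclidean_space set \<Rightarrow> ('a \<Rightarrow> 'b::real_normed_vector) \<Rightarrow> bool" where
  "Ck_holder_on 0 \<alpha> S f \<longleftrightarrow> holder_on \<alpha> S f"
| "Ck_holder_on (Suc k) \<alpha> S f \<longleftrightarrow>
     f differentiable_on S \<and> (\<forall>v\<in>span S. Ck_holder_on k \<alpha> S (dirderiv S v f))"

definition gradient ::
  "(real^'n) set \<Rightarrow> (real^'n \<Rightarrow> real^'N) \<Rightarrow> real^'n \<Rightarrow> real^'n^'N" where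
  "gradient S u x = (\<chi> k i. dirderiv S (axis i 1) u x $ k)"

definition hessian ::
  "(real^'n) set \<Rightarrow> (real^'n \<Rightarrow> real^'N) \<Rightarrow> real^'n \<Rightarrow> real^'n^'n^'N" where
  "hessian S u x = (\<chi> k i j. dirderiv S (axis i 1) (dirderiv S (axis j 1) u) x $ k)"

definition second_order_op ::
  "(real^'n \<Rightarrow> real^'n^'n) \<Rightarrow> (real^'n) set \<Rightarrow> (real^'n \<Rightarrow> real^'N) \<Rightarrow> real^'n \<Rightarrow> real^'N" where
  "second_order_op A S u x = (\<chi> k. \<Sum>i\<in>UNIV. \<Sum>j\<in>UNIV. A x $ i $ j * hessian S u x $ k $ i $ j)"

definition sym_tensors :: "(real^'n^'n^'N) set" where
  "sym_tensors = {r. \<forall>k. transpose (r $ k) = r $ k}"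

text \<open>
  A nonlinearity \<open>a(x, p, q, r)\<close> with symmetric \<open>r\<close> is a function on the subspace \<open>jet_space\<close>;
  its values at non-symmetric \<open>r\<close> are irrelevant.
\<close>

definition jet_space :: "((real^'n) \<times> (real^'N) \<times> (real^'n^'N) \<times> (real^'n^'n^'N)) set" where
  "jet_space = UNIV \<times> UNIV \<times> UNIV \<times> sym_tensors"

definition vanishing_order_two :: "(real^'n) set \<Rightarrow> (real^'n \<Rightarrow> real^'N) \<Rightarrow> bool" where
  "vanishing_order_two S u \<longleftrightarrow> u 0 = 0 \<and> gradient S u 0 = 0 \<and> hessian S u 0 \<noteq> 0"

definition radially_symmetric_on :: "'a::real_normed_vector set \<Rightarrow> ('a \<Rightarrow> 'b) \<Rightarrow> bool" where
  "radially_symmetric_on S u \<longleftrightarrow> (\<forall>x\<in>S. \<forall>y\<in>S. norm x = norm y \<longrightarrow> u x = u y)"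

text \<open>
  Maps on the ball are represented by extensional functions, so that distinct functions
  are distinct maps on the ball.
\<close>

definition is_solution ::
  "(real^'n \<Rightarrow> real^'n^'n) \<Rightarrow> ((real^'n) \<times> (real^'N) \<times> (real^'n^'N) \<times> (real^'n^'n^'N) \<Rightarrow> real^'N)
    \<Rightarrow> real \<Rightarrow> real \<Rightarrow> (real^'n \<Rightarrow> real^'N) \<Rightarrow> bool" where
  "is_solution A a \<alpha> R u \<longleftrightarrow>
     u \<in> extensional (cball 0 R) \<and>
     Ck_holder_on 2 \<alpha> (cball 0 R) u \<and>
     (\<forall>x\<in>cball 0 R. second_order_op A (cball 0 R) u x =
        a (x, u x, gradient (cball 0 R) u x, hessian (cball 0 R) u x))"

end

theory Submission
  imports Defs
begin

text \<open>
  Look for \<open>u\<close> with prescribed \<open>Lu\<close> instead of \<open>u\<close> itself. Freezing the coefficients at the origin and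
  normalising them to the Laplacian, an explicit radial kernel \<open>\<kappa>\<close> of compact support satisfies
  \<open>\<Delta>\<kappa> = \<phi> - 2\<^sup>n \<phi>(2\<cdot>)\<close>; the convolutions with its rescalings by \<open>2\<^sup>-\<^sup>k\<close> telescope to an operator \<open>U\<close> with
  \<open>\<Delta> U f = f - P f\<close>, where \<open>P f\<close> is an average of \<open>f\<close> at unit scale, and splitting the scales at \<open>|x - y|\<close>
  gives the Schauder estimate. On a ball of radius \<open>R\<close>, a density vanishing at the centre has sup norm
  \<open>O(R\<^sup>\<alpha>)\<close> relative to its Hoelder seminorm, so \<open>P\<close> is a small perturbation there.
  Subtracting Taylor polynomials makes \<open>U f\<close> vanish to second order; adding a quadratic polynomial whose
  Hessian at the origin is \<open>\<epsilon> h + c I\<close>, with \<open>h\<close> annihilated by \<open>L\<close> at the origin and not a multiple of the identity,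
  the equation becomes a fixed point problem for \<open>f\<close>. Since the nonlinearity has no linear part in the
  Hessian variable, this is a contraction in a Hoelder ball for small \<open>R\<close> and all \<open>\<epsilon> \<le> R\<^sup>\<alpha>\<close>. Each \<open>\<epsilon> > 0\<close>
  yields one solution; its Hessian at the origin is not a multiple of the identity, so it is not radial.
\<close>

section \<open>Convolution with compactly supported kernels\<close>

text \<open>The Hessian is only Hoelder continuous and enters the right-hand side, so an iteration
  on \<open>u\<close> would have to recover two derivatives at every step; the density
  \<open>Lu\<close> and the right-hand side live in the same Hoelder space. The kernel comes from
  one regularised fundamental solution at the scales 1 and 1/2: the two gradients agree outside the
  unit ball, so no singular integral occurs. In the contraction all jets have size of order
  \<open>R powr \<alpha>\<close>. The derivative in the Hessian variable, zero at the origin, is of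
  that order along them, and lower order terms gain from the vanishing first jet of
  \<open>u\<close>. Only the explicit dependence on \<open>x\<close> offers no such factor: it
  cancels in differences of two iterates, and in the first iterate it is paid for by
  \<open>R powr (1 - \<alpha>)\<close>. The bound \<epsilon> \<le> \<open>R powr \<alpha>\<close>
  keeps the added polynomial at the size of the other Hessians, so one radius serves a whole
  interval of \<epsilon>. The parameter is read back from the difference of two diagonal entries of
  the Hessian at the origin, where the multiple of the identity drops out.\<close>

lemma mean_value_bound:
  fixes f :: "'a::{real_normed_vector,perfect_space} \<Rightarrow> 'b::real_normed_vector"
  assumes "convex S" "\<And>x. x \<in> S \<Longrightarrow> (f has_derivative f' x) (at x within S)"
    and "\<And>x h. x \<in> S \<Longrightarrow> norm (f' x h) \<le> B * norm h" "x \<in> S" "y \<in> S"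
  shows "norm (f x - f y) \<le> B * norm (x - y)"
proof (rule differentiable_bound[OF assms(1,2) _ assms(4,5)])
  show "onorm (f' x) \<le> B" if "x \<in> S" for x by (rule onorm_le) (rule assms(3)[OF that])
qed

text \<open>Substituting y = x + d z shows the usual mass-preserving rescaling d^(-n) K((y - x) /
  d). Here \<open>x\<close> enters the kernel with a minus sign, which is the origin of the sign in
  later derivatives.\<close>

definition conv :: "('a::euclidean_space \<Rightarrow> real) \<Rightarrow> real \<Rightarrow> ('a \<Rightarrow> 'b::euclidean_space) \<Rightarrow> 'a \<Rightarrow> 'b" where
  "conv K d f x = (LINT z|lborel. K z *\<^sub>R f (x + d *\<^sub>R z))"

text \<open>Because of the support condition the Lipschitz constant also controls the size, so one
  number carries every estimate for a kernel.\<close>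

definition unit_kernel :: "real \<Rightarrow> ('a::euclidean_space \<Rightarrow> real) \<Rightarrow> bool" where
  "unit_kernel L K \<longleftrightarrow> 0 \<le> L \<and> (\<forall>z y. \<bar>K z - K y\<bar> \<le> L * norm (z - y)) \<and> (\<forall>z. 1 \<le> norm z \<longrightarrow> K z = 0)"

lemma unit_kernel_bound:
  fixes K :: "'a::euclidean_space \<Rightarrow> real"
  assumes "unit_kernel L K"
  shows "\<bar>K z\<bar> \<le> 2 * L"
proof (cases "norm z \<ge> 1")
  case True then show ?thesis using assms by (auto simp: unit_kernel_def)
next
  case False
  \<comment> \<open>A unit vector serves as a zero of \<open>K\<close> at distance at most 2 from
    \<open>z\<close>.\<close>
  obtain e :: 'a where e: "e \<in> Basis" using nonempty_Basis by blast
  have "K e = 0" using assms e by (auto simp: unit_kernel_def)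
  then have "\<bar>K z\<bar> \<le> L * norm (z - e)" using assms unfolding unit_kernel_def by (metis diff_zero)
  also have "\<dots> \<le> L * 2"
    using assms False norm_triangle_ineq4[of z e] e
    by (intro mult_left_mono) (auto simp: unit_kernel_def)
  finally show ?thesis by simp
qed

lemma continuous_on_unit_kernel:
  assumes "unit_kernel L K"
  shows "continuous_on S K"
proof -
  have "L-lipschitz_on UNIV K"
    using assms by (intro lipschitz_onI) (auto simp: unit_kernel_def dist_norm)
  then show ?thesis using lipschitz_on_continuous_on continuous_on_subset by blast
qed

text \<open>Composing \<open>K\<close> with the projection onto the unit ball does not change it:
  outside points project to the sphere, where \<open>K\<close> vanishes. The projection is
  nonexpansive, so a Lipschitz bound inside the ball suffices.\<close>

lemma unit_kernelI:
  assumes "0 \<le> L"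
    and "\<And>z y. norm z \<le> 1 \<Longrightarrow> norm y \<le> 1 \<Longrightarrow> \<bar>K z - K y\<bar> \<le> L * norm (z - y)"
    and K0: "\<And>z. 1 \<le> norm z \<Longrightarrow> K z = 0"
  shows "unit_kernel L (K :: 'a::euclidean_space \<Rightarrow> real)"
proof -
  define p where "p = closest_point (cball (0::'a) 1)"
  have p: "norm (p z) \<le> 1" for z
    using closest_point_in_set[of "cball (0::'a) 1" z] by (auto simp: p_def)
  have Kp: "K (p z) = K z" for z
  proof (cases "norm z \<le> 1")
    case True then show ?thesis by (simp add: p_def closest_point_self)
  next
    case False
    then have "p z \<in> rel_frontier (cball 0 1)" unfolding p_def
      by (intro closest_point_in_rel_frontier) (auto simp: rel_interior_nonempty_interior affine_hull_nonempty_interior)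
    then have "norm (p z) = 1" by simp
    then show ?thesis using K0 False by auto
  qed
  have "\<bar>K z - K y\<bar> \<le> L * norm (z - y)" for z y
  proof -
    have "\<bar>K (p z) - K (p y)\<bar> \<le> L * norm (p z - p y)" using p assms(2) by blast
    also have "\<dots> \<le> L * norm (z - y)"
      using closest_point_lipschitz[of "cball (0::'a) 1" z y] assms(1)
      by (intro mult_left_mono) (auto simp: p_def dist_norm)
    finally show ?thesis by (simp add: Kp)
  qed
  then show ?thesis using assms by (auto simp: unit_kernel_def)
qed

lemma integrable_continuous_cball:
  fixes G :: "'a::euclidean_space \<Rightarrow> 'b::euclidean_space"
  assumes "continuous_on UNIV G" "\<And>z. r < norm z \<Longrightarrow> G z = 0"
  shows "integrable lborel G"
proof -
  have "integrable lborel (\<lambda>z. indicator (cball 0 r) z *\<^sub>R G z)"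
    by (rule borel_integrable_compact) (auto intro: continuous_on_subset[OF assms(1)])
  also have "(\<lambda>z. indicator (cball 0 r) z *\<^sub>R G z) = G"
    using assms(2) by (auto simp: indicator_def fun_eq_iff not_le)
  finally show ?thesis .
qed

lemma integral_cball_bound:
  fixes G :: "'a::euclidean_space \<Rightarrow> 'b::euclidean_space"
  assumes "continuous_on UNIV G" "\<And>z. r < norm z \<Longrightarrow> G z = 0" "\<And>z. norm z \<le> r \<Longrightarrow> norm (G z) \<le> m" 
  shows "norm (LINT z|lborel. G z) \<le> m * measure lborel (cball (0::'a) r)"
proof -
  have "norm (LINT z|lborel. G z) \<le> (LINT z|lborel. m * indicator (cball (0::'a) r) z)"
  proof (rule Bochner_Integration.integral_norm_bound_integral)
    show "integrable lborel G" using assms integrable_continuous_cball by blast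
    show "integrable lborel (\<lambda>z. m * indicator (cball (0::'a) r) z)"
      by (intro integrable_mult_right integrable_real_indicator emeasure_bounded_finite) auto
  qed (use assms(2,3) in \<open>auto simp: indicator_def not_le\<close>)
  then show ?thesis by simp
qed

lemma integral_shift:
  fixes G :: "'a::euclidean_space \<Rightarrow> 'b::euclidean_space"
  assumes "continuous_on UNIV G"
  shows "(LINT z|lborel. G (c + z)) = (LINT z|lborel. G z)"
proof -
  have "G \<in> borel_measurable borel" using assms by (rule borel_measurable_continuous_onI)
  then have "(LINT z|distr lborel borel ((+) c). G z) = (LINT z|lborel. G (c + z))"
    by (subst integral_distr) auto
  then show ?thesis by (simp add: lborel_distr_plus)
qed

lemma integral_dilate:
  fixes G :: "'a::euclidean_space \<Rightarrow> 'b::euclidean_space"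
  assumes "continuous_on UNIV G" "0 < c"
  shows "(c ^ DIM('a)) *\<^sub>R (LINT z|lborel. G (c *\<^sub>R z)) = (LINT z|lborel. G z)"
proof -
  have m: "G \<in> borel_measurable borel" using assms(1) by (rule borel_measurable_continuous_onI)
  have "(LINT z|lborel. G z) = (LINT z|density (distr lborel borel (\<lambda>x. 0 + c *\<^sub>R x)) (\<lambda>_. ennreal (\<bar>c\<bar>^DIM('a))). G z)"
    using lborel_affine[of c "0::'a"] assms(2) by (simp add: ennreal_power)
  also have "\<dots> = (LINT z|distr lborel borel (\<lambda>x. 0 + c *\<^sub>R x). (\<bar>c\<bar>^DIM('a)) *\<^sub>R G z)"
    by (rule integral_density) (use m in auto)
  also have "\<dots> = (LINT z|lborel. (\<bar>c\<bar>^DIM('a)) *\<^sub>R G (c *\<^sub>R z))"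
    by (subst integral_distr) (use m in auto)
  finally show ?thesis using assms(2) by simp
qed

lemma conv_integrable:
  fixes f :: "'a::euclidean_space \<Rightarrow> 'b::euclidean_space"
  assumes "unit_kernel L K" "continuous_on UNIV f"
  shows "integrable lborel (\<lambda>z. K z *\<^sub>R f (x + d *\<^sub>R z))"
  by (rule integrable_continuous_cball[of _ 1])
     (use assms in \<open>auto intro!: continuous_intros continuous_on_unit_kernel[OF assms(1)]
        continuous_on_compose2[OF assms(2)] simp: unit_kernel_def\<close>)

section \<open>Linearity of convolution in the kernel and in the density\<close>

lemma conv_diff_kernel:
  fixes f :: "'a::euclidean_space \<Rightarrow> 'b::euclidean_space"
  assumes "unit_kernel L K" "unit_kernel L' K'" "continuous_on UNIV f"
  shows "conv (\<lambda>z. K z - K' z) d f x = conv K d f x - conv K' d f x"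
  unfolding conv_def scaleR_diff_left
  by (rule Bochner_Integration.integral_diff) (use assms conv_integrable in blast)+

lemma conv_add_kernel:
  fixes f :: "'a::euclidean_space \<Rightarrow> 'b::euclidean_space"
  assumes "unit_kernel L K" "unit_kernel L' K'" "continuous_on UNIV f"
  shows "conv (\<lambda>z. K z + K' z) d f x = conv K d f x + conv K' d f x"
  unfolding conv_def scaleR_add_left
  by (rule Bochner_Integration.integral_add) (use assms conv_integrable in blast)+

lemma conv_scale_kernel:
  fixes f :: "'a::euclidean_space \<Rightarrow> 'b::euclidean_space"
  shows "conv (\<lambda>z. c * K z) d f x = c *\<^sub>R conv K d f x"
  unfolding conv_def by (simp flip: scaleR_scaleR)

lemma conv_sum_kernel:
  fixes f :: "'a::euclidean_space \<Rightarrow> 'b::euclidean_space"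
  assumes "\<And>i. i \<in> I \<Longrightarrow> unit_kernel (L i) (K i)" "continuous_on UNIV f"
  shows "conv (\<lambda>z. \<Sum>i\<in>I. K i z) d f x = (\<Sum>i\<in>I. conv (K i) d f x)"
  unfolding conv_def scaleR_sum_left
  by (rule Bochner_Integration.integral_sum) (use assms conv_integrable in blast)

lemma conv_diff:
  fixes f :: "'a::euclidean_space \<Rightarrow> 'b::euclidean_space"
  assumes "unit_kernel L K" "continuous_on UNIV f" "continuous_on UNIV g"
  shows "conv K d (\<lambda>x. f x - g x) x = conv K d f x - conv K d g x"
  unfolding conv_def scaleR_diff_right
  by (rule Bochner_Integration.integral_diff) (use assms conv_integrable in blast)+

section \<open>Size, increments and derivatives of convolutions\<close>

lemma conv_bound:
  fixes f :: "'a::euclidean_space \<Rightarrow> 'b::euclidean_space"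
  assumes "unit_kernel L K" "continuous_on UNIV f" "\<And>z. norm z \<le> 1 \<Longrightarrow> norm (f (x + d *\<^sub>R z)) \<le> m"
  shows "norm (conv K d f x) \<le> 2 * L * m * measure lborel (cball (0::'a) 1)"
  unfolding conv_def
proof (rule integral_cball_bound)
  show "continuous_on UNIV (\<lambda>z. K z *\<^sub>R f (x + d *\<^sub>R z))"
    by (auto intro!: continuous_intros continuous_on_unit_kernel[OF assms(1)]
        continuous_on_compose2[OF assms(2)])
  fix z :: 'a
  assume "norm z \<le> 1"
  then show "norm (K z *\<^sub>R f (x + d *\<^sub>R z)) \<le> 2 * L * m"
    using assms(3)[of z] unit_kernel_bound[OF assms(1), of z] by (auto intro!: mult_mono')
qed (use assms in \<open>auto simp: unit_kernel_def\<close>)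

text \<open>The shift moves from the density to the kernel, so regularity in \<open>x\<close> is
  paid for by smoothness of \<open>K\<close> while \<open>f\<close> is merely continuous.\<close>

lemma conv_translate:
  fixes f :: "'a::euclidean_space \<Rightarrow> 'b::euclidean_space"
  assumes "unit_kernel L K" "continuous_on UNIV f" "d \<noteq> 0"
  shows "conv K d f (x + h) = (LINT z|lborel. K (z - h /\<^sub>R d) *\<^sub>R f (x + d *\<^sub>R z))"
proof -
  have "conv K d f (x + h) = (LINT z|lborel. K ((h /\<^sub>R d + z) - h /\<^sub>R d) *\<^sub>R f (x + d *\<^sub>R (h /\<^sub>R d + z)))"
    unfolding conv_def using assms(3) by (simp add: algebra_simps)
  also have "\<dots> = (LINT z|lborel. K (z - h /\<^sub>R d) *\<^sub>R f (x + d *\<^sub>R z))"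
    by (rule integral_shift)
       (auto intro!: continuous_intros continuous_on_compose2[OF continuous_on_unit_kernel[OF assms(1), of UNIV]]
        continuous_on_compose2[OF assms(2)])
  finally show ?thesis .
qed

lemma translated_kernel_integrable:
  fixes f :: "'a::euclidean_space \<Rightarrow> 'b::euclidean_space"
  assumes "unit_kernel L K" "continuous_on UNIV f" "norm w \<le> 1"
  shows "integrable lborel (\<lambda>z. K (z - w) *\<^sub>R f (x + d *\<^sub>R z))"
proof (rule integrable_continuous_cball[of _ 2])
  fix z :: 'a
  assume "2 < norm z"
  then have "norm (z - w) \<ge> 1" using assms(3) norm_triangle_ineq2[of z w] by linarith
  then show "K (z - w) *\<^sub>R f (x + d *\<^sub>R z) = 0" using assms by (auto simp: unit_kernel_def)
qed (auto intro!: continuous_intros continuous_on_compose2[OF continuous_on_unit_kernel[OF assms(1), of UNIV]]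
        continuous_on_compose2[OF assms(2)])

text \<open>Once the shift sits on the kernel, its Lipschitz bound yields the factor
  \<open>norm h / d\<close> and \<open>f\<close> enters only by its size. Radius 2 covers the
  support of the kernel and of its translate by at most 1.\<close>

lemma conv_increment_bound:
  fixes f :: "'a::euclidean_space \<Rightarrow> 'b::euclidean_space"
  assumes K: "unit_kernel L K" and f: "continuous_on UNIV f" and "d > 0" "norm h \<le> d"
    and m: "\<And>z. norm z \<le> 2 \<Longrightarrow> norm (f (x + d *\<^sub>R z)) \<le> m"
  shows "norm (conv K d f (x + h) - conv K d f x) \<le> L * (norm h / d) * m * measure lborel (cball (0::'a) 2)"
proof -
  define w where "w = h /\<^sub>R d"
  have w: "norm w = norm h / d" using \<open>d > 0\<close> by (simp add: w_def field_simps)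
  then have w1: "norm w \<le> 1" using assms by simp
  have "conv K d f (x + h) - conv K d f x = (LINT z|lborel. K (z - w) *\<^sub>R f (x + d *\<^sub>R z)) - conv K d f x"
    using conv_translate[OF K f, of d x h] \<open>d > 0\<close> by (simp add: w_def)
  also have "\<dots> = (LINT z|lborel. (K (z - w) - K z) *\<^sub>R f (x + d *\<^sub>R z))"
    unfolding scaleR_diff_left conv_def
    by (subst Bochner_Integration.integral_diff)
       (use translated_kernel_integrable[OF K f w1] conv_integrable[OF K f] in auto)
  also have "norm \<dots> \<le> L * (norm h / d) * m * measure lborel (cball (0::'a) 2)"
  proof (rule integral_cball_bound)
    show "continuous_on UNIV (\<lambda>z. (K (z - w) - K z) *\<^sub>R f (x + d *\<^sub>R z))"
      by (auto intro!: continuous_intros continuous_on_unit_kernel[OF K]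
        continuous_on_compose2[OF continuous_on_unit_kernel[OF K, of UNIV]] continuous_on_compose2[OF f])
    show "(K (z - w) - K z) *\<^sub>R f (x + d *\<^sub>R z) = 0" if "2 < norm z" for z
    proof -
      have "norm (z - w) \<ge> 1" using that w1 norm_triangle_ineq2[of z w] by linarith
      then show ?thesis using K that by (auto simp: unit_kernel_def)
    qed
    show "norm ((K (z - w) - K z) *\<^sub>R f (x + d *\<^sub>R z)) \<le> L * (norm h / d) * m" if "norm z \<le> 2" for z
    proof -
      have "\<bar>K (z - w) - K z\<bar> \<le> L * norm (z - w - z)" using K unfolding unit_kernel_def by blast
      also have "\<dots> = L * (norm h / d)" using w by simp
      finally have "\<bar>K (z - w) - K z\<bar> * norm (f (x + d *\<^sub>R z)) \<le> (L * (norm h / d)) * m"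
        by (rule mult_mono') (use m[OF that] in auto)
      then show ?thesis by simp
    qed
  qed
  finally show ?thesis .
qed

lemma kernel_taylor:
  fixes K :: "'a::euclidean_space \<Rightarrow> real"
  assumes "\<And>z. (K has_derivative K' z) (at z)"
    and "\<And>h. unit_kernel (L * norm h) (\<lambda>z. K' z h)"
  shows "\<bar>K (z + h) - K z - K' z h\<bar> \<le> L * (norm h)\<^sup>2"
proof -
  have "norm ((\<lambda>t. K (z + t *\<^sub>R h) - K' z (t *\<^sub>R h)) 1 - (\<lambda>t. K (z + t *\<^sub>R h) - K' z (t *\<^sub>R h)) 0)
      \<le> (L * (norm h)\<^sup>2) * norm (1 - 0 :: real)"
  proof (rule mean_value_bound[of "{0..1}" _ "\<lambda>t s. K' (z + t *\<^sub>R h) (s *\<^sub>R h) - K' z (s *\<^sub>R h)"])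
    fix t :: real assume t: "t \<in> {0..1}"
    have lin: "bounded_linear (K' z)" using assms(1) has_derivative_bounded_linear by blast
    show "((\<lambda>t. K (z + t *\<^sub>R h) - K' z (t *\<^sub>R h)) has_derivative
        (\<lambda>s. K' (z + t *\<^sub>R h) (s *\<^sub>R h) - K' z (s *\<^sub>R h))) (at t within {0..1})"
      by (rule derivative_eq_intros has_derivative_compose[of "\<lambda>t. z + t *\<^sub>R h", OF _ assms(1)]
          bounded_linear.has_derivative[OF lin] refl | simp)+
    fix s :: real
    have e: "K' (z + t *\<^sub>R h) (s *\<^sub>R h) - K' z (s *\<^sub>R h) = s * (K' (z + t *\<^sub>R h) h - K' z h)"
      using assms(1)[THEN has_derivative_linear, THEN linear_scale] by (simp add: algebra_simps)
    have "\<bar>K' (z + t *\<^sub>R h) h - K' z h\<bar> \<le> L * norm h * norm (z + t *\<^sub>R h - z)"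
      using assms(2)[of h] unfolding unit_kernel_def by blast
    moreover have "L * norm h * norm (z + t *\<^sub>R h - z) \<le> L * norm h * norm h"
      using t assms(2)[of h] by (intro mult_left_mono) (auto simp: unit_kernel_def mult_left_le_one_le)
    ultimately have "\<bar>s\<bar> * \<bar>K' (z + t *\<^sub>R h) h - K' z h\<bar> \<le> \<bar>s\<bar> * (L * norm h * norm h)"
      by (intro mult_left_mono) auto
    then show "norm (K' (z + t *\<^sub>R h) (s *\<^sub>R h) - K' z (s *\<^sub>R h)) \<le> L * (norm h)\<^sup>2 * norm s"
      unfolding e
      by (simp add: abs_mult power2_eq_square mult_ac)
  qed auto
  then show ?thesis using linear_0[OF has_derivative_linear[OF assms(1)[of z]]] by simp
qed

text \<open>All differentiation falls on the kernel. Its Taylor remainder for the shift by h / d is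
  supported in the ball of radius 2 and quadratic in \<open>norm h / d\<close>, so after integration
  it is negligible against \<open>norm h\<close>.\<close>

lemma conv_has_derivative:
  fixes f :: "'a::euclidean_space \<Rightarrow> 'b::euclidean_space"
  assumes K: "unit_kernel L0 K" and dK: "\<And>z. (K has_derivative K' z) (at z)"
    and K': "\<And>h. unit_kernel (L * norm h) (\<lambda>z. K' z h)"
    and f: "continuous_on UNIV f" and m: "\<And>z. norm (f z) \<le> m" and "d > 0"
  shows "(conv K d f has_derivative (\<lambda>h. - conv (\<lambda>z. K' z h) d f x /\<^sub>R d)) (at x)"
proof -
  define B where "B = \<bar>L\<bar> * \<bar>m\<bar> / d\<^sup>2 * measure lborel (cball (0::'a) 2)"
  let ?D = "\<lambda>h. - conv (\<lambda>z. K' z h) d f x /\<^sub>R d"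
  note lin = has_derivative_linear[OF dK]
  have "linear ?D"
  proof (rule linearI)
    show "?D (a + b) = ?D a + ?D b" for a b
      using conv_add_kernel[OF K'[of a] K'[of b] f] by (simp add: linear_add[OF lin] algebra_simps)
    show "?D (c *\<^sub>R b) = c *\<^sub>R ?D b" for c b
      using conv_scale_kernel[of c "\<lambda>z. K' z b" d f x] by (simp add: linear_scale[OF lin] algebra_simps)
  qed
  then have bl: "bounded_linear ?D" by (rule linear_conv_bounded_linear[THEN iffD1])
  have est: "norm (conv K d f (x + h) - conv K d f x - ?D h) \<le> B * (norm h)\<^sup>2" if h: "norm h \<le> d" for h
  proof -
    define w where "w = h /\<^sub>R d"
    have w: "norm w = norm h / d" using \<open>d > 0\<close> by (simp add: w_def field_simps)
    then have w1: "norm w \<le> 1" using h \<open>d > 0\<close> by simp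
    have D: "?D h = conv (\<lambda>z. - (inverse d * K' z h)) d f x"
      using conv_scale_kernel[of "- inverse d" "\<lambda>z. K' z h" d f x] by simp
    have e: "- (inverse d * K' z h) = K' z (- w)" for z
      by (simp add: w_def linear_scale[OF lin] linear_neg[OF lin])
    have I1: "integrable lborel (\<lambda>z. K (z - w) *\<^sub>R f (x + d *\<^sub>R z))"
      by (rule translated_kernel_integrable[OF K f w1])
    have I2: "integrable lborel (\<lambda>z. K z *\<^sub>R f (x + d *\<^sub>R z))" by (rule conv_integrable[OF K f])
    have I3: "integrable lborel (\<lambda>z. K' z (-w) *\<^sub>R f (x + d *\<^sub>R z))" by (rule conv_integrable[OF K' f])
    have "conv K d f (x + h) - conv K d f x - ?D h =
       (LINT z|lborel. (K (z - w) - K z - K' z (-w)) *\<^sub>R f (x + d *\<^sub>R z))"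
      unfolding scaleR_diff_left D e using conv_translate[OF K f, of d x h] \<open>d > 0\<close>
      by (simp add: I1 I2 I3 conv_def Bochner_Integration.integral_diff w_def[symmetric])
    also have "norm \<dots> \<le> \<bar>L\<bar> * (norm w)\<^sup>2 * \<bar>m\<bar> * measure lborel (cball (0::'a) 2)"
    proof (rule integral_cball_bound)
      show "continuous_on UNIV (\<lambda>z. (K (z - w) - K z - K' z (-w)) *\<^sub>R f (x + d *\<^sub>R z))"
        by (auto intro!: continuous_intros continuous_on_unit_kernel[OF K] continuous_on_unit_kernel[OF K']
          continuous_on_compose2[OF continuous_on_unit_kernel[OF K, of UNIV]] continuous_on_compose2[OF f])
      show "(K (z - w) - K z - K' z (-w)) *\<^sub>R f (x + d *\<^sub>R z) = 0" if "2 < norm z" for z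
      proof -
        have "norm (z - w) \<ge> 1" using that w1 norm_triangle_ineq2[of z w] by linarith
        then show ?thesis using K K'[of "-w"] that by (auto simp: unit_kernel_def)
      qed
      show "norm ((K (z - w) - K z - K' z (-w)) *\<^sub>R f (x + d *\<^sub>R z)) \<le> \<bar>L\<bar> * (norm w)\<^sup>2 * \<bar>m\<bar>" for z
      proof -
        have "\<bar>K (z - w) - K z - K' z (-w)\<bar> \<le> L * (norm w)\<^sup>2"
          using kernel_taylor[OF dK K', of z "-w"] by simp
        also have "\<dots> \<le> \<bar>L\<bar> * (norm w)\<^sup>2" by (intro mult_right_mono) auto
        finally show ?thesis using m[of "x + d *\<^sub>R z"] by (auto intro!: mult_mono')
      qed
    qed
    also have "\<dots> = B * (norm h)\<^sup>2" by (simp add: w B_def power_divide)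
    finally show ?thesis .
  qed
  show ?thesis
    unfolding has_derivative_at
  proof (intro conjI bl)
    have B0: "0 \<le> B" by (simp add: B_def)
    have "((\<lambda>h. B * norm h) \<longlongrightarrow> 0) (at (0::'a))"
      by (auto intro!: tendsto_eq_intros)
    moreover have "\<forall>\<^sub>F h in at 0. norm (norm (conv K d f (x + h) - conv K d f x - ?D h) / norm h) \<le> B * norm h"
    proof -
      have "\<forall>\<^sub>F h in at (0::'a). h \<noteq> 0 \<and> norm h \<le> d"
        unfolding eventually_at using \<open>d > 0\<close> by (intro exI[of _ d]) auto
      then show ?thesis
      proof eventually_elim
        case (elim h)
        then show ?case using est[of h] by (simp add: divide_le_eq power2_eq_square mult.assoc)
      qed
    qed
    ultimately show "((\<lambda>h. norm (conv K d f (x + h) - conv K d f x - ?D h) / norm h) \<longlongrightarrow> 0) (at 0)"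
      by (rule Lim_null_comparison[rotated])
  qed
qed

section \<open>The telescoping kernel\<close>

lemma has_real_derivative_split:
  fixes f :: "real \<Rightarrow> real"
  assumes "(f has_real_derivative D) (at x within {..x})" "(f has_real_derivative D) (at x within {x..})"
  shows "(f has_real_derivative D) (at x)"
proof -
  have "{..x} \<union> {x..} = (UNIV :: real set)" by auto
  then show ?thesis
    using assms Lim_within_Un[of "\<lambda>y. (f y - f x) / (y - x)" D x "{..x}" "{x..}"]
    by (simp add: has_field_derivative_iff)
qed

text \<open>
  \<open>c * profile (dim / 2) (norm x)\<^sup>2 *\<^sub>R x\<close> is the gradient of the fundamental solution outside the unit ball,
  extended into the ball as a \<open>C\<^sup>1\<close> vector field.
\<close>

definition profile :: "real \<Rightarrow> real \<Rightarrow> real" where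
  "profile p t = max 1 t powr (- p) + p * (max 1 t - t)"

definition profile' :: "real \<Rightarrow> real \<Rightarrow> real" where
  "profile' p t = - p * max 1 t powr (- p - 1)"

lemma profile_has_derivative: "(profile p has_real_derivative profile' p t) (at t)"
proof -
  have l: "(profile p has_real_derivative profile' p t) (at t within {..t})" if "t \<le> 1" for t
  proof (rule has_field_derivative_transform_within[of "\<lambda>t. 1 + p * (1 - t)" _ _ _ 1])
    show "((\<lambda>t. 1 + p * (1 - t)) has_real_derivative profile' p t) (at t within {..t})"
      using that by (auto intro!: derivative_eq_intros simp: profile'_def max_def)
  qed (use that in \<open>auto simp: profile_def max_absorb1\<close>)
  have r: "(profile p has_real_derivative profile' p t) (at t within {t..})" if "t \<ge> 1" for t
  proof (rule has_field_derivative_transform_within[of "\<lambda>t. t powr (- p)" _ _ _ 1])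
    show "((\<lambda>t. t powr (- p)) has_real_derivative profile' p t) (at t within {t..})"
      using that by (auto intro!: derivative_eq_intros simp: profile'_def max_def)
  qed (use that in \<open>auto simp: profile_def max_def\<close>)
  consider "t < 1" | "t = 1" | "t > 1" by linarith
  then show ?thesis
  proof cases
    case 1
    show ?thesis
    proof (rule has_field_derivative_transform_within_open[of "\<lambda>t. 1 + p * (1 - t)" _ _ "{..<1}"])
      show "((\<lambda>t. 1 + p * (1 - t)) has_real_derivative profile' p t) (at t)"
        using 1 by (auto intro!: derivative_eq_intros simp: profile'_def max_def)
    qed (use 1 in \<open>auto simp: profile_def max_def\<close>)
  next
    case 2 then show ?thesis using l[of t] r[of t] by (intro has_real_derivative_split) auto
  next
    case 3
    show ?thesis
    proof (rule has_field_derivative_transform_within_open[of "\<lambda>t. t powr (- p)" _ _ "{1<..}"])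
      show "((\<lambda>t. t powr (- p)) has_real_derivative profile' p t) (at t)"
        using 3 by (auto intro!: derivative_eq_intros simp: profile'_def max_def)
    qed (use 3 in \<open>auto simp: profile_def max_def\<close>)
  qed
qed

lemma profile'_bound: "p \<ge> 0 \<Longrightarrow> \<bar>profile' p t\<bar> \<le> p"
proof -
  assume "p \<ge> 0"
  then have "max 1 t powr (- p - 1) \<le> 1 powr (- p - 1)"
    by (intro powr_mono2') auto
  then show ?thesis using \<open>p \<ge> 0\<close> by (simp add: profile'_def abs_mult mult_left_le)
qed

lemma profile'_lipschitz:
  assumes "p \<ge> 0"
  shows "\<bar>profile' p s - profile' p t\<bar> \<le> p * (p + 1) * \<bar>s - t\<bar>"
proof -
  have "norm (max 1 s powr (- p - 1) - max 1 t powr (- p - 1)) \<le> (p + 1) * norm (max 1 s - max 1 t)"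
  proof (rule mean_value_bound[of "{1..}" "\<lambda>t. t powr (- p - 1)" "\<lambda>t h. ((- p - 1) * t powr (- p - 2)) * h"])
    fix t :: real assume t: "t \<in> {1..}"
    show "((\<lambda>t. t powr (- p - 1)) has_derivative (\<lambda>h. ((- p - 1) * t powr (- p - 2)) * h)) (at t within {1..})"
      unfolding has_field_derivative_def[symmetric] using t
      by (auto intro!: derivative_eq_intros simp: algebra_simps diff_diff_eq)
    fix h :: real
    have "t powr (- p - 2) \<le> 1 powr (- p - 2)" using t assms by (intro powr_mono2') auto
    then have "\<bar>(- p - 1) * t powr (- p - 2)\<bar> \<le> p + 1" using assms by (simp add: abs_mult mult_left_le add.commute[of 1])
    then have "\<bar>(- p - 1) * t powr (- p - 2)\<bar> * \<bar>h\<bar> \<le> (p + 1) * \<bar>h\<bar>"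
      by (rule mult_right_mono) simp
    then show "norm (((- p - 1) * t powr (- p - 2)) * h) \<le> (p + 1) * norm h"
      by (simp only: abs_mult real_norm_def)
  qed auto
  also have "\<dots> \<le> (p + 1) * \<bar>s - t\<bar>" using assms by (intro mult_left_mono) auto
  finally have "p * \<bar>max 1 s powr (- p - 1) - max 1 t powr (- p - 1)\<bar> \<le> p * ((p + 1) * \<bar>s - t\<bar>)"
    using assms by (intro mult_left_mono) auto
  then show ?thesis using assms
    by (simp add: profile'_def abs_mult mult.assoc flip: right_diff_distrib abs_minus_commute)
qed

lemma antiderivative_vanishing_beyond_1:
  fixes g' :: "real \<Rightarrow> real"
  assumes "continuous_on UNIV g'" "\<And>t. t \<ge> 1 \<Longrightarrow> g' t = 0"
  obtains g where "\<And>t. t \<ge> 0 \<Longrightarrow> (g has_real_derivative g' t) (at t)" "\<And>t. t \<ge> 1 \<Longrightarrow> g t = 0"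
proof -
  \<comment> \<open>Starting at -1 makes t = 0, the squared norm at the centre, an interior point
    with a two-sided derivative.\<close>
  define g where "g t = integral {-1..t} g' - integral {-1..1} g'" for t
  have c: "continuous_on S g'" for S using assms(1) continuous_on_subset by blast
  have "(g has_real_derivative g' t) (at t)" if "t \<ge> 0" for t
  proof -
    have "((\<lambda>t. integral {-1..t} g') has_real_derivative g' t) (at t within {-1..t+1})"
      using that by (intro integral_has_real_derivative c) auto
    then have "((\<lambda>t. integral {-1..t} g') has_real_derivative g' t) (at t)"
      using that by (subst (asm) at_within_Icc_at) auto
    then show ?thesis unfolding g_def[abs_def] by (auto intro!: derivative_eq_intros)
  qed
  moreover have "g t = 0" if "t \<ge> 1" for t
  proof -
    have "integral {-1..1} g' + integral {1..t} g' = integral {-1..t} g'"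
      using that by (intro Henstock_Kurzweil_Integration.integral_combine integrable_continuous_real c) auto
    moreover have "integral {1..t} g' = integral {1..t} (\<lambda>_. 0)"
      using assms(2) by (intro Henstock_Kurzweil_Integration.integral_cong) auto
    ultimately show ?thesis by (simp add: g_def)
  qed
  ultimately show ?thesis using that by blast
qed

lemma unit_kernel_of_derivative_bound:
  fixes K :: "'a::euclidean_space \<Rightarrow> real"
  assumes "\<And>z. (K has_derivative K' z) (at z)" "\<And>z w. norm z \<le> 1 \<Longrightarrow> \<bar>K' z w\<bar> \<le> L * norm w"
    and "\<And>z. 1 \<le> norm z \<Longrightarrow> K z = 0" "0 \<le> L"
  shows "unit_kernel L K"
proof (rule unit_kernelI)
  fix z y :: 'a assume "norm z \<le> 1" "norm y \<le> 1"
  then have "norm (K z - K y) \<le> L * norm (z - y)"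
    using assms by (intro mean_value_bound[of "cball 0 1" K K'] has_derivative_at_withinI[OF assms(1)]) auto
  then show "\<bar>K z - K y\<bar> \<le> L * norm (z - y)" by simp
qed (use assms in auto)

lemma abs_inner_sq_diff:
  assumes "norm z \<le> 1" "norm y \<le> 1"
  shows "\<bar>z \<bullet> z - y \<bullet> y\<bar> \<le> 2 * norm (z - y :: 'a::real_inner)"
proof -
  have "z \<bullet> z - y \<bullet> y = (z - y) \<bullet> (z + y)" by (simp add: inner_diff_left inner_add_right inner_commute[of z y])
  also have "\<bar>\<dots>\<bar> \<le> norm (z - y) * norm (z + y)" by (rule Cauchy_Schwarz_ineq2)
  also have "\<dots> \<le> norm (z - y) * 2"
    using assms norm_triangle_ineq[of z y] by (intro mult_left_mono) auto
  finally show ?thesis by simp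
qed

lemma abs_inner_le_of_norm_le: "norm x \<le> a \<Longrightarrow> \<bar>x \<bullet> y\<bar> \<le> a * norm y"
  using Cauchy_Schwarz_ineq2[of x y] by (smt (verit) mult_right_mono norm_ge_zero)

text \<open>With p = n/2, the field V(x) = 2 \<open>profile p (x \<bullet> x)\<close> x equals a
  multiple of x / |x|^n outside the unit ball. By homogeneity it agrees there with 2^(n-1) V(2x), so
  the difference of the two is the gradient of a radial function with compact support. The
  divergence of V is the bump \<open>\<phi>\<close>, and that of the rescaled field is 2^n
  \<open>\<phi>\<close>(2x).\<close>

lemma kernel_exists:
  obtains \<kappa> :: "'a::euclidean_space \<Rightarrow> real" and \<kappa>1 \<kappa>2 \<phi> C
  where "0 < C" "unit_kernel C \<kappa>" "\<And>z. (\<kappa> has_derivative \<kappa>1 z) (at z)"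
    "\<And>v. unit_kernel (C * norm v) (\<lambda>z. \<kappa>1 z v)"
    "\<And>z v. ((\<lambda>z. \<kappa>1 z v) has_derivative \<kappa>2 z v) (at z)"
    "\<And>v w. unit_kernel (C * norm v * norm w) (\<lambda>z. \<kappa>2 z v w)"
    "\<And>z v w. \<kappa>2 z v w = \<kappa>2 z w v"
    "\<And>z. (\<Sum>e\<in>Basis. \<kappa>2 z e e) = \<phi> z - 2 ^ DIM('a) * \<phi> (2 *\<^sub>R z)"
    "unit_kernel C \<phi>" "(LINT z|lborel. \<phi> z) > 0"
proof -
  define n where "n = real DIM('a)"
  define p where "p = n / 2"
  have p: "p > 0" by (simp add: p_def n_def)
  define N :: real where "N = 2 ^ DIM('a)"
  have N: "N > 0" by (simp add: N_def)
  \<comment> \<open>Doubling x multiplies the squared norm by 4, hence the argument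
    \<open>4 * t\<close>; the powers cancel for t \<ge> 1 because
    \<open>4 powr p = N\<close>.\<close>
  define g1 where "g1 t = profile p t - N * profile p (4 * t)" for t
  define g2 where "g2 t = profile' p t - 4 * N * profile' p (4 * t)" for t
  have dg1: "(g1 has_real_derivative g2 t) (at t)" for t
    unfolding g1_def[abs_def] g2_def
    by (auto intro!: derivative_eq_intros profile_has_derivative DERIV_chain2[OF profile_has_derivative])
  have "(4::real) powr p = 2 powr n"
    unfolding p_def using powr_powr[of 2 2 "n/2"] by (simp flip: powr_realpow)
  then have N4: "(4::real) powr p = N" by (simp add: n_def N_def powr_realpow)
  then have N4': "N * 4 powr (- p) = 1" using N by (simp add: powr_minus)
  have g1_0: "g1 t = 0" if "t \<ge> 1" for t
  proof -
    have "N * (4 * t) powr (- p) = N * 4 powr (- p) * t powr (- p)" using that by (simp add: powr_mult)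
    then show ?thesis using that N4' by (simp add: g1_def profile_def)
  qed
  have g2_0: "g2 t = 0" if "t \<ge> 1" for t
  proof -
    have "4 * N * (4 * t) powr (- p - 1) = N * 4 powr (- p) * t powr (- p - 1)"
      using that by (simp add: powr_mult powr_diff)
    then show ?thesis using that N4' by (simp add: g2_def profile'_def)
  qed
  \<comment> \<open>The first summand bounds \<open>g2\<close>, and with it the slope of
    \<open>g1\<close>; the second is a Lipschitz constant of \<open>g2\<close>.\<close>
  define M where "M = (p + 4 * N * p) + (p * (p + 1) + 16 * N * (p * (p + 1)))"
  have M: "M > 0" using p N by (simp add: M_def add_pos_pos)
  have g2_b: "\<bar>g2 t\<bar> \<le> M" for t
  proof -
    have "\<bar>g2 t\<bar> \<le> \<bar>profile' p t\<bar> + 4 * N * \<bar>profile' p (4 * t)\<bar>"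
      using N unfolding g2_def by (intro order_trans[OF abs_triangle_ineq4]) (simp add: abs_mult)
    also have "\<dots> \<le> p + 4 * N * p"
      using p N by (intro add_mono mult_left_mono profile'_bound) auto
    also have "\<dots> \<le> M" using p N by (simp add: M_def)
    finally show ?thesis .
  qed
  have g2_l: "\<bar>g2 s - g2 t\<bar> \<le> M * \<bar>s - t\<bar>" for s t
  proof -
    have "4 * s - 4 * t = 4 * (s - t)" by simp
    then have 4: "\<bar>4 * s - 4 * t\<bar> = 4 * \<bar>s - t\<bar>" by (simp only: abs_mult)
    have "g2 s - g2 t = (profile' p s - profile' p t) - 4 * N * (profile' p (4 * s) - profile' p (4 * t))"
      by (simp add: g2_def algebra_simps)
    then have "\<bar>g2 s - g2 t\<bar> \<le> \<bar>profile' p s - profile' p t\<bar> + \<bar>4 * N * (profile' p (4 * s) - profile' p (4 * t))\<bar>"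
      by (simp only: abs_triangle_ineq4)
    moreover have "\<bar>4 * N * (profile' p (4 * s) - profile' p (4 * t))\<bar> \<le> 4 * N * (p * (p + 1) * (4 * \<bar>s - t\<bar>))"
      unfolding abs_mult[of "4 * N"] 4[symmetric]
      using p N by (intro mult_mono profile'_lipschitz) auto
    moreover have "\<bar>profile' p s - profile' p t\<bar> \<le> p * (p + 1) * \<bar>s - t\<bar>"
      using p by (intro profile'_lipschitz) auto
    moreover have "p * (p + 1) * \<bar>s - t\<bar> + 4 * N * (p * (p + 1) * (4 * \<bar>s - t\<bar>))
      = (p * (p + 1) + 16 * N * (p * (p + 1))) * \<bar>s - t\<bar>" by algebra
    moreover have "(p * (p + 1) + 16 * N * (p * (p + 1))) * \<bar>s - t\<bar> \<le> M * \<bar>s - t\<bar>"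
      using p N by (intro mult_right_mono) (auto simp: M_def)
    ultimately show ?thesis by linarith
  qed
  have g1_l: "\<bar>g1 s - g1 t\<bar> \<le> M * \<bar>s - t\<bar>" for s t
  proof -
    have "norm (g1 s - g1 t) \<le> M * norm (s - t)"
      using g2_b dg1
      by (intro mean_value_bound[of UNIV g1 "\<lambda>t h. g2 t * h"])
         (auto simp: has_field_derivative_def abs_mult intro!: mult_right_mono)
    then show ?thesis by simp
  qed
  have g1_b: "\<bar>g1 t\<bar> \<le> M" if "0 \<le> t" "t \<le> 1" for t
  proof -
    have "\<bar>g1 t\<bar> \<le> M * \<bar>t - 1\<bar>" using g1_l[of t 1] g1_0[of 1] by simp
    also have "\<dots> \<le> M * 1" using that M by (intro mult_left_mono) auto
    finally show ?thesis by simp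
  qed
  have "continuous_on UNIV g1"
    by (intro continuous_at_imp_continuous_on ballI DERIV_isCont[OF dg1])
  then obtain g where dg: "\<And>t. t \<ge> 0 \<Longrightarrow> (g has_real_derivative g1 t) (at t)" and g_0: "\<And>t. t \<ge> 1 \<Longrightarrow> g t = 0"
    using antiderivative_vanishing_beyond_1 g1_0 by blast
  define \<kappa> where "\<kappa> z = g (z \<bullet> z)" for z :: 'a
  define \<kappa>1 where "\<kappa>1 z v = 2 * (z \<bullet> v) * g1 (z \<bullet> z)" for z v :: 'a
  define \<kappa>2 where "\<kappa>2 z v w = 4 * ((z \<bullet> v) * (z \<bullet> w)) * g2 (z \<bullet> z) + 2 * (v \<bullet> w) * g1 (z \<bullet> z)" for z v w :: 'a
  define \<phi> where "\<phi> z = n * (n + 2) * max 0 (1 - z \<bullet> z)" for z :: 'a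
  have sq1: "z \<bullet> z \<le> 1" if "norm z \<le> 1" for z :: 'a
    using that by (simp add: norm_le_square)
  have sq2: "z \<bullet> z \<ge> 1" if "norm z \<ge> 1" for z :: 'a
    using that power_mono[of 1 "norm z" 2] by (simp add: power2_norm_eq_inner)
  have dsq: "((\<lambda>z. z \<bullet> z) has_derivative (\<lambda>w. 2 * (z \<bullet> w))) (at z)" for z :: 'a
    by (auto intro!: derivative_eq_intros simp: inner_commute)
  have d1: "(\<kappa> has_derivative \<kappa>1 z) (at z)" for z
    using has_derivative_compose[OF dsq[of z] dg[of "z \<bullet> z", unfolded has_field_derivative_def]]
    unfolding \<kappa>_def[abs_def] \<kappa>1_def[abs_def] by (simp add: mult_ac)
  have dgsq: "((\<lambda>z. g1 (z \<bullet> z)) has_derivative (\<lambda>w. g2 (z \<bullet> z) * (2 * (z \<bullet> w)))) (at z)" for z :: 'a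
    using has_derivative_compose[OF dsq[of z] dg1[of "z \<bullet> z", unfolded has_field_derivative_def]] .
  have dlin: "((\<lambda>z. 2 * (z \<bullet> v)) has_derivative (\<lambda>w. 2 * (w \<bullet> v))) (at z)" for z v :: 'a
    by (auto intro!: derivative_eq_intros)
  have d2: "((\<lambda>z. \<kappa>1 z v) has_derivative \<kappa>2 z v) (at z)" for z v
  proof -
    have "(\<lambda>w. 2 * (z \<bullet> v) * (g2 (z \<bullet> z) * (2 * (z \<bullet> w))) + 2 * (w \<bullet> v) * g1 (z \<bullet> z)) = \<kappa>2 z v"
      by (simp add: fun_eq_iff \<kappa>2_def inner_commute)
    then show ?thesis using has_derivative_mult[OF dlin[of v z] dgsq[of z]] unfolding \<kappa>1_def[abs_def] by simp
  qed
  have k1: "unit_kernel (2 * M) \<kappa>"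
  proof (rule unit_kernel_of_derivative_bound[OF d1])
    fix z w :: 'a assume z: "norm z \<le> 1"
    have "\<bar>\<kappa>1 z w\<bar> = 2 * (\<bar>z \<bullet> w\<bar> * \<bar>g1 (z \<bullet> z)\<bar>)" by (simp add: \<kappa>1_def abs_mult)
    also have "\<dots> \<le> 2 * ((1 * norm w) * M)"
      using z M by (intro mult_left_mono mult_mono abs_inner_le_of_norm_le g1_b sq1) auto
    finally show "\<bar>\<kappa>1 z w\<bar> \<le> 2 * M * norm w" by (simp add: mult_ac)
  qed (use M g_0 sq2 in \<open>auto simp: \<kappa>_def\<close>)
  have k2: "unit_kernel (6 * M * norm v) (\<lambda>z. \<kappa>1 z v)" for v
  proof (rule unit_kernel_of_derivative_bound[OF d2])
    fix z w :: 'a assume z: "norm z \<le> 1"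
    have "\<bar>\<kappa>2 z v w\<bar> \<le> 4 * ((\<bar>z \<bullet> v\<bar> * \<bar>z \<bullet> w\<bar>) * \<bar>g2 (z \<bullet> z)\<bar>) + 2 * (\<bar>v \<bullet> w\<bar> * \<bar>g1 (z \<bullet> z)\<bar>)"
      unfolding \<kappa>2_def by (intro order_trans[OF abs_triangle_ineq]) (simp add: abs_mult)
    also have "\<dots> \<le> 4 * (((1 * norm v) * (1 * norm w)) * M) + 2 * ((norm v * norm w) * M)"
      using z M by (intro add_mono mult_left_mono mult_mono abs_inner_le_of_norm_le g1_b g2_b sq1) auto
    finally show "\<bar>\<kappa>2 z v w\<bar> \<le> 6 * M * norm v * norm w" by (simp add: mult_ac)
  qed (use M g1_0 sq2 in \<open>auto simp: \<kappa>1_def\<close>)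
  have k3: "unit_kernel (20 * M * norm v * norm w) (\<lambda>z. \<kappa>2 z v w)" for v w
  proof (rule unit_kernelI)
    fix z y :: 'a assume z: "norm z \<le> 1" and y: "norm y \<le> 1"
    \<comment> \<open>The increment is telescoped by changing one factor at a time. The pieces cost
      1, 1, 2 and 2 times \<open>Q\<close> and have weights 4, 4, 4 and 2, which gives the constant
      20.\<close>
    define Q where "Q = M * norm v * norm w * norm (z - y)"
    define p1 where "p1 = ((z - y) \<bullet> v) * (z \<bullet> w) * g2 (z \<bullet> z)"
    define p2 where "p2 = (y \<bullet> v) * ((z - y) \<bullet> w) * g2 (z \<bullet> z)"
    define p3 where "p3 = (y \<bullet> v) * (y \<bullet> w) * (g2 (z \<bullet> z) - g2 (y \<bullet> y))"
    define p4 where "p4 = (v \<bullet> w) * (g1 (z \<bullet> z) - g1 (y \<bullet> y))"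
    have *: "\<bar>g2 (z \<bullet> z) - g2 (y \<bullet> y)\<bar> \<le> M * (2 * norm (z - y))"
      "\<bar>g1 (z \<bullet> z) - g1 (y \<bullet> y)\<bar> \<le> M * (2 * norm (z - y))"
      using abs_inner_sq_diff[OF z y] M
      by (auto intro: order_trans[OF g2_l] order_trans[OF g1_l] mult_left_mono)
    have "\<bar>p1\<bar> \<le> (norm (z - y) * norm v) * (1 * norm w) * M"
      unfolding p1_def abs_mult using z y M by (intro mult_mono abs_inner_le_of_norm_le g2_b) auto
    then have b1: "\<bar>p1\<bar> \<le> Q" by (simp add: Q_def mult_ac)
    have "\<bar>p2\<bar> \<le> (1 * norm v) * (norm (z - y) * norm w) * M"
      unfolding p2_def abs_mult using z y M by (intro mult_mono abs_inner_le_of_norm_le g2_b) auto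
    then have b2: "\<bar>p2\<bar> \<le> Q" by (simp add: Q_def mult_ac)
    have "\<bar>p3\<bar> \<le> (1 * norm v) * (1 * norm w) * (M * (2 * norm (z - y)))"
      unfolding p3_def abs_mult using z y M * by (intro mult_mono abs_inner_le_of_norm_le) auto
    then have b3: "\<bar>p3\<bar> \<le> 2 * Q" by (simp add: Q_def mult_ac)
    have "\<bar>p4\<bar> \<le> (norm v * norm w) * (M * (2 * norm (z - y)))"
      unfolding p4_def abs_mult using z y M * by (intro mult_mono abs_inner_le_of_norm_le) auto
    then have b4: "\<bar>p4\<bar> \<le> 2 * Q" by (simp add: Q_def mult_ac)
    have "\<kappa>2 z v w - \<kappa>2 y v w = 4 * p1 + 4 * p2 + 4 * p3 + 2 * p4"
      unfolding \<kappa>2_def p1_def p2_def p3_def p4_def inner_diff_left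
      by (simp only: algebra_simps)
    then have "\<bar>\<kappa>2 z v w - \<kappa>2 y v w\<bar> \<le> 20 * Q" using b1 b2 b3 b4 by linarith
    then show "\<bar>\<kappa>2 z v w - \<kappa>2 y v w\<bar> \<le> 20 * M * norm v * norm w * norm (z - y)"
      by (simp add: Q_def mult.assoc)
  qed (use M g1_0 g2_0 sq2 in \<open>auto simp: \<kappa>2_def\<close>)
  have k4: "unit_kernel (n * (n + 2) * 2) \<phi>"
  proof (rule unit_kernelI)
    fix z y :: 'a assume z: "norm z \<le> 1" and y: "norm y \<le> 1"
    have "\<bar>max 0 (1 - z \<bullet> z) - max 0 (1 - y \<bullet> y)\<bar> \<le> 2 * norm (z - y)"
      using abs_inner_sq_diff[OF z y] by (auto simp: max_def)
    then have "n * (n + 2) * \<bar>max 0 (1 - z \<bullet> z) - max 0 (1 - y \<bullet> y)\<bar> \<le> n * (n + 2) * (2 * norm (z - y))"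
      by (intro mult_left_mono) (auto simp: n_def)
    then show "\<bar>\<phi> z - \<phi> y\<bar> \<le> n * (n + 2) * 2 * norm (z - y)"
      unfolding \<phi>_def right_diff_distrib[symmetric] abs_mult by (simp add: n_def)
  qed (use sq2 in \<open>auto simp: \<phi>_def n_def\<close>)
  \<comment> \<open>The divergence of V in the variable t = z \<bullet> z: affine in t inside the
    unit ball and zero outside.\<close>
  have lap0: "4 * t * profile' p t + 2 * n * profile p t = n * (n + 2) * max 0 (1 - t)" if "t \<ge> 0" for t
  proof (cases "t \<le> 1")
    case True then show ?thesis by (simp add: profile_def profile'_def p_def field_simps)
  next
    case False
    then have "t * t powr (- p - 1) = t powr (- p)" by (simp add: powr_diff)
    then show ?thesis using False by (simp add: profile_def profile'_def p_def field_simps)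
  qed
  have lap: "(\<Sum>e\<in>Basis. \<kappa>2 z e e) = \<phi> z - 2 ^ DIM('a) * \<phi> (2 *\<^sub>R z)" for z
  proof -
    define t where "t = z \<bullet> z"
    have t: "t \<ge> 0" by (simp add: t_def)
    have "(\<Sum>e\<in>Basis. \<kappa>2 z e e) = 4 * t * g2 t + 2 * n * g1 t"
      by (simp add: \<kappa>2_def sum.distrib n_def t_def euclidean_inner[of z z] flip: sum_distrib_left sum_distrib_right)
    also have "\<dots> = (4 * t * profile' p t + 2 * n * profile p t)
      - N * (4 * (4 * t) * profile' p (4 * t) + 2 * n * profile p (4 * t))"
      by (simp add: g1_def g2_def algebra_simps)
    also have "\<dots> = \<phi> z - N * \<phi> (2 *\<^sub>R z)"
      using t by (subst (1 2) lap0) (auto simp: \<phi>_def t_def)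
    finally show ?thesis by (simp add: N_def)
  qed
  have pos: "(LINT z|lborel. \<phi> z) > 0"
  proof -
    have "0 < n * (n + 2) * (3 / 4) * measure lborel (cball (0::'a) (1/2))"
      using content_cball_pos[of "1/2" "0::'a"] by (simp add: n_def)
    also have "\<dots> = (LINT z|lborel. n * (n + 2) * (3 / 4) * indicator (cball (0::'a) (1/2)) z)" by simp
    also have "\<dots> \<le> (LINT z|lborel. \<phi> z)"
    proof (rule integral_mono)
      show "integrable lborel (\<lambda>z. n * (n + 2) * (3 / 4) * indicator (cball (0::'a) (1/2)) z)"
        by (intro integrable_mult_right integrable_real_indicator emeasure_bounded_finite) auto
      show "integrable lborel \<phi>"
        by (rule integrable_continuous_cball[of _ 1])
           (use k4 continuous_on_unit_kernel[OF k4] in \<open>auto simp: unit_kernel_def\<close>)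
      fix z :: 'a
      have "z \<bullet> z \<le> 1 / 4" if "norm z \<le> 1/2"
        using power_mono[OF that norm_ge_zero, of 2] by (simp add: power2_norm_eq_inner power_divide)
      then have "(3 / 4) * indicator (cball (0::'a) (1/2)) z \<le> max 0 (1 - z \<bullet> z)"
        by (auto simp: indicator_def)
      then show "n * (n + 2) * (3 / 4) * indicator (cball (0::'a) (1/2)) z \<le> \<phi> z"
        unfolding \<phi>_def mult.assoc by (intro mult_left_mono) (auto simp: n_def)
    qed
    finally show ?thesis .
  qed
  have mono: "unit_kernel L' K" if "unit_kernel L K" "L \<le> L'" for L L' and K :: "'a \<Rightarrow> real"
  proof -
    have "L * norm (z - y) \<le> L' * norm (z - y)" for z y :: 'a using that(2) by (rule mult_right_mono) simp
    then show ?thesis using that unfolding unit_kernel_def by (meson order_trans)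
  qed
  define C where "C = 20 * M + n * (n + 2) * 2"
  have C: "C \<ge> 20 * M" "C \<ge> n * (n + 2) * 2" "0 < C" using M by (auto simp: C_def n_def add_pos_nonneg)
  show ?thesis
  proof (rule that[of C \<kappa> \<kappa>1 \<kappa>2 \<phi>])
    show "unit_kernel C \<kappa>" using k1 C M by (elim mono) linarith
    show "unit_kernel (C * norm v) (\<lambda>z. \<kappa>1 z v)" for v
      using k2[of v] by (rule mono) (use C M in \<open>auto intro!: mult_right_mono\<close>)
    show "unit_kernel (C * norm v * norm w) (\<lambda>z. \<kappa>2 z v w)" for v w
      using k3[of v w] by (rule mono) (use C M in \<open>auto intro!: mult_right_mono\<close>)
    show "unit_kernel C \<phi>" using k4 C(2) by (rule mono)
    show "\<kappa>2 z v w = \<kappa>2 z w v" for z v w by (simp add: \<kappa>2_def inner_commute mult_ac)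
  qed (use C d1 d2 lap pos in auto)
qed

section \<open>A parametrix for the Laplacian\<close>

text \<open>The summable bounds \<open>c n\<close> make the differentiated series converge uniformly
  in the point, as in the Weierstrass test, and this permits termwise differentiation.\<close>

lemma has_derivative_suminf:
  fixes F :: "nat \<Rightarrow> 'a::real_normed_vector \<Rightarrow> 'b::banach"
  assumes F: "\<And>n x. (F n has_derivative F' n x) (at x)"
    and bound: "\<And>n x h. norm (F' n x h) \<le> c n * norm h" and c: "summable c"
    and sF: "\<And>x. summable (\<lambda>n. F n x)"
  shows "((\<lambda>x. \<Sum>n. F n x) has_derivative (\<lambda>h. \<Sum>n. F' n x h)) (at x)"
proof -
  have sn: "summable (\<lambda>n. norm (F' n x h))" for x h
    by (rule summable_comparison_test'[OF summable_mult2[OF c, of "norm h"], of 0]) (use bound in auto)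
  have "\<exists>g. \<forall>x\<in>UNIV. (\<lambda>n. F n x) sums g x \<and> (g has_derivative (\<lambda>h. \<Sum>n. F' n x h)) (at x within UNIV)"
  proof (rule has_derivative_series[OF _ _ _ _ summable_sums[OF sF]])
    fix e :: real assume "e > 0"
    obtain N where N: "\<And>n. n \<ge> N \<Longrightarrow> norm (\<Sum>i. c (i + n)) < e"
      using suminf_exist_split[OF \<open>e > 0\<close> c] by blast
    show "\<forall>\<^sub>F n in sequentially. \<forall>x\<in>UNIV. \<forall>h. norm ((\<Sum>i<n. F' i x h) - (\<Sum>n. F' n x h)) \<le> e * norm h"
    proof (rule eventually_sequentiallyI[of N], intro ballI allI)
      fix n x h assume n: "N \<le> n"
      have s': "summable (\<lambda>i. c (i + n))" using c by (rule summable_ignore_initial_segment)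
      have "norm ((\<Sum>i<n. F' i x h) - (\<Sum>n. F' n x h)) = norm (\<Sum>i. F' (i + n) x h)"
        using suminf_split_initial_segment[OF summable_norm_cancel[OF sn], of x h n] by simp
      also have "\<dots> \<le> (\<Sum>i. norm (F' (i + n) x h))"
        by (rule summable_norm) (rule summable_ignore_initial_segment[OF sn])
      also have "\<dots> \<le> (\<Sum>i. c (i + n) * norm h)"
        by (intro suminf_le bound summable_mult2 s' summable_ignore_initial_segment[OF sn])
      also have "\<dots> = (\<Sum>i. c (i + n)) * norm h" using suminf_mult2[OF s'] by simp
      also have "\<dots> \<le> e * norm h" using N[OF n] by (intro mult_right_mono) auto
      finally show "norm ((\<Sum>i<n. F' i x h) - (\<Sum>n. F' n x h)) \<le> e * norm h" .
    qed
  qed (use F in auto)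
  then obtain g where g: "\<And>x. (\<lambda>n. F n x) sums g x" "(g has_derivative (\<lambda>h. \<Sum>n. F' n x h)) (at x)"
    by auto
  then have "g = (\<lambda>x. \<Sum>n. F n x)" using sums_unique by blast
  then show ?thesis using g by simp
qed

lemma geometric_tail_bound:
  fixes a :: "nat \<Rightarrow> 'b::banach"
  assumes "\<And>k. norm (a k) \<le> A * q ^ k" "0 \<le> q" "q < 1"
  shows "summable a" "norm (\<Sum>k. a k) \<le> A / (1 - q)"
proof -
  have g: "(\<lambda>k. A * q ^ k) sums (A * (1 / (1 - q)))"
    using assms by (intro sums_mult geometric_sums) auto
  have n: "summable (\<lambda>k. norm (a k))"
    by (rule summable_comparison_test'[OF sums_summable[OF g], of 0]) (use assms in auto)
  then show "summable a" by (rule summable_norm_cancel)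
  have "norm (\<Sum>k. a k) \<le> (\<Sum>k. norm (a k))" using n by (rule summable_norm)
  also have "\<dots> \<le> (\<Sum>k. A * q ^ k)" using assms n sums_summable[OF g] by (intro suminf_le) auto
  also have "\<dots> = A / (1 - q)" using sums_unique[OF g] by simp
  finally show "norm (\<Sum>k. a k) \<le> A / (1 - q)" .
qed

lemma power_powr: "0 \<le> x \<Longrightarrow> (x ^ k) powr a = (x powr a) ^ k" for x a :: real
  by (induction k) (simp_all add: powr_mult)

lemma half_power_powr: "((1/2) ^ k) powr a = ((1/2) powr a) ^ k" for a :: real
  by (rule power_powr) simp

text \<open>Terms at scales \<open>\<le> h\<close> are estimated by size, terms at scales \<open>\<ge> h\<close> by their increments.\<close>

lemma dyadic_sum_bound:
  fixes a :: "nat \<Rightarrow> 'b::banach"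
  assumes \<alpha>: "0 < \<alpha>" "\<alpha> < 1" and h: "0 < h" "h \<le> 1" and "0 \<le> B"
    and a1: "\<And>k. norm (a k) \<le> B * ((1/2) ^ k) powr \<alpha>"
    and a2: "\<And>k. h \<le> (1/2) ^ k \<Longrightarrow> norm (a k) \<le> B * (h / (1/2) ^ k) * ((1/2) ^ k) powr \<alpha>"
  shows "norm (\<Sum>k. a k) \<le> B * (1 / (1 - (1/2) powr (1 - \<alpha>)) + 1 / (1 - (1/2) powr \<alpha>)) * h powr \<alpha>"
proof -
  define q where "q = (1/2 :: real) powr \<alpha>"
  define r where "r = (1/2 :: real) powr (1 - \<alpha>)"
  have q: "0 < q" "q < 1" using \<alpha> powr_less_mono2[of \<alpha> "1/2" 1] by (auto simp: q_def)
  have r: "0 < r" "r < 1" using \<alpha> powr_less_mono2[of "1 - \<alpha>" "1/2" 1] by (auto simp: r_def)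
  obtain j where "(1/2) ^ j < h" using real_arch_pow_inv[of h "1/2"] h(1) by auto
  moreover have "(1/2 :: real) ^ Suc j \<le> (1/2) ^ j" by (intro power_decreasing) auto
  ultimately have ex: "\<exists>m. (1/2) ^ Suc m < h" using le_less_trans by blast
  \<comment> \<open>\<open>(1/2) ^ m\<close> is the last dyadic scale not below \<open>h\<close>. Up
    to index \<open>m\<close> the increment bound applies, beyond it only the size bound.\<close>
  define m where "m = (LEAST m. (1/2) ^ Suc m < h)"
  have m1: "(1/2) ^ Suc m < h" using ex unfolding m_def by (rule LeastI_ex)
  have m2: "h \<le> (1/2) ^ m"
  proof (cases m)
    case (Suc j)
    then have "\<not> (1/2) ^ Suc j < h" using not_less_Least[of j "\<lambda>m. (1/2) ^ Suc m < h"] by (simp add: m_def)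
    then show ?thesis using Suc by simp
  qed (use h in simp)
  have small: "norm (a (k + Suc m)) \<le> (B * h powr \<alpha>) * q ^ k" for k
  proof -
    have "((1/2) ^ (k + Suc m)) powr \<alpha> = ((1/2) ^ Suc m) powr \<alpha> * q ^ k"
      unfolding half_power_powr q_def by (simp only: power_add mult.commute)
    also have "\<dots> \<le> h powr \<alpha> * q ^ k"
      using m1 \<alpha> q by (intro mult_right_mono powr_mono2) auto
    finally have "B * ((1/2) ^ (k + Suc m)) powr \<alpha> \<le> B * (h powr \<alpha> * q ^ k)"
      using \<open>0 \<le> B\<close> by (rule mult_left_mono)
    then show ?thesis using a1[of "k + Suc m"] by (simp add: mult.assoc)
  qed
  have large: "norm (a k) \<le> (B * h powr \<alpha>) * r ^ (m - k)" if k: "k \<le> m" for k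
  proof -
    define s where "s = (1/2 :: real) ^ k"
    have s: "0 < s" by (simp add: s_def)
    have mk: "(1/2) ^ m = s * (1/2) ^ (m - k)" using k by (simp add: s_def flip: power_add)
    have "(1/2) ^ m \<le> s" unfolding s_def using k by (intro power_decreasing) auto
    then have hs: "h \<le> s" using m2 by linarith
    have "(h / s) * s powr \<alpha> = h powr \<alpha> * (h / s) powr (1 - \<alpha>)"
      using h(1) s by (simp add: powr_diff powr_divide field_simps)
    also have "\<dots> \<le> h powr \<alpha> * ((1/2) ^ (m - k)) powr (1 - \<alpha>)"
      using m2 mk s h(1) \<alpha> by (intro mult_left_mono powr_mono2) (auto simp: field_simps)
    also have "((1/2) ^ (m - k)) powr (1 - \<alpha>) = r ^ (m - k)" by (simp only: half_power_powr r_def)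
    finally have "B * ((h / s) * s powr \<alpha>) \<le> B * (h powr \<alpha> * r ^ (m - k))"
      using \<open>0 \<le> B\<close> by (rule mult_left_mono)
    then show ?thesis using a2[of k] hs by (simp add: s_def mult.assoc)
  qed
  have sa: "summable a"
    by (rule geometric_tail_bound(1)[of a B q]) (use a1 q in \<open>auto simp: half_power_powr q_def\<close>)
  \<comment> \<open>Counted backwards from \<open>m\<close>, the coarse terms form a geometric
    series with ratio \<open>r\<close>, so their number does not enter the bound.\<close>
  have "norm (\<Sum>k<Suc m. a k) \<le> (\<Sum>k<Suc m. (B * h powr \<alpha>) * r ^ (m - k))"
    by (intro sum_norm_le large) auto
  also have "\<dots> = (\<Sum>k<Suc m. (B * h powr \<alpha>) * r ^ k)"
    using sum.nat_diff_reindex[of "\<lambda>k. (B * h powr \<alpha>) * r ^ k" "Suc m"] by simp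
  also have "\<dots> \<le> (\<Sum>k. (B * h powr \<alpha>) * r ^ k)"
    using r \<open>0 \<le> B\<close> by (intro sum_le_suminf summable_mult summable_geometric) auto
  also have "\<dots> = B * h powr \<alpha> / (1 - r)"
    using r by (subst suminf_mult) (auto simp: suminf_geometric)
  finally have b1: "norm (\<Sum>k<Suc m. a k) \<le> B * h powr \<alpha> / (1 - r)" .
  have b2: "norm (\<Sum>k. a (k + Suc m)) \<le> B * h powr \<alpha> / (1 - q)"
    using small q by (intro geometric_tail_bound(2)) auto
  have split: "(\<Sum>k. a k) = (\<Sum>k. a (k + Suc m)) + (\<Sum>k<Suc m. a k)"
    by (rule suminf_split_initial_segment[OF sa])
  have "norm (\<Sum>k. a k) \<le> B * h powr \<alpha> / (1 - q) + B * h powr \<alpha> / (1 - r)"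
    unfolding split by (rule order_trans[OF norm_triangle_ineq add_mono[OF b2 b1]])
  then show ?thesis by (simp add: q_def r_def algebra_simps add_divide_distrib)
qed


text \<open>Size and seminorm are separate numbers because they act separately: \<open>k\<close>
  controls the second derivatives of the potential, \<open>M\<close> the averaging error. After
  recentring on a small ball, \<open>M\<close> is small relative to \<open>k\<close>.\<close>

definition globally_hoelder ::
  "real \<Rightarrow> real \<Rightarrow> real \<Rightarrow> ('a::euclidean_space \<Rightarrow> 'b::euclidean_space) \<Rightarrow> bool" where
  "globally_hoelder \<alpha> M k f \<longleftrightarrow> 0 \<le> k \<and>
    (\<forall>x y. norm (f x - f y) \<le> k * norm (x - y) powr \<alpha>) \<and> (\<forall>x. norm (f x) \<le> M)"

lemma globally_hoelder_continuous:
  assumes "globally_hoelder \<alpha> M k f" "0 < \<alpha>"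
  shows "continuous_on S f"
proof -
  have "isCont f x" for x
  proof -
    have "((\<lambda>y. norm (y - x)) \<longlongrightarrow> norm (x - x)) (at x)" by (intro tendsto_intros)
    then have n: "((\<lambda>y. norm (y - x)) \<longlongrightarrow> 0) (at x)" by simp
    have "((\<lambda>y. k * norm (y - x) powr \<alpha>) \<longlongrightarrow> 0) (at x)"
      by (rule tendsto_mult_right_zero[OF tendsto_zero_powrI[OF n tendsto_const _ assms(2)]]) simp
    then have "((\<lambda>y. f y - f x) \<longlongrightarrow> 0) (at x)"
      using assms(1) by (elim Lim_null_comparison[OF always_eventually, rotated]) (auto simp: globally_hoelder_def)
    then show ?thesis by (simp add: isCont_def LIM_zero_iff)
  qed
  then show ?thesis by (intro continuous_at_imp_continuous_on) auto
qed

locale laplace_kernel =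
  fixes \<kappa> :: "'a::euclidean_space \<Rightarrow> real" and \<kappa>1 \<kappa>2 \<phi> and C \<alpha> V1 V2 :: real
  assumes C: "0 < C"
    and k0: "unit_kernel C \<kappa>" and d0: "\<And>z. (\<kappa> has_derivative \<kappa>1 z) (at z)"
    and k1: "\<And>v. unit_kernel (C * norm v) (\<lambda>z. \<kappa>1 z v)"
    and d1: "\<And>z v. ((\<lambda>z. \<kappa>1 z v) has_derivative \<kappa>2 z v) (at z)"
    and k2: "\<And>v w. unit_kernel (C * norm v * norm w) (\<lambda>z. \<kappa>2 z v w)"
    and sym: "\<And>z v w. \<kappa>2 z v w = \<kappa>2 z w v"
    and lap: "\<And>z. (\<Sum>e\<in>Basis. \<kappa>2 z e e) = \<phi> z - 2 ^ DIM('a) * \<phi> (2 *\<^sub>R z)"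
    and kp: "unit_kernel C \<phi>" and pos: "(LINT z|lborel. \<phi> z) > 0"
    and \<alpha>: "0 < \<alpha>" "\<alpha> < 1"
    and V1: "V1 = measure lborel (cball (0::'a) 1)" and V2: "V2 = measure lborel (cball (0::'a) 2)"
begin

definition c where "c = 1 / (LINT z|lborel. \<phi> z)"

text \<open>The squared scale balances two differentiations, each of which costs one inverse scale.
  The second derivatives thus add up without weights, and their convergence rests on the Hoelder
  continuity of \<open>f\<close>.\<close>

definition pot :: "('a \<Rightarrow> 'b::euclidean_space) \<Rightarrow> 'a \<Rightarrow> 'b" where
  "pot f x = - (c *\<^sub>R (\<Sum>k. ((1/2) ^ k)\<^sup>2 *\<^sub>R conv \<kappa> ((1/2) ^ k) f x))"
definition pot1 :: "('a \<Rightarrow> 'b::euclidean_space) \<Rightarrow> 'a \<Rightarrow> 'a \<Rightarrow> 'b" where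
  "pot1 f x v = c *\<^sub>R (\<Sum>k. (1/2) ^ k *\<^sub>R conv (\<lambda>z. \<kappa>1 z v) ((1/2) ^ k) f x)"
definition pot2 :: "('a \<Rightarrow> 'b::euclidean_space) \<Rightarrow> 'a \<Rightarrow> 'a \<Rightarrow> 'a \<Rightarrow> 'b" where
  "pot2 f x v w = - (c *\<^sub>R (\<Sum>k. conv (\<lambda>z. \<kappa>2 z v w) ((1/2) ^ k) f x))"
definition avg :: "('a \<Rightarrow> 'b::euclidean_space) \<Rightarrow> 'a \<Rightarrow> 'b" where
  "avg f x = c *\<^sub>R conv \<phi> 1 f x"

lemmas conv_bound_V1 = conv_bound[where 'a = 'a, folded V1]
lemmas conv_increment_bound_V2 = conv_increment_bound[where 'a = 'a, folded V2]

lemma V_nonneg: "0 \<le> V1" "0 \<le> V2" by (simp_all add: V1 V2)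

lemma c_pos: "c > 0" using pos by (simp add: c_def)

text \<open>\<open>\<kappa>2\<close> is a derivative of a compactly supported kernel and so has mean
  zero. This is read off by differentiating the convolution of \<open>\<kappa>1\<close> with a
  constant, which does not depend on the point.\<close>

lemma conv_\<kappa>2_const: "conv (\<lambda>z. \<kappa>2 z v w) d (\<lambda>_. b :: 'b::euclidean_space) x = 0"
proof -
  have "(conv (\<lambda>z. \<kappa>1 z v) 1 (\<lambda>_. b) has_derivative (\<lambda>h. - conv (\<lambda>z. \<kappa>2 z v h) 1 (\<lambda>_. b) x /\<^sub>R 1)) (at x)"
    by (rule conv_has_derivative[OF k1 d1, where L = "C * norm v" and m = "norm b"]) (use k2 in auto)
  moreover have "(conv (\<lambda>z. \<kappa>1 z v) 1 (\<lambda>_. b) has_derivative (\<lambda>h. 0)) (at x)"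
    unfolding conv_def by simp
  ultimately have "(\<lambda>h. - conv (\<lambda>z. \<kappa>2 z v h) 1 (\<lambda>_. b) x /\<^sub>R 1) = (\<lambda>h. 0)"
    by (rule has_derivative_unique)
  from fun_cong[OF this, of w] have "conv (\<lambda>z. \<kappa>2 z v w) 1 (\<lambda>_. b) x = 0" by simp
  then show ?thesis by (simp add: conv_def)
qed

context
  fixes f :: "'a \<Rightarrow> 'b::euclidean_space" and M k :: real
  assumes f: "globally_hoelder \<alpha> M k f"
begin

lemma contf: "continuous_on S f" using globally_hoelder_continuous[OF f \<alpha>(1)] .

lemma k_nonneg: "k \<ge> 0" using f by (simp add: globally_hoelder_def)
lemma bounded_f: "norm (f x) \<le> M" using f by (simp add: globally_hoelder_def)
lemma M_nonneg: "M \<ge> 0" by (rule order_trans[OF norm_ge_zero bounded_f])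

text \<open>Mean zero allows any constant to be subtracted; with b = f x only the oscillation of
  \<open>f\<close> at the scale of the kernel remains.\<close>

lemma conv_\<kappa>2_recenter: "conv (\<lambda>z. \<kappa>2 z v w) d f x = conv (\<lambda>z. \<kappa>2 z v w) d (\<lambda>z. f z - b) x"
  using conv_diff[OF k2 contf continuous_on_const, of v w d b x] conv_\<kappa>2_const by simp

lemma hoelder_bound_scaled:
  assumes "norm z \<le> r" "d > 0"
  shows "norm (f (x + d *\<^sub>R z) - f x) \<le> k * (r * d) powr \<alpha>"
proof -
  have "norm (f (x + d *\<^sub>R z) - f x) \<le> k * norm (d *\<^sub>R z) powr \<alpha>"
    using f unfolding globally_hoelder_def by (metis add_diff_cancel_left')
  also have "\<dots> \<le> k * (r * d) powr \<alpha>"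
    using assms \<alpha> k_nonneg by (intro mult_left_mono powr_mono2) (auto simp: mult.commute)
  finally show ?thesis .
qed

lemma conv_\<kappa>2_bound:
  assumes "d > 0"
  shows "norm (conv (\<lambda>z. \<kappa>2 z v w) d f x) \<le> (2 * C * V1 * k * norm v * norm w) * d powr \<alpha>"
proof -
  have "norm (conv (\<lambda>z. \<kappa>2 z v w) d (\<lambda>z. f z - f x) x) \<le> 2 * (C * norm v * norm w) * (k * (1 * d) powr \<alpha>) * V1"
    using assms by (intro conv_bound_V1[OF k2] hoelder_bound_scaled) (auto intro!: continuous_intros contf)
  then show ?thesis using conv_\<kappa>2_recenter[of v w d x "f x"] by (simp add: mult_ac)
qed

lemma conv_\<kappa>2_increment:
  assumes "norm h \<le> d" "d > 0"
  shows "norm (conv (\<lambda>z. \<kappa>2 z v w) d f (x + h) - conv (\<lambda>z. \<kappa>2 z v w) d f x)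
    \<le> (C * 2 powr \<alpha> * V2 * k * norm v * norm w) * (norm h / d) * d powr \<alpha>"
proof -
  have "norm (conv (\<lambda>z. \<kappa>2 z v w) d (\<lambda>z. f z - f x) (x + h) - conv (\<lambda>z. \<kappa>2 z v w) d (\<lambda>z. f z - f x) x)
    \<le> (C * norm v * norm w) * (norm h / d) * (k * (2 * d) powr \<alpha>) * V2"
    using assms by (intro conv_increment_bound_V2[OF k2] hoelder_bound_scaled) (auto intro!: continuous_intros contf)
  then show ?thesis
    using conv_\<kappa>2_recenter[of v w d x "f x"] conv_\<kappa>2_recenter[of v w d "x + h" "f x"] assms
    by (simp add: mult_ac powr_mult)
qed

lemma summable_pot: "summable (\<lambda>j. ((1/2) ^ j)\<^sup>2 *\<^sub>R conv \<kappa> ((1/2) ^ j) f x)"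
proof (rule geometric_tail_bound(1)[where q = "1/4" and A = "2 * C * M * V1"])
  fix j :: nat
  have "norm (conv \<kappa> ((1/2) ^ j) f x) \<le> 2 * C * M * V1"
    by (intro conv_bound_V1[OF k0 contf] bounded_f)
  moreover have "((1/2) ^ j)\<^sup>2 = (1/4 :: real) ^ j" by (simp add: power2_eq_square flip: power_mult_distrib)
  ultimately show "norm (((1/2) ^ j)\<^sup>2 *\<^sub>R conv \<kappa> ((1/2) ^ j) f x) \<le> 2 * C * M * V1 * (1/4) ^ j"
    by (simp add: mult.commute mult_left_mono)
qed auto

lemma pot1_term_bound:
  "norm ((1/2) ^ j *\<^sub>R conv (\<lambda>z. \<kappa>1 z v) ((1/2) ^ j) f x) \<le> 2 * C * M * V1 * (1/2) ^ j * norm v"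
proof -
  have "norm (conv (\<lambda>z. \<kappa>1 z v) ((1/2) ^ j) f x) \<le> 2 * (C * norm v) * M * V1"
    by (intro conv_bound_V1[OF k1 contf] bounded_f)
  then have "(1/2) ^ j * norm (conv (\<lambda>z. \<kappa>1 z v) ((1/2) ^ j) f x) \<le> (1/2) ^ j * (2 * (C * norm v) * M * V1)"
    by (rule mult_left_mono) simp
  then show ?thesis by (simp add: mult_ac)
qed

lemma summable_pot1: "summable (\<lambda>j. (1/2) ^ j *\<^sub>R conv (\<lambda>z. \<kappa>1 z v) ((1/2) ^ j) f x)"
  by (rule geometric_tail_bound(1)[where q = "1/2" and A = "2 * C * M * V1 * norm v"])
     (use pot1_term_bound in \<open>auto simp: mult_ac\<close>)

lemma half_powr_lt_1: "(1/2) powr \<alpha> < 1"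
  using \<alpha> powr_less_mono2[of \<alpha> "1/2" 1] by auto

lemma pot2_term_bound:
  "norm (conv (\<lambda>z. \<kappa>2 z v w) ((1/2) ^ j) f x) \<le> (2 * C * V1 * k * norm v * norm w) * ((1/2) powr \<alpha>) ^ j"
  using conv_\<kappa>2_bound[of "(1/2) ^ j"] by (simp only: half_power_powr) simp

lemma summable_pot2: "summable (\<lambda>j. conv (\<lambda>z. \<kappa>2 z v w) ((1/2) ^ j) f x)"
  by (rule geometric_tail_bound(1)[OF pot2_term_bound]) (use half_powr_lt_1 in auto)

lemma pot_has_derivative: "(pot f has_derivative pot1 f x) (at x)"
proof -
  have "((\<lambda>x. \<Sum>j. ((1/2) ^ j)\<^sup>2 *\<^sub>R conv \<kappa> ((1/2) ^ j) f x) has_derivative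
      (\<lambda>h. \<Sum>j. - ((1/2) ^ j *\<^sub>R conv (\<lambda>z. \<kappa>1 z h) ((1/2) ^ j) f x))) (at x)"
  proof (rule has_derivative_suminf)
    fix j x
    have "(conv \<kappa> ((1/2) ^ j) f has_derivative (\<lambda>h. - conv (\<lambda>z. \<kappa>1 z h) ((1/2) ^ j) f x /\<^sub>R (1/2) ^ j)) (at x)"
      by (rule conv_has_derivative[OF k0 d0 k1 contf bounded_f]) simp
    from bounded_linear.has_derivative[OF bounded_linear_scaleR_right this, of "((1/2) ^ j)\<^sup>2"]
    show "((\<lambda>x. ((1/2) ^ j)\<^sup>2 *\<^sub>R conv \<kappa> ((1/2) ^ j) f x) has_derivative
      (\<lambda>h. - ((1/2) ^ j *\<^sub>R conv (\<lambda>z. \<kappa>1 z h) ((1/2) ^ j) f x))) (at x)"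
      by (simp add: power2_eq_square power_divide)
  next
    show "norm (- ((1/2) ^ j *\<^sub>R conv (\<lambda>z. \<kappa>1 z h) ((1/2) ^ j) f x)) \<le> 2 * C * M * V1 * (1/2) ^ j * norm h" for j x h
      using pot1_term_bound by (simp only: norm_minus_cancel)
  qed (auto intro!: summable_mult summable_geometric summable_pot)
  then have "((\<lambda>x. - (c *\<^sub>R (\<Sum>j. ((1/2) ^ j)\<^sup>2 *\<^sub>R conv \<kappa> ((1/2) ^ j) f x))) has_derivative
      (\<lambda>h. - (c *\<^sub>R (\<Sum>j. - ((1/2) ^ j *\<^sub>R conv (\<lambda>z. \<kappa>1 z h) ((1/2) ^ j) f x))))) (at x)"
    by (intro derivative_intros)
  then show ?thesis
    unfolding pot_def[abs_def] pot1_def[abs_def] using suminf_minus[OF summable_pot1] by simp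
qed

lemma pot1_has_derivative: "((\<lambda>x. pot1 f x v) has_derivative pot2 f x v) (at x)"
proof -
  have "((\<lambda>x. \<Sum>j. (1/2) ^ j *\<^sub>R conv (\<lambda>z. \<kappa>1 z v) ((1/2) ^ j) f x) has_derivative
      (\<lambda>h. \<Sum>j. - conv (\<lambda>z. \<kappa>2 z v h) ((1/2) ^ j) f x)) (at x)"
  proof (rule has_derivative_suminf)
    fix j x
    have "(conv (\<lambda>z. \<kappa>1 z v) ((1/2) ^ j) f has_derivative (\<lambda>h. - conv (\<lambda>z. \<kappa>2 z v h) ((1/2) ^ j) f x /\<^sub>R (1/2) ^ j)) (at x)"
      by (rule conv_has_derivative[OF k1 d1 k2 contf bounded_f]) simp
    from bounded_linear.has_derivative[OF bounded_linear_scaleR_right this, of "(1/2) ^ j"]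
    show "((\<lambda>x. (1/2) ^ j *\<^sub>R conv (\<lambda>z. \<kappa>1 z v) ((1/2) ^ j) f x) has_derivative
      (\<lambda>h. - conv (\<lambda>z. \<kappa>2 z v h) ((1/2) ^ j) f x)) (at x)"
      by simp
  next
    show "norm (- conv (\<lambda>z. \<kappa>2 z v h) ((1/2) ^ j) f x) \<le> (2 * C * V1 * k * norm v) * ((1/2) powr \<alpha>) ^ j * norm h" for j x h
      using pot2_term_bound[of v h j x] by (simp add: mult_ac)
  qed (use half_powr_lt_1 in \<open>auto intro!: summable_mult summable_geometric summable_pot1\<close>)
  then have "((\<lambda>x. c *\<^sub>R (\<Sum>j. (1/2) ^ j *\<^sub>R conv (\<lambda>z. \<kappa>1 z v) ((1/2) ^ j) f x)) has_derivative
      (\<lambda>h. c *\<^sub>R (\<Sum>j. - conv (\<lambda>z. \<kappa>2 z v h) ((1/2) ^ j) f x))) (at x)"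
    by (intro derivative_intros)
  then show ?thesis
    unfolding pot2_def[abs_def] pot1_def[abs_def] using suminf_minus[OF summable_pot2] by simp
qed

lemma pot2_commute: "pot2 f x v w = pot2 f x w v"
  unfolding pot2_def by (subst sym) simp

text \<open>The subtracted bump at scale d is the original bump at scale d / 2; hence the
  cancellation of consecutive terms in \<open>laplacian_pot\<close>.\<close>

lemma conv_dilate: "conv (\<lambda>z. 2 ^ DIM('a) * \<phi> (2 *\<^sub>R z)) d f x = conv \<phi> (d / 2) f x"
proof -
  have "conv \<phi> (d / 2) f x = 2 ^ DIM('a) *\<^sub>R (LINT z|lborel. \<phi> (2 *\<^sub>R z) *\<^sub>R f (x + (d / 2) *\<^sub>R (2 *\<^sub>R z)))"
    unfolding conv_def
    by (rule integral_dilate[symmetric])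
       (auto intro!: continuous_intros continuous_on_unit_kernel[OF kp] continuous_on_compose2[OF contf[of UNIV]])
  moreover have "(d / 2) *\<^sub>R (2 *\<^sub>R z) = d *\<^sub>R z" for z :: 'a by simp
  ultimately have "conv \<phi> (d / 2) f x = 2 ^ DIM('a) *\<^sub>R (LINT z|lborel. \<phi> (2 *\<^sub>R z) *\<^sub>R f (x + d *\<^sub>R z))"
    by (simp only:)
  then show ?thesis using conv_scale_kernel[of "2 ^ DIM('a)" "\<lambda>z. \<phi> (2 *\<^sub>R z)" d f x]
    by (simp only: conv_def)
qed

lemma unit_kernel_dilate: "unit_kernel (2 ^ DIM('a) * (2 * C)) (\<lambda>z. 2 ^ DIM('a) * \<phi> (2 *\<^sub>R z))"
proof (unfold unit_kernel_def, intro conjI allI impI)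
  fix z y
  have "\<bar>\<phi> (2 *\<^sub>R z) - \<phi> (2 *\<^sub>R y)\<bar> \<le> C * norm (2 *\<^sub>R z - 2 *\<^sub>R y)"
    using kp unfolding unit_kernel_def by blast
  also have "\<dots> = 2 * C * norm (z - y)" by (simp flip: scaleR_diff_right)
  finally have "2 ^ DIM('a) * \<bar>\<phi> (2 *\<^sub>R z) - \<phi> (2 *\<^sub>R y)\<bar> \<le> 2 ^ DIM('a) * (2 * C * norm (z - y))"
    by (rule mult_left_mono) simp
  then show "\<bar>2 ^ DIM('a) * \<phi> (2 *\<^sub>R z) - 2 ^ DIM('a) * \<phi> (2 *\<^sub>R y)\<bar> \<le> 2 ^ DIM('a) * (2 * C) * norm (z - y)"
    unfolding right_diff_distrib[symmetric] abs_mult by simp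
qed (use C kp in \<open>auto simp: unit_kernel_def\<close>)

text \<open>An approximate identity whose mass is not normalised: subtracting \<open>f x\<close>
  leaves a density of size k d^\<alpha> on the support of the kernel.\<close>

lemma conv_\<phi>_tendsto: "(\<lambda>j. conv \<phi> ((1/2) ^ j) f x) \<longlonglongrightarrow> (LINT z|lborel. \<phi> z) *\<^sub>R f x"
proof -
  have e: "conv \<phi> d f x - (LINT z|lborel. \<phi> z) *\<^sub>R f x = conv \<phi> d (\<lambda>z. f z - f x) x" for d
  proof -
    have "integrable lborel \<phi>"
      using conv_integrable[OF kp continuous_on_const, of "1::real"] by simp
    then have "(LINT z|lborel. \<phi> z *\<^sub>R f x) = (LINT z|lborel. \<phi> z) *\<^sub>R f x"
      by (intro integral_scaleR_left)
    then show ?thesis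
      using conv_diff[OF kp contf continuous_on_const, of d "f x" x] by (simp add: conv_def)
  qed
  have b: "norm (conv \<phi> d (\<lambda>z. f z - f x) x) \<le> 2 * C * (k * (1 * d) powr \<alpha>) * V1" if "d > 0" for d
    using that by (intro conv_bound_V1[OF kp] hoelder_bound_scaled) (auto intro!: continuous_intros contf)
  have "(\<lambda>j. 2 * C * k * V1 * ((1/2) powr \<alpha>) ^ j) \<longlonglongrightarrow> 2 * C * k * V1 * 0"
    using half_powr_lt_1 by (intro tendsto_mult_left LIMSEQ_realpow_zero) auto
  then have "(\<lambda>j. 2 * C * k * V1 * ((1/2) powr \<alpha>) ^ j) \<longlonglongrightarrow> 0" by simp
  then have "(\<lambda>j. conv \<phi> ((1/2) ^ j) f x - (LINT z|lborel. \<phi> z) *\<^sub>R f x) \<longlonglongrightarrow> 0"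
  proof (rule Lim_null_comparison[OF always_eventually, rotated], intro allI)
    fix j :: nat
    show "norm (conv \<phi> ((1/2) ^ j) f x - (LINT z|lborel. \<phi> z) *\<^sub>R f x) \<le> 2 * C * k * V1 * ((1/2) powr \<alpha>) ^ j"
      using b[of "(1/2) ^ j"] unfolding e mult_1 half_power_powr by (simp add: mult_ac)
  qed
  then show ?thesis by (simp add: LIM_zero_iff)
qed

text \<open>The sum telescopes. The coarsest average \<open>G 0\<close> survives and becomes the
  error \<open>avg\<close>; the limit over fine scales is normalised to \<open>f x\<close> by
  \<open>c\<close>.\<close>

lemma laplacian_pot: "(\<Sum>e\<in>Basis. pot2 f x e e) = f x - avg f x"
proof -
  define G where "G j = conv \<phi> ((1/2) ^ j) f x" for j
  have "(\<Sum>e\<in>Basis. conv (\<lambda>z. \<kappa>2 z e e) ((1/2) ^ j) f x) = G j - G (Suc j)" for j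
  proof -
    have "(\<Sum>e\<in>Basis. conv (\<lambda>z. \<kappa>2 z e e) ((1/2) ^ j) f x)
        = conv (\<lambda>z. \<phi> z - 2 ^ DIM('a) * \<phi> (2 *\<^sub>R z)) ((1/2) ^ j) f x"
      unfolding lap[symmetric] by (rule conv_sum_kernel[OF k2 contf, symmetric])
    also have "\<dots> = conv \<phi> ((1/2) ^ j) f x - conv \<phi> ((1/2) ^ j / 2) f x"
      by (subst conv_diff_kernel[OF kp unit_kernel_dilate contf]) (simp only: conv_dilate)
    finally show ?thesis by (simp add: G_def)
  qed
  moreover have "(\<lambda>j. G j - G (Suc j)) sums (G 0 - (LINT z|lborel. \<phi> z) *\<^sub>R f x)"
    unfolding G_def by (rule telescope_sums'[OF conv_\<phi>_tendsto])
  ultimately have 1: "(\<Sum>j. \<Sum>e\<in>Basis. conv (\<lambda>z. \<kappa>2 z e e) ((1/2) ^ j) f x) = G 0 - (LINT z|lborel. \<phi> z) *\<^sub>R f x"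
    by (simp add: sums_iff)
  have 2: "(\<Sum>j. \<Sum>e\<in>Basis. conv (\<lambda>z. \<kappa>2 z e e) ((1/2) ^ j) f x)
     = (\<Sum>e\<in>Basis. \<Sum>j. conv (\<lambda>z. \<kappa>2 z e e) ((1/2) ^ j) f x)"
    by (rule suminf_sum) (rule summable_pot2)
  have "(\<Sum>e\<in>Basis. pot2 f x e e) = - (c *\<^sub>R (\<Sum>e\<in>Basis. \<Sum>j. conv (\<lambda>z. \<kappa>2 z e e) ((1/2) ^ j) f x))"
    by (simp add: pot2_def sum_negf scaleR_sum_right)
  also have "\<dots> = (c * (LINT z|lborel. \<phi> z)) *\<^sub>R f x - c *\<^sub>R G 0"
    unfolding 2[symmetric] 1 by (simp add: scaleR_diff_right)
  also have "c * (LINT z|lborel. \<phi> z) = 1" using pos by (simp add: c_def)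
  finally show ?thesis by (simp add: G_def avg_def)
qed

definition "K2 = c * ((4 * C * V1 + C * 2 powr \<alpha> * V2)
    * (1 / (1 - (1/2) powr (1 - \<alpha>)) + 1 / (1 - (1/2) powr \<alpha>)))"

text \<open>Each dyadic term is bounded by its size at both points and, at scales at least
  \<open>norm (x - y)\<close>, by its increment; \<open>dyadic_sum_bound\<close> combines the two.
  The constant sees \<open>f\<close> only through its seminorm.\<close>

lemma pot2_hoelder:
  assumes "norm (x - y) \<le> 1"
  shows "norm (pot2 f x v w - pot2 f y v w) \<le> K2 * k * norm (x - y) powr \<alpha> * norm v * norm w"
proof (cases "x = y")
  case True then show ?thesis by simp
next
  case False
  define h where "h = x - y"
  have h: "0 < norm h" "norm h \<le> 1" "x = y + h" using False assms by (auto simp: h_def)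
  define b where "b j = conv (\<lambda>z. \<kappa>2 z v w) ((1/2) ^ j) f x - conv (\<lambda>z. \<kappa>2 z v w) ((1/2) ^ j) f y" for j :: nat
  define B where "B = (4 * C * V1 + C * 2 powr \<alpha> * V2) * k * norm v * norm w"
  have B: "B = 2 * (2 * C * V1 * k * norm v * norm w) + C * 2 powr \<alpha> * V2 * k * norm v * norm w"
    by (simp add: B_def algebra_simps)
  have nn: "0 \<le> 2 * C * V1 * k * norm v * norm w" "0 \<le> C * 2 powr \<alpha> * V2 * k * norm v * norm w"
    using C k_nonneg V_nonneg by auto
  have "norm (\<Sum>j. b j) \<le> B * (1 / (1 - (1/2) powr (1 - \<alpha>)) + 1 / (1 - (1/2) powr \<alpha>)) * norm h powr \<alpha>"
  proof (rule dyadic_sum_bound[OF \<alpha> h(1,2)])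
    show "0 \<le> B" using nn unfolding B by linarith
    fix j :: nat
    let ?d = "(1/2 :: real) ^ j"
    have "norm (b j) \<le> 2 * (2 * C * V1 * k * norm v * norm w) * ?d powr \<alpha>"
      using conv_\<kappa>2_bound[of ?d v w x] conv_\<kappa>2_bound[of ?d v w y]
        norm_triangle_ineq4[of "conv (\<lambda>z. \<kappa>2 z v w) ?d f x" "conv (\<lambda>z. \<kappa>2 z v w) ?d f y"]
      unfolding b_def by simp
    also have "\<dots> \<le> B * ?d powr \<alpha>" using nn unfolding B by (intro mult_right_mono) auto
    finally show "norm (b j) \<le> B * ?d powr \<alpha>" .
    assume "norm h \<le> ?d"
    then have "norm (b j) \<le> (C * 2 powr \<alpha> * V2 * k * norm v * norm w) * (norm h / ?d) * ?d powr \<alpha>"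
      using conv_\<kappa>2_increment[of h ?d v w y] unfolding b_def h(3) by simp
    also have "\<dots> \<le> B * (norm h / ?d) * ?d powr \<alpha>"
      using nn unfolding B by (intro mult_right_mono) auto
    finally show "norm (b j) \<le> B * (norm h / ?d) * ?d powr \<alpha>" .
  qed
  moreover have "pot2 f x v w - pot2 f y v w = - (c *\<^sub>R (\<Sum>j. b j))"
    unfolding b_def pot2_def by (subst suminf_diff[OF summable_pot2 summable_pot2, symmetric]) (simp add: algebra_simps)
  ultimately have "norm (pot2 f x v w - pot2 f y v w) \<le>
     c * (B * (1 / (1 - (1/2) powr (1 - \<alpha>)) + 1 / (1 - (1/2) powr \<alpha>)) * norm h powr \<alpha>)"
    using c_pos by (simp add: mult_left_mono)
  then show ?thesis by (simp add: K2_def B_def h_def mult_ac)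
qed

lemma avg_lipschitz:
  assumes "norm (x - y) \<le> 1"
  shows "norm (avg f x - avg f y) \<le> c * C * V2 * M * norm (x - y)"
proof -
  have "norm (conv \<phi> 1 f (y + (x - y)) - conv \<phi> 1 f y) \<le> C * (norm (x - y) / 1) * M * V2"
    using assms by (intro conv_increment_bound_V2[OF kp contf] bounded_f) auto
  then have "c * norm (conv \<phi> 1 f x - conv \<phi> 1 f y) \<le> c * (C * norm (x - y) * M * V2)"
    using c_pos by (intro mult_left_mono) auto
  then show ?thesis using c_pos by (simp add: avg_def mult_ac flip: scaleR_diff_right)
qed

end

lemma pot_diff:
  assumes "globally_hoelder \<alpha> M k f" "globally_hoelder \<alpha> M' k' g"
  shows "pot (\<lambda>x. f x - g x) x = pot f x - pot g x"
    "pot1 (\<lambda>x. f x - g x) x v = pot1 f x v - pot1 g x v"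
    "pot2 (\<lambda>x. f x - g x) x v w = pot2 f x v w - pot2 g x v w"
    "avg (\<lambda>x. f x - g x) x = avg f x - avg g x"
proof -
  note cf = globally_hoelder_continuous[OF assms(1) \<alpha>(1)] globally_hoelder_continuous[OF assms(2) \<alpha>(1)]
  show "pot (\<lambda>x. f x - g x) x = pot f x - pot g x"
    unfolding pot_def conv_diff[OF k0 cf] scaleR_diff_right
    by (subst suminf_diff[OF summable_pot[OF assms(1)] summable_pot[OF assms(2)], symmetric]) (simp add: scaleR_diff_right)
  show "pot1 (\<lambda>x. f x - g x) x v = pot1 f x v - pot1 g x v"
    unfolding pot1_def conv_diff[OF k1 cf] scaleR_diff_right
    by (subst suminf_diff[OF summable_pot1[OF assms(1)] summable_pot1[OF assms(2)], symmetric]) (simp add: scaleR_diff_right)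
  show "pot2 (\<lambda>x. f x - g x) x v w = pot2 f x v w - pot2 g x v w"
    unfolding pot2_def conv_diff[OF k2 cf]
    by (subst suminf_diff[OF summable_pot2[OF assms(1)] summable_pot2[OF assms(2)], symmetric]) (simp add: scaleR_diff_right)
  show "avg (\<lambda>x. f x - g x) x = avg f x - avg g x"
    unfolding avg_def conv_diff[OF kp cf] by (simp add: scaleR_diff_right)
qed

end

text \<open>Hides the kernel from the rest of the argument. Linearity is recorded as difference
  rules for \<open>globally_hoelder\<close> densities, for which the series converge.\<close>

lemma laplace_parametrix:
  assumes "0 < \<alpha>" "\<alpha> < 1"
  obtains U :: "('a::euclidean_space \<Rightarrow> 'b::euclidean_space) \<Rightarrow> 'a \<Rightarrow> 'b" and D1 D2 P and C :: real
  where "C \<ge> 0"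
    "\<And>f M k x. globally_hoelder \<alpha> M k f \<Longrightarrow> (U f has_derivative D1 f x) (at x)"
    "\<And>f M k x v. globally_hoelder \<alpha> M k f \<Longrightarrow> ((\<lambda>x. D1 f x v) has_derivative D2 f x v) (at x)"
    "\<And>f M k x v w. globally_hoelder \<alpha> M k f \<Longrightarrow> D2 f x v w = D2 f x w v"
    "\<And>f M k x. globally_hoelder \<alpha> M k f \<Longrightarrow> (\<Sum>e\<in>Basis. D2 f x e e) = f x - P f x"
    "\<And>f M k x y v w. globally_hoelder \<alpha> M k f \<Longrightarrow> norm (x - y) \<le> 1 \<Longrightarrow>
       norm (D2 f x v w - D2 f y v w) \<le> C * k * norm (x - y) powr \<alpha> * norm v * norm w"
    "\<And>f M k x y. globally_hoelder \<alpha> M k f \<Longrightarrow> norm (x - y) \<le> 1 \<Longrightarrow>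
       norm (P f x - P f y) \<le> C * M * norm (x - y)"
    "\<And>f M k g M' k' x. globally_hoelder \<alpha> M k f \<Longrightarrow> globally_hoelder \<alpha> M' k' g \<Longrightarrow> U (\<lambda>x. f x - g x) x = U f x - U g x"
    "\<And>f M k g M' k' x v. globally_hoelder \<alpha> M k f \<Longrightarrow> globally_hoelder \<alpha> M' k' g \<Longrightarrow> D1 (\<lambda>x. f x - g x) x v = D1 f x v - D1 g x v"
    "\<And>f M k g M' k' x v w. globally_hoelder \<alpha> M k f \<Longrightarrow> globally_hoelder \<alpha> M' k' g \<Longrightarrow> D2 (\<lambda>x. f x - g x) x v w = D2 f x v w - D2 g x v w"
    "\<And>f M k g M' k' x. globally_hoelder \<alpha> M k f \<Longrightarrow> globally_hoelder \<alpha> M' k' g \<Longrightarrow> P (\<lambda>x. f x - g x) x = P f x - P g x"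
proof -
  show ?thesis
  proof (rule kernel_exists[where 'a = 'a], goal_cases)
    case (1 \<kappa> \<kappa>1 \<kappa>2 \<phi> C)
    interpret laplace_kernel \<kappa> \<kappa>1 \<kappa>2 \<phi> C \<alpha>
      "measure lborel (cball (0::'a) 1)" "measure lborel (cball (0::'a) 2)"
      by (rule laplace_kernel.intro[OF 1 assms refl refl])
  define K where "K = max K2 (c * C * measure lborel (cball (0::'a) 2))"
  have K: "K2 \<le> K" "c * C * measure lborel (cball (0::'a) 2) \<le> K" by (auto simp: K_def)
    show ?thesis
    proof (rule that[of K pot pot1 pot2 avg])
    show "K \<ge> 0" using c_pos C V_nonneg by (auto simp: K_def le_max_iff_disj)
    show "norm (pot2 f x v w - pot2 f y v w) \<le> K * k * norm (x - y) powr \<alpha> * norm v * norm w"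
      if f: "globally_hoelder \<alpha> M k f" and xy: "norm (x - y) \<le> 1" for f :: "'a \<Rightarrow> 'b" and M k x y v w
    proof -
      have "K2 * (k * norm (x - y) powr \<alpha> * norm v * norm w) \<le> K * (k * norm (x - y) powr \<alpha> * norm v * norm w)"
        using K(1) k_nonneg[OF f] by (intro mult_right_mono) auto
      then show ?thesis using pot2_hoelder[OF f xy, of v w] by (simp add: mult.assoc)
    qed
    show "norm (avg f x - avg f y) \<le> K * M * norm (x - y)"
      if f: "globally_hoelder \<alpha> M k f" and xy: "norm (x - y) \<le> 1" for f :: "'a \<Rightarrow> 'b" and M k x y
    proof -
      have "c * C * measure lborel (cball (0::'a) 2) * (M * norm (x - y)) \<le> K * (M * norm (x - y))"
        using K(2) M_nonneg[OF f] by (intro mult_right_mono) auto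
      then show ?thesis using avg_lipschitz[OF f xy] by (simp add: mult.assoc)
    qed
    qed (rule pot_has_derivative pot1_has_derivative pot2_commute laplacian_pot pot_diff; assumption)+
  qed
qed

section \<open>Constant coefficient elliptic operators\<close>

definition contract :: "real^'n^'n \<Rightarrow> ('n \<Rightarrow> 'n \<Rightarrow> 'b::real_vector) \<Rightarrow> 'b" where
  "contract A h = (\<Sum>i\<in>UNIV. \<Sum>j\<in>UNIV. A $ i $ j *\<^sub>R h i j)"

lemma contract_add: "contract A (\<lambda>i j. g i j + h i j) = contract A g + contract A h"
  by (simp add: contract_def scaleR_add_right sum.distrib)

lemma contract_diff: "contract A (\<lambda>i j. g i j - h i j) = contract A g - contract A h"
  by (simp add: contract_def scaleR_diff_right sum_subtractf)

lemma contract_matrix_diff: "contract (A - B) h = contract A h - contract B h"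
  by (simp add: contract_def scaleR_diff_left sum_subtractf)

lemma contract_scaleR: "contract A (\<lambda>i j. g i j *\<^sub>R b) = contract A g *\<^sub>R b"
  by (simp add: contract_def scaleR_sum_left)

text \<open>Gram-Schmidt for the form of A + A^T, which is positive by ellipticity. Squared length 2
  makes up for the factor 1/2 left out of the symmetrisation. The \<open>V m\<close> are the rows of
  a linear change of variables and \<open>B\<close> inverts it.\<close>

lemma orthonormalizing_family:
  fixes A :: "real^'n^'n"
  assumes "lam > 0" and ell: "\<And>\<xi>. contract A (\<lambda>i j. \<xi> $ i * \<xi> $ j) \<ge> lam * (norm \<xi>)\<^sup>2"
  obtains V :: "'n \<Rightarrow> real^'n" and B
  where "\<And>l m. contract A (\<lambda>i j. V l $ i * V m $ j) + contract A (\<lambda>i j. V m $ i * V l $ j) = (if l = m then 2 else 0)"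
    "linear B" "\<And>x. B (\<chi> m. V m \<bullet> x) = x"
proof -
  define S where "S = A + transpose A"
  have S: "v \<bullet> (S *v w) = contract A (\<lambda>i j. v $ i * w $ j) + contract A (\<lambda>i j. w $ i * v $ j)" for v w
  proof -
    have "v \<bullet> (S *v w) = (\<Sum>i\<in>UNIV. \<Sum>j\<in>UNIV. A $ i $ j * (v $ i * w $ j)) + (\<Sum>i\<in>UNIV. \<Sum>j\<in>UNIV. A $ j $ i * (v $ i * w $ j))"
      by (simp add: S_def inner_vec_def matrix_vector_mult_def transpose_def sum_distrib_left sum.distrib algebra_simps)
    also have "(\<Sum>i\<in>UNIV. \<Sum>j\<in>UNIV. A $ j $ i * (v $ i * w $ j)) = (\<Sum>j\<in>UNIV. \<Sum>i\<in>UNIV. A $ j $ i * (v $ i * w $ j))"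
      by (rule sum.swap)
    finally show ?thesis by (simp add: contract_def mult_ac)
  qed
  have S_sym: "v \<bullet> (S *v w) = w \<bullet> (S *v v)" for v w by (simp add: S)
  have S_pos: "v \<bullet> (S *v v) > 0" if "v \<noteq> 0" for v
  proof -
    have "0 < lam * (norm v)\<^sup>2" using that assms(1) by simp
    then show ?thesis using ell[of v] by (simp add: S)
  qed
  have "\<exists>V :: 'n \<Rightarrow> real^'n. \<forall>l\<in>I. \<forall>m\<in>I. V l \<bullet> (S *v V m) = (if l = m then 2 else 0)" for I :: "'n set"
    using finite[of I]
  proof (induction I)
    case empty then show ?case by simp
  next
    case (insert k I)
    then obtain V :: "'n \<Rightarrow> real^'n" where V: "\<And>l m. l \<in> I \<Longrightarrow> m \<in> I \<Longrightarrow> V l \<bullet> (S *v V m) = (if l = m then 2 else 0)"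
      by blast
    \<comment> \<open>Dimension count: fewer than n vectors leave a nonzero vector orthogonal to all
      of them, which \<open>s\<close> then rescales.\<close>
    have "dim ((\<lambda>m. S *v V m) ` I) \<le> card I"
      using dim_le_card'[of "(\<lambda>m. S *v V m) ` I"] card_image_le[of I "\<lambda>m. S *v V m"] by simp
    also have "card I < card (UNIV :: 'n set)"
      using insert.hyps by (intro psubset_card_mono) auto
    finally obtain w where w: "w \<noteq> 0" "\<And>y. y \<in> span ((\<lambda>m. S *v V m) ` I) \<Longrightarrow> orthogonal w y"
      using orthogonal_to_subspace_exists[of "(\<lambda>m. S *v V m) ` I"] by auto
    define s where "s = sqrt (2 / (w \<bullet> (S *v w)))"
    define w' where "w' = s *\<^sub>R w"
    have o: "w' \<bullet> (S *v V m) = 0" if "m \<in> I" for m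
      using w(2)[of "S *v V m"] that by (auto simp: span_base orthogonal_def w'_def)
    have o': "V m \<bullet> (S *v w') = 0" if "m \<in> I" for m
      using o[OF that] S_sym[of "V m" w'] by simp
    have "w' \<bullet> (S *v w') = s\<^sup>2 * (w \<bullet> (S *v w))"
      by (simp add: w'_def matrix_vector_mult_scaleR power2_eq_square)
    then have n: "w' \<bullet> (S *v w') = 2" using S_pos[OF w(1)] by (simp add: s_def)
    have "\<forall>l\<in>insert k I. \<forall>m\<in>insert k I. (V(k := w')) l \<bullet> (S *v (V(k := w')) m) = (if l = m then 2 else 0)"
      using V o o' n insert.hyps by auto
    then show ?case by blast
  qed
  from this[of UNIV] obtain V :: "'n \<Rightarrow> real^'n"
    where V: "\<And>l m. V l \<bullet> (S *v V m) = (if l = m then 2 else 0)" by auto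
  define T where "T x = (\<chi> m. V m \<bullet> x)" for x
  define B where "B y = (1/2) *\<^sub>R (\<Sum>m\<in>UNIV. y $ m *\<^sub>R (S *v V m))" for y :: "real^'n"
  have lT: "linear T" by (rule linearI) (simp_all add: T_def vec_eq_iff inner_add_right)
  have lB: "linear B"
    by (rule linearI) (simp_all add: B_def scaleR_add_left sum.distrib scaleR_add_right scaleR_sum_right mult_ac)
  have TB: "T (B y) = y" for y
    by (simp add: T_def B_def vec_eq_iff inner_sum_right V if_distrib cong: if_cong)
  have "surj T" using TB by (rule surjI)
  then have "inj T" using lT linear_surjective_imp_injective by blast
  then have BT: "B (T x) = x" for x using TB[of "T x"] by (rule injD)
  show ?thesis
    by (rule that[of V B]) (use V BT lB in \<open>auto simp: S T_def\<close>)
qed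

lemma sum_Basis_vec: "(\<Sum>e\<in>(Basis :: (real^'n) set). F e) = (\<Sum>i\<in>UNIV. F (axis i 1))"
proof -
  have "(Basis :: (real^'n) set) = range (\<lambda>i. axis i 1)" by (auto simp: Basis_vec_def)
  then have "(\<Sum>e\<in>(Basis :: (real^'n) set). F e) = sum F (range (\<lambda>i. axis i 1))" by simp
  also have "\<dots> = (\<Sum>i\<in>UNIV. F (axis i 1))"
    by (subst sum.reindex) (auto simp: inj_on_def axis_eq_axis)
  finally show ?thesis .
qed

lemma linear_bound_pos:
  assumes "linear (T :: 'a::euclidean_space \<Rightarrow> 'b::real_normed_vector)"
  obtains t where "t > 0" "\<And>x. norm (T x) \<le> t * norm x"
  using linear_bounded_pos[OF assms] by (metis mult.commute)

text \<open>In the coordinates \<open>T x\<close> the symmetric part of \<open>A\<close> becomes the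
  identity, so the Laplace parametrix is conjugated by \<open>T\<close> and its inverse
  \<open>B\<close>. The constants change by powers of their operator bounds, and points at distance
  at most 1/t stay at distance at most 1 under \<open>T\<close>.\<close>

lemma elliptic_parametrix:
  fixes A :: "real^'n^'n"
  assumes \<alpha>: "0 < \<alpha>" "\<alpha> < 1" and "lam > 0"
    and ell: "\<And>\<xi>. contract A (\<lambda>i j. \<xi> $ i * \<xi> $ j) \<ge> lam * (norm \<xi>)\<^sup>2"
  obtains U :: "(real^'n \<Rightarrow> 'b::euclidean_space) \<Rightarrow> real^'n \<Rightarrow> 'b" and D1 D2 P and C r :: real
  where "C \<ge> 0" "r > 0"
    "\<And>f M k x. globally_hoelder \<alpha> M k f \<Longrightarrow> (U f has_derivative D1 f x) (at x)"
    "\<And>f M k x v. globally_hoelder \<alpha> M k f \<Longrightarrow> ((\<lambda>x. D1 f x v) has_derivative D2 f x v) (at x)"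
    "\<And>f M k x v w. globally_hoelder \<alpha> M k f \<Longrightarrow> D2 f x v w = D2 f x w v"
    "\<And>f M k x. globally_hoelder \<alpha> M k f \<Longrightarrow> contract A (\<lambda>i j. D2 f x (axis i 1) (axis j 1)) = f x - P f x"
    "\<And>f M k x y v w. globally_hoelder \<alpha> M k f \<Longrightarrow> norm (x - y) \<le> r \<Longrightarrow>
       norm (D2 f x v w - D2 f y v w) \<le> C * k * norm (x - y) powr \<alpha> * norm v * norm w"
    "\<And>f M k x y. globally_hoelder \<alpha> M k f \<Longrightarrow> norm (x - y) \<le> r \<Longrightarrow>
       norm (P f x - P f y) \<le> C * M * norm (x - y)"
    "\<And>f M k g M' k' x. globally_hoelder \<alpha> M k f \<Longrightarrow> globally_hoelder \<alpha> M' k' g \<Longrightarrow> U (\<lambda>x. f x - g x) x = U f x - U g x"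
    "\<And>f M k g M' k' x v. globally_hoelder \<alpha> M k f \<Longrightarrow> globally_hoelder \<alpha> M' k' g \<Longrightarrow> D1 (\<lambda>x. f x - g x) x v = D1 f x v - D1 g x v"
    "\<And>f M k g M' k' x v w. globally_hoelder \<alpha> M k f \<Longrightarrow> globally_hoelder \<alpha> M' k' g \<Longrightarrow> D2 (\<lambda>x. f x - g x) x v w = D2 f x v w - D2 g x v w"
    "\<And>f M k g M' k' x. globally_hoelder \<alpha> M k f \<Longrightarrow> globally_hoelder \<alpha> M' k' g \<Longrightarrow> P (\<lambda>x. f x - g x) x = P f x - P g x"
proof (rule laplace_parametrix[OF \<alpha>, where 'a = "real^'n" and 'b = 'b], goal_cases)
  case (1 U D1 D2 P C)
  note C = 1(2) and U = 1(3) and D1 = 1(4) and D2_sym = 1(5) and lap = 1(6) and D2_h = 1(7) and P_l = 1(8)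
    and diff = 1(9-12)
  obtain V :: "'n \<Rightarrow> real^'n" and B
    where V: "\<And>l m. contract A (\<lambda>i j. V l $ i * V m $ j) + contract A (\<lambda>i j. V m $ i * V l $ j) = (if l = m then 2 else 0)"
    and lB: "linear B" and BT: "\<And>x. B (\<chi> m. V m \<bullet> x) = x"
    using orthonormalizing_family[OF assms(3) ell] by blast
  define T where "T x = (\<chi> m. V m \<bullet> x)" for x
  have lT: "linear T" by (rule linearI) (simp_all add: T_def vec_eq_iff inner_add_right)
  obtain t where t: "t > 0" "\<And>x. norm (T x) \<le> t * norm x" using linear_bound_pos[OF lT] by blast
  obtain b where b: "b > 0" "\<And>x. norm (B x) \<le> b * norm x" using linear_bound_pos[OF lB] by blast
  have dT: "(T has_derivative T) (at x)" for x
    using lT by (simp add: linear_conv_bounded_linear bounded_linear_imp_has_derivative)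
  have gh: "globally_hoelder \<alpha> M (k * b powr \<alpha>) (\<lambda>y. f (B y))" if f: "globally_hoelder \<alpha> M k f"
    for f :: "real^'n \<Rightarrow> 'b" and M k
    unfolding globally_hoelder_def
  proof (intro conjI allI)
    show "0 \<le> k * b powr \<alpha>" "norm (f (B x)) \<le> M" for x using f by (auto simp: globally_hoelder_def)
    fix x y
    have "norm (f (B x) - f (B y)) \<le> k * norm (B x - B y) powr \<alpha>" using f by (simp add: globally_hoelder_def)
    also have "\<dots> \<le> k * (b * norm (x - y)) powr \<alpha>"
      using b(2)[of "x - y"] \<alpha> f
      by (intro mult_left_mono powr_mono2) (auto simp: globally_hoelder_def linear_diff[OF lB])
    finally show "norm (f (B x) - f (B y)) \<le> k * b powr \<alpha> * norm (x - y) powr \<alpha>"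
      using b(1) by (simp add: powr_mult mult_ac)
  qed
  define U' where "U' f x = U (\<lambda>y. f (B y)) (T x)" for f x
  define D1' where "D1' f x v = D1 (\<lambda>y. f (B y)) (T x) (T v)" for f x v
  define D2' where "D2' f x v w = D2 (\<lambda>y. f (B y)) (T x) (T v) (T w)" for f x v w
  define P' where "P' f x = P (\<lambda>y. f (B y)) (T x)" for f x
  define K where "K = C * b powr \<alpha> * t powr \<alpha> * t * t + C * t"
  have T_small: "norm (T x - T y) \<le> 1" "norm (T x - T y) \<le> t * norm (x - y)" if "norm (x - y) \<le> 1 / t" for x y
  proof -
    show *: "norm (T x - T y) \<le> t * norm (x - y)" using t(2)[of "x - y"] by (simp add: linear_diff[OF lT])
    also have "\<dots> \<le> 1" using that t(1) by (simp add: field_simps)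
    finally show "norm (T x - T y) \<le> 1" .
  qed
  show thesis
  proof (rule 1(1)[of K "1 / t" U' D1' D2' P'])
    show "K \<ge> 0" using C t by (simp add: K_def)
    show "1 / t > 0" using t by simp
    fix f :: "real^'n \<Rightarrow> 'b" and M k
    assume f: "globally_hoelder \<alpha> M k f"
    note g = gh[OF f]
    have k: "k \<ge> 0" and M: "M \<ge> 0"
      using f order_trans[OF norm_ge_zero, of "f 0" M] by (auto simp: globally_hoelder_def)
    show "(U' f has_derivative D1' f x) (at x)" for x
      unfolding U'_def[abs_def] D1'_def[abs_def] by (rule has_derivative_compose[OF dT U[OF g]])
    show "((\<lambda>x. D1' f x v) has_derivative D2' f x v) (at x)" for x v
      unfolding D2'_def[abs_def] D1'_def[abs_def] by (rule has_derivative_compose[OF dT D1[OF g]])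
    show sym': "D2' f x v w = D2' f x w v" for x v w
      unfolding D2'_def by (rule D2_sym[OF g])
    show "contract A (\<lambda>i j. D2' f x (axis i 1) (axis j 1)) = f x - P' f x" for x
    proof -
      define H where "H l m = D2 (\<lambda>y. f (B y)) (T x) (axis l 1) (axis m 1)" for l m :: 'n
      have lin2: "linear (D2 (\<lambda>y. f (B y)) (T x) v)" for v
        using D1[OF g] by (rule has_derivative_linear)
      have H_sym: "H l m = H m l" for l m unfolding H_def by (rule D2_sym[OF g])
      have Tax: "T (axis i 1) = (\<Sum>m\<in>UNIV. V m $ i *\<^sub>R axis m 1)" for i
      proof -
        have "T (axis i 1) $ k = (\<Sum>m\<in>UNIV. V m $ i *\<^sub>R axis m 1) $ k" for k
        proof -
          have "T (axis i 1) $ k = V k $ i" by (simp add: T_def inner_axis)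
          then show ?thesis by (simp add: axis_def if_distrib cong: if_cong)
        qed
        then show ?thesis by (simp add: vec_eq_iff)
      qed
      have e: "D2' f x (axis i 1) (axis j 1) = (\<Sum>l\<in>UNIV. \<Sum>m\<in>UNIV. (V l $ i * V m $ j) *\<^sub>R H l m)" for i j
      proof -
        have "D2' f x (axis i 1) (axis j 1) = (\<Sum>m\<in>UNIV. V m $ j *\<^sub>R D2 (\<lambda>y. f (B y)) (T x) (T (axis i 1)) (axis m 1))"
          unfolding D2'_def Tax[of j] by (simp add: linear_sum[OF lin2] linear_scale[OF lin2])
        also have "\<dots> = (\<Sum>m\<in>UNIV. V m $ j *\<^sub>R D2 (\<lambda>y. f (B y)) (T x) (axis m 1) (T (axis i 1)))"
          by (subst D2_sym[OF g]) simp
        also have "\<dots> = (\<Sum>m\<in>UNIV. V m $ j *\<^sub>R (\<Sum>l\<in>UNIV. V l $ i *\<^sub>R H m l))"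
          unfolding Tax[of i] by (simp add: linear_sum[OF lin2] linear_scale[OF lin2] H_def)
        also have "\<dots> = (\<Sum>m\<in>UNIV. \<Sum>l\<in>UNIV. (V l $ i * V m $ j) *\<^sub>R H l m)"
          unfolding scaleR_sum_right scaleR_scaleR
          by (intro sum.cong refl) (subst H_sym, simp add: mult.commute)
        also have "\<dots> = (\<Sum>l\<in>UNIV. \<Sum>m\<in>UNIV. (V l $ i * V m $ j) *\<^sub>R H l m)" by (rule sum.swap)
        finally show ?thesis .
      qed
      define c where "c l m = contract A (\<lambda>i j. V l $ i * V m $ j)" for l m
      have "contract A (\<lambda>i j. D2' f x (axis i 1) (axis j 1))
          = (\<Sum>i\<in>UNIV. \<Sum>j\<in>UNIV. \<Sum>l\<in>UNIV. \<Sum>m\<in>UNIV. (A $ i $ j * (V l $ i * V m $ j)) *\<^sub>R H l m)"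
        unfolding e contract_def by (simp add: scaleR_sum_right)
      also have "\<dots> = (\<Sum>i\<in>UNIV. \<Sum>l\<in>UNIV. \<Sum>j\<in>UNIV. \<Sum>m\<in>UNIV. (A $ i $ j * (V l $ i * V m $ j)) *\<^sub>R H l m)"
        by (intro sum.cong refl sum.swap)
      also have "\<dots> = (\<Sum>l\<in>UNIV. \<Sum>i\<in>UNIV. \<Sum>j\<in>UNIV. \<Sum>m\<in>UNIV. (A $ i $ j * (V l $ i * V m $ j)) *\<^sub>R H l m)"
        by (rule sum.swap)
      also have "\<dots> = (\<Sum>l\<in>UNIV. \<Sum>i\<in>UNIV. \<Sum>m\<in>UNIV. \<Sum>j\<in>UNIV. (A $ i $ j * (V l $ i * V m $ j)) *\<^sub>R H l m)"
        by (intro sum.cong refl sum.swap)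
      also have "\<dots> = (\<Sum>l\<in>UNIV. \<Sum>m\<in>UNIV. \<Sum>i\<in>UNIV. \<Sum>j\<in>UNIV. (A $ i $ j * (V l $ i * V m $ j)) *\<^sub>R H l m)"
        by (intro sum.cong refl sum.swap)
      also have "\<dots> = (\<Sum>l\<in>UNIV. \<Sum>m\<in>UNIV. c l m *\<^sub>R H l m)"
        by (simp add: c_def contract_def scaleR_sum_left)
      finally have 1: "contract A (\<lambda>i j. D2' f x (axis i 1) (axis j 1)) = (\<Sum>l\<in>UNIV. \<Sum>m\<in>UNIV. c l m *\<^sub>R H l m)" .
      \<comment> \<open>Only the symmetrisation of \<open>c\<close> is known; doubling the sum by
        exchanging l and m brings it in, because \<open>H\<close> is symmetric.\<close>
      have "(\<Sum>l\<in>UNIV. \<Sum>m\<in>UNIV. c l m *\<^sub>R H l m) = (\<Sum>l\<in>UNIV. \<Sum>m\<in>UNIV. c m l *\<^sub>R H m l)" by (rule sum.swap)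
      also have "\<dots> = (\<Sum>l\<in>UNIV. \<Sum>m\<in>UNIV. c m l *\<^sub>R H l m)" by (intro sum.cong refl) (subst H_sym, rule refl)
      finally have "2 *\<^sub>R (\<Sum>l\<in>UNIV. \<Sum>m\<in>UNIV. c l m *\<^sub>R H l m)
          = (\<Sum>l\<in>UNIV. \<Sum>m\<in>UNIV. c l m *\<^sub>R H l m) + (\<Sum>l\<in>UNIV. \<Sum>m\<in>UNIV. c m l *\<^sub>R H l m)"
        by (simp add: scaleR_2)
      also have "\<dots> = (\<Sum>l\<in>UNIV. \<Sum>m\<in>UNIV. (c l m + c m l) *\<^sub>R H l m)"
        by (simp add: sum.distrib scaleR_add_left)
      also have "\<dots> = (\<Sum>l\<in>UNIV. \<Sum>m\<in>UNIV. if m = l then 2 *\<^sub>R H l m else 0)"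
        unfolding c_def V by (intro sum.cong refl) auto
      also have "\<dots> = 2 *\<^sub>R (\<Sum>l\<in>UNIV. H l l)" by (simp add: scaleR_sum_right)
      finally have 2: "(\<Sum>l\<in>UNIV. \<Sum>m\<in>UNIV. c l m *\<^sub>R H l m) = (\<Sum>l\<in>UNIV. H l l)" by simp
      have "(\<Sum>l\<in>UNIV. H l l) = f (B (T x)) - P' f x"
        using lap[OF g, of "T x"] unfolding sum_Basis_vec H_def P'_def .
      then show ?thesis unfolding 1 2 using BT by (simp add: T_def)
    qed
    show "norm (D2' f x v w - D2' f y v w) \<le> K * k * norm (x - y) powr \<alpha> * norm v * norm w"
      if xy: "norm (x - y) \<le> 1 / t" for x y v w
    proof -
      have "norm (D2' f x v w - D2' f y v w) \<le> C * (k * b powr \<alpha>) * norm (T x - T y) powr \<alpha> * norm (T v) * norm (T w)"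
        unfolding D2'_def using D2_h[OF g T_small(1)[OF xy]] .
      also have "\<dots> \<le> C * (k * b powr \<alpha>) * (t * norm (x - y)) powr \<alpha> * (t * norm v) * (t * norm w)"
        using t C k b \<alpha> T_small(2)[OF xy] by (intro mult_mono powr_mono2) auto
      also have "\<dots> = (C * b powr \<alpha> * t powr \<alpha> * t * t) * (k * norm (x - y) powr \<alpha> * norm v * norm w)"
        using t by (simp add: powr_mult mult_ac)
      also have "\<dots> \<le> K * (k * norm (x - y) powr \<alpha> * norm v * norm w)"
        using k C t by (intro mult_right_mono) (auto simp: K_def)
      finally show ?thesis by (simp add: mult.assoc)
    qed
    show "norm (P' f x - P' f y) \<le> K * M * norm (x - y)" if xy: "norm (x - y) \<le> 1 / t" for x y
    proof -
      have "norm (P' f x - P' f y) \<le> C * M * norm (T x - T y)"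
        unfolding P'_def using P_l[OF g T_small(1)[OF xy]] .
      also have "\<dots> \<le> C * M * (t * norm (x - y))" using C M T_small(2)[OF xy] by (intro mult_left_mono) auto
      also have "\<dots> = C * t * (M * norm (x - y))" by (simp add: mult_ac)
      also have "\<dots> \<le> K * (M * norm (x - y))" using M C t by (intro mult_right_mono) (auto simp: K_def)
      finally show ?thesis by (simp add: mult.assoc)
    qed
    fix g :: "real^'n \<Rightarrow> 'b" and M' k' assume "globally_hoelder \<alpha> M' k' g"
    note g' = gh[OF this]
    show "U' (\<lambda>x. f x - g x) x = U' f x - U' g x" for x unfolding U'_def by (rule diff(1)[OF g g'])
    show "D1' (\<lambda>x. f x - g x) x v = D1' f x v - D1' g x v" for x v unfolding D1'_def by (rule diff(2)[OF g g'])
    show "D2' (\<lambda>x. f x - g x) x v w = D2' f x v w - D2' g x v w" for x v w unfolding D2'_def by (rule diff(3)[OF g g'])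
    show "P' (\<lambda>x. f x - g x) x = P' f x - P' g x" for x unfolding P'_def by (rule diff(4)[OF g g'])
  qed
qed

section \<open>Local right inverses\<close>

text \<open>The weight of the value at the centre makes the norm scale invariant, and all constants of the
  contraction argument below proportional to \<open>R powr \<alpha>\<close>.\<close>

definition hoelder_bound ::
  "real \<Rightarrow> real \<Rightarrow> real \<Rightarrow> ('a::real_normed_vector \<Rightarrow> 'b::real_normed_vector) \<Rightarrow> bool" where
  "hoelder_bound \<alpha> R k f \<longleftrightarrow> norm (f 0) \<le> k * R powr \<alpha> \<and>
    (\<forall>x\<in>cball 0 R. \<forall>y\<in>cball 0 R. norm (f x - f y) \<le> k * norm (x - y) powr \<alpha>)"

lemma hoelder_bound_nonneg:
  assumes "hoelder_bound \<alpha> R k f" "R > 0"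
  shows "k \<ge> 0"
proof -
  have "0 \<le> k * R powr \<alpha>" using assms norm_ge_zero order_trans unfolding hoelder_bound_def by metis
  then show ?thesis using assms(2) by (simp add: zero_le_mult_iff)
qed

lemma hoelder_bound_sup:
  assumes "hoelder_bound \<alpha> R k f" "R > 0" "0 \<le> \<alpha>" "norm x \<le> R"
  shows "norm (f x) \<le> 2 * k * R powr \<alpha>"
proof -
  have "x \<in> cball 0 R" "0 \<in> cball 0 R" using assms by auto
  then have "norm (f x - f 0) \<le> k * norm (x - 0) powr \<alpha>" using assms(1) unfolding hoelder_bound_def by blast
  also have "\<dots> \<le> k * R powr \<alpha>"
    using hoelder_bound_nonneg[OF assms(1,2)] assms by (intro mult_left_mono powr_mono2) auto
  finally show ?thesis using norm_triangle_sub[of "f x" "f 0"] assms(1) unfolding hoelder_bound_def by linarith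
qed

lemma hoelder_bound_mono: "hoelder_bound \<alpha> R k f \<Longrightarrow> k \<le> k' \<Longrightarrow> hoelder_bound \<alpha> R k' f"
  unfolding hoelder_bound_def by (meson mult_right_mono order_trans powr_ge_zero)

definition recentered_extension :: "real \<Rightarrow> ('a::euclidean_space \<Rightarrow> 'b::euclidean_space) \<Rightarrow> 'a \<Rightarrow> 'b" where
  "recentered_extension R f x = f (closest_point (cball 0 R) x) - f 0"

lemma recentered_extension_diff:
  "recentered_extension R (\<lambda>x. f x - g x) = (\<lambda>x. recentered_extension R f x - recentered_extension R g x)"
  by (simp add: recentered_extension_def fun_eq_iff)

text \<open>The nearest point projection is nonexpansive, which keeps the seminorm. Every value of
  the recentred function is an increment from the centre of the ball, hence the size
  \<open>k * R powr \<alpha>\<close>.\<close>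

lemma globally_hoelder_recentered_extension:
  fixes f :: "'a::euclidean_space \<Rightarrow> 'b::euclidean_space"
  assumes f: "hoelder_bound \<alpha> R k f" and "R > 0" "0 \<le> \<alpha>"
  shows "globally_hoelder \<alpha> (k * R powr \<alpha>) k (recentered_extension R f)"
proof -
  define p where "p = closest_point (cball (0::'a) R)"
  have k: "k \<ge> 0" using hoelder_bound_nonneg[OF assms(1,2)] .
  have p: "p x \<in> cball 0 R" for x
    using \<open>R > 0\<close> unfolding p_def by (intro closest_point_in_set) auto
  have lip: "norm (p x - p y) \<le> norm (x - y)" for x y
    using closest_point_lipschitz[of "cball (0::'a) R" x y] \<open>R > 0\<close> by (auto simp: p_def dist_norm)
  show ?thesis
    unfolding globally_hoelder_def recentered_extension_def p_def[symmetric]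
  proof (intro conjI allI k)
    fix x y
    have "norm (f (p x) - f (p y)) \<le> k * norm (p x - p y) powr \<alpha>"
      using f p unfolding hoelder_bound_def by blast
    also have "\<dots> \<le> k * norm (x - y) powr \<alpha>"
      using k lip \<open>0 \<le> \<alpha>\<close> by (intro mult_left_mono powr_mono2) auto
    finally show "norm (f (p x) - f 0 - (f (p y) - f 0)) \<le> k * norm (x - y) powr \<alpha>" by simp
    have "norm (f (p x) - f 0) \<le> k * norm (p x - 0) powr \<alpha>"
      using f p[of x] \<open>R > 0\<close> unfolding hoelder_bound_def by (metis centre_in_cball less_imp_le)
    also have "\<dots> \<le> k * R powr \<alpha>"
      using k p[of x] \<open>0 \<le> \<alpha>\<close> by (intro mult_left_mono powr_mono2) auto
    finally show "norm (f (p x) - f 0) \<le> k * R powr \<alpha>" .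
  qed
qed

text \<open>
  \<open>D1 f\<close> and \<open>D2 f\<close> are the first and second differentials of \<open>u f\<close>, and \<open>tr\<close> is the trace of \<open>A\<close>, so that
  \<open>u f\<close> agrees with \<open>(norm x)\<^sup>2 / (2 * tr) *\<^sub>R f 0\<close> to second order at the origin.
\<close>

definition is_local_inverse ::
  "real^'n^'n \<Rightarrow> real \<Rightarrow> real \<Rightarrow> real \<Rightarrow> real \<Rightarrow> ((real^'n \<Rightarrow> 'b::euclidean_space) \<Rightarrow> real^'n \<Rightarrow> 'b) \<Rightarrow>
   ((real^'n \<Rightarrow> 'b) \<Rightarrow> real^'n \<Rightarrow> real^'n \<Rightarrow> 'b) \<Rightarrow>
   ((real^'n \<Rightarrow> 'b) \<Rightarrow> real^'n \<Rightarrow> real^'n \<Rightarrow> real^'n \<Rightarrow> 'b) \<Rightarrow>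
   ((real^'n \<Rightarrow> 'b) \<Rightarrow> real^'n \<Rightarrow> 'b) \<Rightarrow> bool" where
  "is_local_inverse A \<alpha> R tr C u D1 D2 Q \<longleftrightarrow>
    (\<forall>f k. hoelder_bound \<alpha> R k f \<longrightarrow>
      (\<forall>x. (u f has_derivative D1 f x) (at x)) \<and>
      (\<forall>x v. ((\<lambda>x. D1 f x v) has_derivative D2 f x v) (at x)) \<and>
      (\<forall>x v w. D2 f x v w = D2 f x w v) \<and>
      u f 0 = 0 \<and> (\<forall>v. D1 f 0 v = 0) \<and> (\<forall>v w. D2 f 0 v w = ((v \<bullet> w) / tr) *\<^sub>R f 0) \<and>
      (\<forall>x\<in>cball 0 R. contract A (\<lambda>i j. D2 f x (axis i 1) (axis j 1)) = f x - Q f x) \<and>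
      (\<forall>x\<in>cball 0 R. \<forall>y\<in>cball 0 R. \<forall>v w.
        norm (D2 f x v w - D2 f y v w) \<le> C * k * norm (x - y) powr \<alpha> * norm v * norm w) \<and>
      Q f 0 = 0 \<and>
      (\<forall>x\<in>cball 0 R. \<forall>y\<in>cball 0 R. norm (Q f x - Q f y) \<le> C * k * R powr \<alpha> * norm (x - y))) \<and>
    (\<forall>f g k k'. hoelder_bound \<alpha> R k f \<longrightarrow> hoelder_bound \<alpha> R k' g \<longrightarrow>
      (\<forall>x. u (\<lambda>x. f x - g x) x = u f x - u g x) \<and>
      (\<forall>x v. D1 (\<lambda>x. f x - g x) x v = D1 f x v - D1 g x v) \<and>
      (\<forall>x v w. D2 (\<lambda>x. f x - g x) x v w = D2 f x v w - D2 g x v w) \<and>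
      (\<forall>x. Q (\<lambda>x. f x - g x) x = Q f x - Q g x))"

lemma is_local_inverseD:
  assumes "is_local_inverse A \<alpha> R tr C u D1 D2 Q" "hoelder_bound \<alpha> R k f"
  shows "(u f has_derivative D1 f x) (at x)"
    "((\<lambda>x. D1 f x v) has_derivative D2 f x v) (at x)"
    "D2 f x v w = D2 f x w v"
    "u f 0 = 0" "D1 f 0 v = 0" "D2 f 0 v w = ((v \<bullet> w) / tr) *\<^sub>R f 0"
    "x \<in> cball 0 R \<Longrightarrow> contract A (\<lambda>i j. D2 f x (axis i 1) (axis j 1)) = f x - Q f x"
    "x \<in> cball 0 R \<Longrightarrow> y \<in> cball 0 R \<Longrightarrow>
       norm (D2 f x v w - D2 f y v w) \<le> C * k * norm (x - y) powr \<alpha> * norm v * norm w"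
    "Q f 0 = 0"
    "x \<in> cball 0 R \<Longrightarrow> y \<in> cball 0 R \<Longrightarrow> norm (Q f x - Q f y) \<le> C * k * R powr \<alpha> * norm (x - y)"
  using assms(1)[unfolded is_local_inverse_def, THEN conjunct1, rule_format, OF assms(2)] by blast+

lemma is_local_inverse_diff:
  assumes "is_local_inverse A \<alpha> R tr C u D1 D2 Q" "hoelder_bound \<alpha> R k f" "hoelder_bound \<alpha> R l g"
  shows "u (\<lambda>x. f x - g x) x = u f x - u g x"
    "D1 (\<lambda>x. f x - g x) x v = D1 f x v - D1 g x v"
    "D2 (\<lambda>x. f x - g x) x v w = D2 f x v w - D2 g x v w"
    "Q (\<lambda>x. f x - g x) x = Q f x - Q g x"
  using assms(1)[unfolded is_local_inverse_def, THEN conjunct2, rule_format, OF assms(2,3)] by blast+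

text \<open>
  Subtracting the value at the centre before extending makes the sup norm of the extension
  of order \<open>R powr \<alpha>\<close>, so that the error \<open>Q\<close> is small for small \<open>R\<close>.
\<close>

lemma local_solution_operator:
  fixes A :: "real^'n^'n"
  assumes \<alpha>: "0 < \<alpha>" "\<alpha> < 1" and lam: "lam > 0"
    and ell: "\<And>\<xi>. contract A (\<lambda>i j. \<xi> $ i * \<xi> $ j) \<ge> lam * (norm \<xi>)\<^sup>2"
    and tr: "tr = (\<Sum>i\<in>UNIV. A $ i $ i)" "tr \<noteq> 0"
  obtains C r :: real
  where "C \<ge> 0" "r > 0"
    "\<And>R. 0 < R \<Longrightarrow> R \<le> r \<Longrightarrow>
      \<exists>(u :: (real^'n \<Rightarrow> 'b::euclidean_space) \<Rightarrow> real^'n \<Rightarrow> 'b) D1 D2 Q. is_local_inverse A \<alpha> R tr C u D1 D2 Q"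
proof (rule elliptic_parametrix[OF \<alpha> lam ell, where 'b = 'b], goal_cases)
  case (1 U D1 D2 P C r)
  note C = 1(2) and r = 1(3) and U = 1(4) and D1 = 1(5) and D2_sym = 1(6) and lap = 1(7) and D2_h = 1(8) and P_l = 1(9)
    and diff = 1(10-13)
  show thesis
  proof (rule 1(1)[of C "r / 2"])
    fix R :: real assume R: "0 < R" "R \<le> r / 2"
    let ?E = "recentered_extension R :: (real^'n \<Rightarrow> 'b) \<Rightarrow> real^'n \<Rightarrow> 'b"
    \<comment> \<open>\<open>q\<close> replaces the Hessian at the origin by the multiple of the
      identity whose contraction with \<open>A\<close> is \<open>f 0\<close>, restoring the value
      removed by recentring.\<close>
    define q where "q f v w = ((v \<bullet> w) / tr) *\<^sub>R f 0 - D2 (?E f) 0 v w" for f :: "real^'n \<Rightarrow> 'b" and v w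
    define u' where "u' f x = U (?E f) x - U (?E f) 0 - D1 (?E f) 0 x + (1/2) *\<^sub>R q f x x" for f x
    define D1' where "D1' f x v = D1 (?E f) x v - D1 (?E f) 0 v + q f x v" for f x v
    define D2' where "D2' f x v w = D2 (?E f) x v w - D2 (?E f) 0 v w + ((v \<bullet> w) / tr) *\<^sub>R f 0" for f x v w
    define Q where "Q f x = P (?E f) x - P (?E f) 0" for f x
    have small: "norm (x - y) \<le> r" if "x \<in> cball 0 R" "y \<in> cball 0 R" for x y :: "real^'n"
      using that R norm_triangle_ineq4[of x y] by simp
    show "\<exists>(u :: (real^'n \<Rightarrow> 'b::euclidean_space) \<Rightarrow> real^'n \<Rightarrow> 'b) D1 D2 Q. is_local_inverse A \<alpha> R tr C u D1 D2 Q"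
      unfolding is_local_inverse_def
    proof (rule exI[of _ u'], rule exI[of _ D1'], rule exI[of _ D2'], rule exI[of _ Q],
        (rule conjI; intro allI impI))
      fix f :: "real^'n \<Rightarrow> 'b" and k
      assume f: "hoelder_bound \<alpha> R k f"
      have gh: "globally_hoelder \<alpha> (k * R powr \<alpha>) k (?E f)"
        using globally_hoelder_recentered_extension[OF f R(1)] \<alpha> by simp
      have l1: "linear (D1 (?E f) x)" for x using U[OF gh] by (rule has_derivative_linear)
      have l2: "linear (D2 (?E f) x v)" for x v using D1[OF gh] by (rule has_derivative_linear)
      have q_sym: "q f v w = q f w v" for v w
        unfolding q_def D2_sym[OF gh, of 0 v w] by (simp add: inner_commute)
      have lq: "linear (q f v)" for v
        unfolding q_def by (rule linearI)
          (simp_all add: linear_add[OF l2] linear_scale[OF l2] inner_add_right add_divide_distrib algebra_simps)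
      have bq: "bounded_linear (q f v)" for v using lq by (simp add: linear_conv_bounded_linear)
      have bq': "bounded_linear (\<lambda>w. q f w v)" for v using bq[of v] by (subst q_sym)
      have bil: "bounded_bilinear (q f)"
      proof -
        have "bilinear (q f)" unfolding bilinear_def using bq bq' by (simp add: linear_conv_bounded_linear)
        then show ?thesis by (simp add: bilinear_conv_bounded_bilinear)
      qed
      have dq: "((\<lambda>x. (1/2) *\<^sub>R q f x x) has_derivative (\<lambda>h. q f x h)) (at x)" for x
      proof -
        have "((\<lambda>x. q f x x) has_derivative (\<lambda>h. q f x h + q f h x)) (at x)"
          by (rule bounded_bilinear.FDERIV[OF bil has_derivative_ident has_derivative_ident])
        then have "((\<lambda>x. (1/2) *\<^sub>R q f x x) has_derivative (\<lambda>h. (1/2) *\<^sub>R (q f x h + q f h x))) (at x)"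
          by (rule has_derivative_scaleR_right)
        moreover have "(1/2) *\<^sub>R (q f x h + q f h x) = q f x h" for h
          unfolding q_sym[of h x] by (simp flip: scaleR_2)
        ultimately show ?thesis by simp
      qed
      have du: "(u' f has_derivative D1' f x) (at x)" for x
      proof -
        have "((\<lambda>x. U (?E f) x - U (?E f) 0 - D1 (?E f) 0 x + (1/2) *\<^sub>R q f x x) has_derivative
          (\<lambda>v. D1 (?E f) x v - 0 - D1 (?E f) 0 v + q f x v)) (at x)"
          by (intro has_derivative_add has_derivative_diff U[OF gh] has_derivative_const dq
              bounded_linear_imp_has_derivative) (use l1 in \<open>simp add: linear_conv_bounded_linear\<close>)
        then show ?thesis by (simp add: u'_def[abs_def] D1'_def[abs_def])
      qed
      have dD1: "((\<lambda>x. D1' f x v) has_derivative D2' f x v) (at x)" for x v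
      proof -
        have "((\<lambda>x. D1 (?E f) x v - D1 (?E f) 0 v + q f x v) has_derivative
          (\<lambda>w. D2 (?E f) x v w - 0 + q f w v)) (at x)"
          by (intro has_derivative_add has_derivative_diff D1[OF gh] has_derivative_const
              bounded_linear_imp_has_derivative bq')
        moreover have "D2 (?E f) x v w - 0 + q f w v = D2' f x v w" for w
          unfolding q_sym[of w v] by (simp add: q_def D2'_def)
        ultimately show ?thesis by (simp add: D1'_def[abs_def])
      qed
      have sol: "contract A (\<lambda>i j. D2' f x (axis i 1) (axis j 1)) = f x - Q f x" if "x \<in> cball 0 R" for x
      proof -
        have "contract A (\<lambda>i j. (((axis i 1 :: real^'n) \<bullet> axis j 1) / tr) *\<^sub>R f 0) = (contract A (\<lambda>i j. ((axis i 1 :: real^'n) \<bullet> axis j 1) / tr)) *\<^sub>R f 0"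
          by (rule contract_scaleR)
        also have "contract A (\<lambda>i j. ((axis i 1 :: real^'n) \<bullet> axis j 1) / tr) = (\<Sum>i\<in>UNIV. \<Sum>j\<in>UNIV. if i = j then A $ i $ j / tr else 0)"
          unfolding contract_def by (intro sum.cong refl) (simp add: inner_axis_axis)
        also have "\<dots> = 1" using tr by (simp flip: sum_divide_distrib)
        finally have "contract A (\<lambda>i j. (((axis i 1 :: real^'n) \<bullet> axis j 1) / tr) *\<^sub>R f 0) = f 0" by simp
        \<comment> \<open>The extension vanishes at 0, so the subtracted Hessian contracts to
          \<open>- P (?E f) 0\<close>. This turns the error \<open>P\<close> into \<open>Q\<close>,
          which is zero at the origin.\<close>
        moreover have "closest_point (cball 0 R) x = x" "closest_point (cball 0 R) 0 = (0 :: real^'n)"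
          using that R by (auto intro!: closest_point_self)
        ultimately show ?thesis
          unfolding D2'_def contract_add contract_diff lap[OF gh]
          by (simp add: Q_def recentered_extension_def)
      qed
      have h2: "norm (D2' f x v w - D2' f y v w) \<le> C * k * norm (x - y) powr \<alpha> * norm v * norm w"
        if "x \<in> cball 0 R" "y \<in> cball 0 R" for x y v w
        using D2_h[OF gh small[OF that], of v w] by (simp add: D2'_def)
      have hQ: "norm (Q f x - Q f y) \<le> C * k * R powr \<alpha> * norm (x - y)"
        if "x \<in> cball 0 R" "y \<in> cball 0 R" for x y
        using P_l[OF gh small[OF that]] by (simp add: Q_def mult_ac)
      have s2: "D2' f x v w = D2' f x w v" for x v w
        unfolding D2'_def D2_sym[OF gh, of x v w] D2_sym[OF gh, of 0 v w] by (simp add: inner_commute)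
      have z: "u' f 0 = 0" "D1' f 0 v = 0" "D2' f 0 v w = ((v \<bullet> w) / tr) *\<^sub>R f 0" "Q f 0 = 0" for v w
        using linear_0[OF l1] linear_0[OF lq] bounded_bilinear.zero_left[OF bil]
        by (simp_all add: u'_def D1'_def D2'_def Q_def)
      show "(\<forall>x. (u' f has_derivative D1' f x) (at x)) \<and>
        (\<forall>x v. ((\<lambda>x. D1' f x v) has_derivative D2' f x v) (at x)) \<and>
        (\<forall>x v w. D2' f x v w = D2' f x w v) \<and>
        u' f 0 = 0 \<and> (\<forall>v. D1' f 0 v = 0) \<and> (\<forall>v w. D2' f 0 v w = ((v \<bullet> w) / tr) *\<^sub>R f 0) \<and>
        (\<forall>x\<in>cball 0 R. contract A (\<lambda>i j. D2' f x (axis i 1) (axis j 1)) = f x - Q f x) \<and>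
        (\<forall>x\<in>cball 0 R. \<forall>y\<in>cball 0 R. \<forall>v w.
          norm (D2' f x v w - D2' f y v w) \<le> C * k * norm (x - y) powr \<alpha> * norm v * norm w) \<and>
        Q f 0 = 0 \<and>
        (\<forall>x\<in>cball 0 R. \<forall>y\<in>cball 0 R. norm (Q f x - Q f y) \<le> C * k * R powr \<alpha> * norm (x - y))"
        by (intro conjI allI ballI du dD1 s2 z sol h2 hQ)
    next
      fix f g :: "real^'n \<Rightarrow> 'b" and k k'
      assume "hoelder_bound \<alpha> R k f" "hoelder_bound \<alpha> R k' g"
      then have "globally_hoelder \<alpha> (k * R powr \<alpha>) k (?E f)" "globally_hoelder \<alpha> (k' * R powr \<alpha>) k' (?E g)"
        using globally_hoelder_recentered_extension[OF _ R(1), of \<alpha>] \<alpha> by auto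
      note d = diff(1)[OF this] diff(2)[OF this] diff(3)[OF this] diff(4)[OF this]
      have dq: "q (\<lambda>x. f x - g x) v w = q f v w - q g v w" for v w
        unfolding q_def recentered_extension_diff d by (simp add: algebra_simps)
      show "(\<forall>x. u' (\<lambda>x. f x - g x) x = u' f x - u' g x) \<and>
        (\<forall>x v. D1' (\<lambda>x. f x - g x) x v = D1' f x v - D1' g x v) \<and>
        (\<forall>x v w. D2' (\<lambda>x. f x - g x) x v w = D2' f x v w - D2' g x v w) \<and>
        (\<forall>x. Q (\<lambda>x. f x - g x) x = Q f x - Q g x)"
        unfolding u'_def D1'_def D2'_def Q_def dq recentered_extension_diff d by (simp add: algebra_simps)
    qed
  qed (use C r in auto)
qed

section \<open>Fixed points and difference estimates\<close>

lemma hoelder_bound_add: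
  assumes "hoelder_bound \<alpha> R k f" "hoelder_bound \<alpha> R l g"
  shows "hoelder_bound \<alpha> R (k + l) (\<lambda>x. f x + g x)"
  unfolding hoelder_bound_def
proof (intro conjI ballI)
  show "norm (f 0 + g 0) \<le> (k + l) * R powr \<alpha>"
    using assms norm_triangle_ineq[of "f 0" "g 0"] unfolding hoelder_bound_def distrib_right by linarith
  fix x y :: 'a assume "x \<in> cball 0 R" "y \<in> cball 0 R"
  then have "norm (f x - f y) \<le> k * norm (x - y) powr \<alpha>" "norm (g x - g y) \<le> l * norm (x - y) powr \<alpha>"
    using assms unfolding hoelder_bound_def by blast+
  moreover have "norm (f x + g x - (f y + g y)) \<le> norm (f x - f y) + norm (g x - g y)"
    using norm_triangle_ineq[of "f x - f y" "g x - g y"] by (simp add: algebra_simps)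
  ultimately show "norm (f x + g x - (f y + g y)) \<le> (k + l) * norm (x - y) powr \<alpha>"
    unfolding distrib_right by linarith
qed

text \<open>Picard iteration from 0. The n-th step has bound (1/2)^(n+1), so the n-th iterate has
  bound 1 - (1/2)^n and never leaves the unit Hoelder ball where \<open>contr\<close> is available.
  Convergence takes place on the ball only, hence the restricted fixed point equation.\<close>

lemma hoelder_fixed_point:
  fixes \<Phi> :: "('a::real_normed_vector \<Rightarrow> 'b::banach) \<Rightarrow> 'a \<Rightarrow> 'b"
  assumes R: "0 < R" and \<alpha>: "0 \<le> \<alpha>"
    and start: "hoelder_bound \<alpha> R (1/2) (\<Phi> (\<lambda>_. 0))"
    and contr: "\<And>f g k. hoelder_bound \<alpha> R 1 f \<Longrightarrow> hoelder_bound \<alpha> R 1 g \<Longrightarrow>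
       hoelder_bound \<alpha> R k (\<lambda>x. f x - g x) \<Longrightarrow> hoelder_bound \<alpha> R (k/2) (\<lambda>x. \<Phi> f x - \<Phi> g x)"
  obtains f where "hoelder_bound \<alpha> R 1 f" "\<And>x. x \<in> cball 0 R \<Longrightarrow> \<Phi> f x = f x"
proof -
  define F where "F n = (\<Phi> ^^ n) (\<lambda>_. 0)" for n
  have F0: "F 0 = (\<lambda>_. 0)" and FS: "F (Suc n) = \<Phi> (F n)" for n by (simp_all add: F_def)
  have le1: "hoelder_bound \<alpha> R 1 (F n)" if "hoelder_bound \<alpha> R (1 - (1/2)^n) (F n)" for n
    using that by (rule hoelder_bound_mono) simp
  have steps: "hoelder_bound \<alpha> R (1 - (1/2)^n) (F n) \<and> hoelder_bound \<alpha> R ((1/2)^Suc n) (\<lambda>x. F (Suc n) x - F n x)" for n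
  proof (induction n)
    case 0
    show ?case using start R by (simp add: F0 FS) (simp add: hoelder_bound_def)
  next
    case (Suc n)
    have "hoelder_bound \<alpha> R ((1/2)^Suc n + (1 - (1/2)^n)) (\<lambda>x. F (Suc n) x - F n x + F n x)"
      using Suc by (intro hoelder_bound_add) auto
    moreover have "(1/2)^Suc n + (1 - (1/2)^n) = 1 - (1/2 :: real)^Suc n" by simp
    ultimately have 1: "hoelder_bound \<alpha> R (1 - (1/2)^Suc n) (F (Suc n))" by simp
    have "hoelder_bound \<alpha> R ((1/2)^Suc n / 2) (\<lambda>x. \<Phi> (F (Suc n)) x - \<Phi> (F n) x)"
      using Suc 1 by (intro contr le1) auto
    then show ?case using 1 unfolding FS by simp
  qed
  have far: "hoelder_bound \<alpha> R ((1/2)^n - (1/2)^(n + m)) (\<lambda>x. F (n + m) x - F n x)" for n m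
  proof (induction m)
    case 0 show ?case using R by (simp add: hoelder_bound_def)
  next
    case (Suc m)
    have "hoelder_bound \<alpha> R ((1/2)^Suc (n + m) + ((1/2)^n - (1/2)^(n + m)))
      (\<lambda>x. (F (Suc (n + m)) x - F (n + m) x) + (F (n + m) x - F n x))"
      using Suc steps by (intro hoelder_bound_add) auto
    moreover have "(1/2)^Suc (n + m) + ((1/2)^n - (1/2)^(n + m)) = (1/2)^n - (1/2 :: real)^(n + Suc m)" by simp
    ultimately show ?case by simp
  qed
  have near: "hoelder_bound \<alpha> R ((1/2)^n) (\<lambda>x. F (n + m) x - F n x)" for n m
    using far by (rule hoelder_bound_mono) simp
  have pw: "norm (F (n + m) x - F n x) \<le> 2 * (1/2)^n * R powr \<alpha>" if "x \<in> cball 0 R" for n m x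
    using hoelder_bound_sup[OF near R \<alpha>, of x n m] that by simp
  have lim0: "(\<lambda>n. 2 * (1/2)^n * R powr \<alpha>) \<longlonglongrightarrow> 0"
    by (intro tendsto_mult_left_zero tendsto_mult_right_zero LIMSEQ_power_zero) simp
  have conv: "convergent (\<lambda>n. F n x)" if x: "x \<in> cball 0 R" for x
  proof (rule Cauchy_convergent, rule CauchyI)
    fix e :: real assume "e > 0"
    then obtain N where N: "2 * (1/2)^N * R powr \<alpha> < e / 2"
      using LIMSEQ_D[OF lim0, of "e / 2"] by (auto dest: spec[of _ "_::nat"] simp: abs_less_iff)
    show "\<exists>M. \<forall>m\<ge>M. \<forall>n\<ge>M. norm (F m x - F n x) < e"
    proof (intro exI allI impI)
      fix m n assume "N \<le> m" "N \<le> n"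
      then have "norm (F m x - F N x) < e / 2" "norm (F n x - F N x) < e / 2"
        using pw[OF x, of N "m - N"] pw[OF x, of N "n - N"] N by auto
      then show "norm (F m x - F n x) < e"
        using norm_triangle_ineq4[of "F m x - F N x" "F n x - F N x"] by simp
    qed
  qed
  define f where "f x = lim (\<lambda>n. F n x)" for x
  have f: "(\<lambda>n. F n x) \<longlonglongrightarrow> f x" if "x \<in> cball 0 R" for x
    using conv[OF that] by (simp add: f_def convergent_LIMSEQ_iff)
  \<comment> \<open>The bounds survive the pointwise limit in \<open>m\<close>, so the limit is
    close to each iterate in the Hoelder sense and not just uniformly; \<open>contr\<close> can then
    be applied to the pair.\<close>
  have close: "hoelder_bound \<alpha> R ((1/2)^n) (\<lambda>x. f x - F n x)" for n
    unfolding hoelder_bound_def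
  proof (intro conjI ballI)
    have sh: "(\<lambda>m. F (n + m) x) \<longlonglongrightarrow> f x" if "x \<in> cball 0 R" for x
      using LIMSEQ_ignore_initial_segment[OF f[OF that], of n] by (simp add: add.commute)
    show "norm (f 0 - F n 0) \<le> (1/2)^n * R powr \<alpha>"
      using near[of n] R
      by (intro Lim_norm_ubound[OF _ tendsto_diff[OF sh tendsto_const]] always_eventually)
         (auto simp: hoelder_bound_def)
    fix x y :: 'a assume xy: "x \<in> cball 0 R" "y \<in> cball 0 R"
    show "norm (f x - F n x - (f y - F n y)) \<le> (1/2)^n * norm (x - y) powr \<alpha>"
    proof (rule Lim_norm_ubound)
      show "(\<lambda>m. F (n + m) x - F n x - (F (n + m) y - F n y)) \<longlonglongrightarrow> f x - F n x - (f y - F n y)"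
        by (intro tendsto_diff sh xy tendsto_const)
      show "\<forall>\<^sub>F m in sequentially. norm (F (n + m) x - F n x - (F (n + m) y - F n y)) \<le> (1/2)^n * norm (x - y) powr \<alpha>"
        using near[of n] xy by (intro always_eventually allI) (auto simp only: hoelder_bound_def)
    qed simp
  qed
  have f1: "hoelder_bound \<alpha> R 1 f" using close[of 0] by (simp add: F0)
  have "\<Phi> f x = f x" if x: "x \<in> cball 0 R" for x
  proof -
    have "hoelder_bound \<alpha> R ((1/2)^n / 2) (\<lambda>x. \<Phi> f x - \<Phi> (F n) x)" for n
      using contr[OF f1 le1 close[of n]] steps by auto
    then have "norm (F (Suc n) x - \<Phi> f x) \<le> 2 * ((1/2)^n / 2) * R powr \<alpha>" for n
      using hoelder_bound_sup[OF _ R \<alpha>, of "(1/2)^n / 2" "\<lambda>x. \<Phi> f x - \<Phi> (F n) x" x] x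
      by (simp add: FS norm_minus_commute)
    then have "norm (F (Suc n) x - \<Phi> f x) \<le> 2 * (1/2)^n * R powr \<alpha>" for n
    proof (rule order_trans)
      have "(1/2)^n * R powr \<alpha> \<le> 2 * ((1/2)^n * R powr \<alpha>)" by simp
      then show "2 * ((1/2)^n / 2) * R powr \<alpha> \<le> 2 * (1/2)^n * R powr \<alpha>" by (simp add: mult.assoc)
    qed
    then have "(\<lambda>n. F (Suc n) x - \<Phi> f x) \<longlonglongrightarrow> 0"
      by (intro Lim_null_comparison[OF always_eventually lim0]) blast
    then have "(\<lambda>n. F (Suc n) x) \<longlonglongrightarrow> \<Phi> f x" by (simp add: LIM_zero_iff)
    moreover have "(\<lambda>n. F (Suc n) x) \<longlonglongrightarrow> f x" using f[OF x] by (rule LIMSEQ_Suc)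
    ultimately show ?thesis by (rule LIMSEQ_unique)
  qed
  then show ?thesis using that f1 by blast
qed

section \<open>Mean value estimates for the nonlinearity and for trial solutions\<close>

lemma linear_basis_bound:
  fixes T :: "'a::euclidean_space \<Rightarrow> 'b::real_normed_vector"
  assumes "linear T" "\<And>b. b \<in> Basis \<Longrightarrow> norm (T b) \<le> c b"
  shows "norm (T x) \<le> (\<Sum>b\<in>Basis. c b) * norm x"
proof -
  have "T x = T (\<Sum>b\<in>Basis. (x \<bullet> b) *\<^sub>R b)" by (simp only: euclidean_representation)
  also have "\<dots> = (\<Sum>b\<in>Basis. (x \<bullet> b) *\<^sub>R T b)" by (simp add: linear_sum[OF assms(1)] linear_scale[OF assms(1)])
  also have "norm \<dots> \<le> (\<Sum>b\<in>Basis. c b * norm x)"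
  proof (rule sum_norm_le)
    fix b :: 'a assume b: "b \<in> Basis"
    then have "\<bar>x \<bullet> b\<bar> * norm (T b) \<le> norm x * c b"
      using assms(2)[OF b] Basis_le_norm[OF b, of x] by (intro mult_mono) auto
    then show "norm ((x \<bullet> b) *\<^sub>R T b) \<le> c b * norm x" by (simp add: mult.commute)
  qed
  finally show ?thesis by (simp add: sum_distrib_right)
qed

text \<open>Compactness of the unit ball bounds \<open>D2\<close> for each fixed pair of directions;
  expanding one direction after the other in the basis merges these bounds into one
  constant.\<close>

lemma C2_derivative_lipschitz:
  fixes F :: "'a::euclidean_space \<Rightarrow> 'b::real_normed_vector"
  assumes F: "\<And>X. (F has_derivative D X) (at X)"
    and D: "\<And>X v. ((\<lambda>X. D X v) has_derivative D2 X v) (at X)"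
    and c: "\<And>v w. continuous_on UNIV (\<lambda>X. D2 X v w)"
  obtains L where "L \<ge> 0"
    "\<And>X Y Z. X \<in> cball 0 1 \<Longrightarrow> Y \<in> cball 0 1 \<Longrightarrow> norm (D X Z - D Y Z) \<le> L * norm (X - Y) * norm Z"
    "\<And>X Z. X \<in> cball 0 1 \<Longrightarrow> norm (D X Z) \<le> L * norm Z"
proof -
  have "\<exists>B. \<forall>X\<in>cball 0 1. norm (D2 X v w) \<le> B" for v w
  proof -
    have "bounded ((\<lambda>X. D2 X v w) ` cball 0 1)"
      by (intro compact_imp_bounded compact_continuous_image continuous_on_subset[OF c]) auto
    then show ?thesis by (auto simp: bounded_iff)
  qed
  then obtain B where B: "\<And>v w X. X \<in> cball 0 1 \<Longrightarrow> norm (D2 X v w) \<le> B v w" by metis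
  have B0: "B v w \<ge> 0" for v w using B[of 0 v w] norm_ge_zero order_trans by (metis centre_in_cball zero_le_one)
  define M where "M v = (\<Sum>w\<in>Basis. B v w)" for v
  have M0: "M v \<ge> 0" for v by (simp add: M_def sum_nonneg B0)
  have inc: "norm (D X v - D Y v) \<le> M v * norm (X - Y)" if "X \<in> cball 0 1" "Y \<in> cball 0 1" for X Y v
  proof (rule mean_value_bound[OF convex_cball _ _ that])
    show "((\<lambda>X. D X v) has_derivative D2 X v) (at X within cball 0 1)" for X
      by (rule has_derivative_at_withinI[OF D])
    show "norm (D2 X v h) \<le> M v * norm h" if "X \<in> cball 0 1" for X h
      unfolding M_def using B[OF that] by (intro linear_basis_bound has_derivative_linear[OF D])
  qed
  have lin: "linear (D X)" for X using F by (rule has_derivative_linear)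
  define L1 where "L1 = (\<Sum>b\<in>Basis. M b)"
  define L where "L = L1 + (\<Sum>b\<in>Basis. norm (D 0 b))"
  have L1: "L1 \<ge> 0" by (simp add: L1_def sum_nonneg M0)
  have L: "L \<ge> 0" "L1 \<le> L" using L1 by (auto simp: L_def sum_nonneg)
  have lip: "norm (D X Z - D Y Z) \<le> L1 * norm (X - Y) * norm Z" if "X \<in> cball 0 1" "Y \<in> cball 0 1" for X Y Z
  proof -
    have "linear (\<lambda>Z. D X Z - D Y Z)" by (intro linear_compose_sub lin)
    then have "norm (D X Z - D Y Z) \<le> (\<Sum>b\<in>Basis. M b * norm (X - Y)) * norm Z"
      by (rule linear_basis_bound) (rule inc[OF that])
    then show ?thesis by (simp add: L1_def sum_distrib_right)
  qed
  show ?thesis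
  proof (rule that[OF L(1)])
    fix X Y Z :: 'a assume X: "X \<in> cball 0 1"
    show "norm (D X Z) \<le> L * norm Z"
    proof -
      have "norm (D X Z - D 0 Z) \<le> L1 * norm (X - 0) * norm Z" using lip[OF X, of 0 Z] by simp
      also have "\<dots> \<le> L1 * 1 * norm Z" using X L1 by (intro mult_right_mono mult_left_mono) auto
      finally have "norm (D X Z - D 0 Z) \<le> L1 * norm Z" by simp
      moreover have "norm (D 0 Z) \<le> (\<Sum>b\<in>Basis. norm (D 0 b)) * norm Z"
        by (rule linear_basis_bound[OF lin]) simp
      ultimately show ?thesis
        using norm_triangle_sub[of "D X Z" "D 0 Z"] unfolding L_def distrib_right by linarith
    qed
    assume Y: "Y \<in> cball 0 1"
    have "norm (D X Z - D Y Z) \<le> L1 * (norm (X - Y) * norm Z)" using lip[OF X Y] by (simp add: mult.assoc)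
    also have "\<dots> \<le> L * (norm (X - Y) * norm Z)" using L by (intro mult_right_mono) auto
    finally show "norm (D X Z - D Y Z) \<le> L * norm (X - Y) * norm Z" by (simp add: mult.assoc)
  qed
qed

text \<open>The derivative only needs to be bounded by \<open>m\<close> in the direction of the second difference, which is
  where the smallness of the derivative in the Hessian variable enters.\<close>

lemma four_point_bound:
  fixes F :: "'a::real_normed_vector \<Rightarrow> 'b::real_normed_vector"
  assumes F: "\<And>X. (F has_derivative D X) (at X)"
    and S: "convex S" "X1 \<in> S" "X2 \<in> S" "Y1 \<in> S" "Y2 \<in> S"
    and lip: "\<And>X Y Z. X \<in> S \<Longrightarrow> Y \<in> S \<Longrightarrow> norm (D X Z - D Y Z) \<le> L * norm (X - Y) * norm Z" "L \<ge> 0"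
    and bd: "\<And>X. X \<in> S \<Longrightarrow> norm (D X ((X1 - X2) - (Y1 - Y2))) \<le> m"
  shows "norm (F X1 - F X2 - (F Y1 - F Y2)) \<le> m + L * (norm (X1 - Y1) + norm (X2 - Y2)) * norm (Y1 - Y2)"
proof -
  define B where "B = m + L * (norm (X1 - Y1) + norm (X2 - Y2)) * norm (Y1 - Y2)"
  define x where "x t = X2 + t *\<^sub>R (X1 - X2)" for t
  define y where "y t = Y2 + t *\<^sub>R (Y1 - Y2)" for t
  have lin: "linear (D X)" for X using F by (rule has_derivative_linear)
  have x': "x t = (1 - t) *\<^sub>R X2 + t *\<^sub>R X1" and y': "y t = (1 - t) *\<^sub>R Y2 + t *\<^sub>R Y1" for t
    by (simp_all add: x_def y_def algebra_simps)
  have "norm ((F (x 1) - F (y 1)) - (F (x 0) - F (y 0))) \<le> B * norm (1 - 0 :: real)"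
  proof (rule mean_value_bound[of "{0..1}" "\<lambda>t. F (x t) - F (y t)" "\<lambda>t s. D (x t) (s *\<^sub>R (X1 - X2)) - D (y t) (s *\<^sub>R (Y1 - Y2))"])
    fix t :: real assume t: "t \<in> {0..1}"
    have xt: "x t \<in> S" and yt: "y t \<in> S"
      unfolding x' y' using S t by (auto intro!: convexD)
    have dx: "(x has_derivative (\<lambda>s. s *\<^sub>R (X1 - X2))) (at t within {0..1})"
      and dy: "(y has_derivative (\<lambda>s. s *\<^sub>R (Y1 - Y2))) (at t within {0..1})"
      unfolding x_def[abs_def] y_def[abs_def] by (auto intro!: derivative_eq_intros)
    show "((\<lambda>t. F (x t) - F (y t)) has_derivative
        (\<lambda>s. D (x t) (s *\<^sub>R (X1 - X2)) - D (y t) (s *\<^sub>R (Y1 - Y2)))) (at t within {0..1})"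
      by (intro has_derivative_diff has_derivative_compose[OF dx F] has_derivative_compose[OF dy F])
    fix s :: real
    \<comment> \<open>Both segments are traversed at the same parameter. The derivative splits into
      \<open>D\<close> applied to the second difference and a change of base point applied to
      \<open>Y1 - Y2\<close>.\<close>
    have "D (x t) (s *\<^sub>R (X1 - X2)) - D (y t) (s *\<^sub>R (Y1 - Y2))
      = s *\<^sub>R (D (x t) ((X1 - X2) - (Y1 - Y2)) + (D (x t) (Y1 - Y2) - D (y t) (Y1 - Y2)))"
      by (simp add: linear_scale[OF lin] linear_diff[OF lin] linear_add[OF lin] algebra_simps)
    also have "norm \<dots> \<le> \<bar>s\<bar> * B"
      unfolding norm_scaleR
    proof (rule mult_left_mono)
      have "x t - y t = (1 - t) *\<^sub>R (X2 - Y2) + t *\<^sub>R (X1 - Y1)" unfolding x' y' by (simp add: algebra_simps)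
      then have "norm (x t - y t) \<le> norm ((1 - t) *\<^sub>R (X2 - Y2)) + norm (t *\<^sub>R (X1 - Y1))"
        by (simp only: norm_triangle_ineq)
      also have "\<dots> \<le> norm (X2 - Y2) + norm (X1 - Y1)"
        using t by (intro add_mono) (auto simp: mult_left_le_one_le)
      finally have "L * norm (x t - y t) * norm (Y1 - Y2) \<le> L * (norm (X1 - Y1) + norm (X2 - Y2)) * norm (Y1 - Y2)"
        using lip(2) by (intro mult_right_mono mult_left_mono) auto
      then show "norm (D (x t) ((X1 - X2) - (Y1 - Y2)) + (D (x t) (Y1 - Y2) - D (y t) (Y1 - Y2))) \<le> B"
        using bd[OF xt] lip(1)[OF xt yt, of "Y1 - Y2"]
        unfolding B_def by (intro order_trans[OF norm_triangle_ineq]) linarith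
    qed simp
    finally show "norm (D (x t) (s *\<^sub>R (X1 - X2)) - D (y t) (s *\<^sub>R (Y1 - Y2))) \<le> B * norm s"
      by (simp add: mult.commute)
  qed auto
  then show ?thesis by (simp add: x_def y_def B_def algebra_simps)
qed

text \<open>Two applications of the mean value inequality from the origin, where \<open>u\<close>
  and its derivative vanish. Since R \<le> 1 absorbs the lengths of the segments, the Hessian bound
  \<open>b\<close> serves every lower order.\<close>

lemma lower_derivative_bounds:
  fixes u :: "'a::euclidean_space \<Rightarrow> 'b::real_normed_vector"
  assumes u: "\<And>x. (u has_derivative D1 x) (at x)" and D1: "\<And>x v. ((\<lambda>x. D1 x v) has_derivative D2 x v) (at x)"
    and z: "u 0 = 0" "\<And>v. D1 0 v = 0" and R: "R > 0" "R \<le> 1" and b: "b \<ge> 0"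
    and D2: "\<forall>x\<in>cball 0 R. \<forall>v w. norm (D2 x v w) \<le> b * norm v * norm w"
    and xy: "x \<in> cball 0 R" "y \<in> cball 0 R"
  shows "norm (D1 x v - D1 y v) \<le> b * norm v * norm (x - y)" "norm (u x - u y) \<le> b * norm (x - y)"
    "norm (D1 x v) \<le> b * norm v" "norm (u x) \<le> b"
proof -
  have 1: "norm (D1 x v - D1 y v) \<le> b * norm v * norm (x - y)" if "x \<in> cball 0 R" "y \<in> cball 0 R" for x y v
    using D2 by (intro mean_value_bound[OF convex_cball has_derivative_at_withinI[OF D1] _ that]) auto
  have 2: "norm (D1 x v) \<le> b * norm v" if x: "x \<in> cball 0 R" for x v
  proof -
    have "norm (D1 x v - D1 0 v) \<le> b * norm v * norm (x - 0)" using x R by (intro 1) auto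
    also have "\<dots> \<le> b * norm v * 1" using x R b by (intro mult_left_mono) auto
    finally show ?thesis by (simp add: z)
  qed
  have 3: "norm (u x - u y) \<le> b * norm (x - y)" if "x \<in> cball 0 R" "y \<in> cball 0 R" for x y
    using 2 by (intro mean_value_bound[OF convex_cball has_derivative_at_withinI[OF u] _ that]) auto
  have "norm (u x - u 0) \<le> b * norm (x - 0)" using xy R by (intro 3) auto
  also have "\<dots> \<le> b * 1" using xy R b by (intro mult_left_mono) auto
  finally show "norm (u x) \<le> b" by (simp add: z)
  show "norm (D1 x v - D1 y v) \<le> b * norm v * norm (x - y)" "norm (u x - u y) \<le> b * norm (x - y)"
    "norm (D1 x v) \<le> b * norm v" using 1 2 3 xy by auto
qed

section \<open>The nonlinear problem on a small ball\<close>

definition gradient_of :: "(real^'n \<Rightarrow> real^'N) \<Rightarrow> real^'n^'N" where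
  "gradient_of d = (\<chi> k i. d (axis i 1) $ k)"

definition hessian_of :: "(real^'n \<Rightarrow> real^'n \<Rightarrow> real^'N) \<Rightarrow> real^'n^'n^'N" where
  "hessian_of h = (\<chi> k i j. h (axis i 1) (axis j 1) $ k)"

lemma norm_vec_le_sum: "norm (x :: 'a::real_normed_vector^'n) \<le> (\<Sum>i\<in>UNIV. norm (x $ i))"
  unfolding norm_vec_def by (rule L2_set_le_sum) simp

lemma gradient_of_diff: "gradient_of (\<lambda>v. d v - d' v) = gradient_of d - gradient_of d'"
  by (simp add: gradient_of_def vec_eq_iff)

lemma hessian_of_diff: "hessian_of (\<lambda>v w. h v w - h' v w) = hessian_of h - hessian_of h'"
  by (simp add: hessian_of_def vec_eq_iff)

lemma norm_gradient_of:
  fixes d :: "real^'n \<Rightarrow> real^'N"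
  assumes "\<And>v. norm (d v) \<le> m * norm v" "0 \<le> m"
  shows "norm (gradient_of d) \<le> real (CARD('N) * CARD('n) * CARD('n)) * m"
proof -
  have "norm (gradient_of d) \<le> (\<Sum>k\<in>UNIV. \<Sum>i\<in>UNIV. norm (gradient_of d $ k $ i))"
    by (rule order_trans[OF norm_vec_le_sum sum_mono[OF norm_vec_le_sum]])
  also have "\<dots> \<le> (\<Sum>k\<in>(UNIV :: 'N set). \<Sum>i\<in>(UNIV :: 'n set). m)"
  proof (intro sum_mono)
    fix k i show "norm (gradient_of d $ k $ i) \<le> m"
      using component_le_norm_cart[of "d (axis i 1)" k] assms(1)[of "axis i 1"] by (simp add: gradient_of_def)
  qed
  \<comment> \<open>The inserted 1 is enlarged to \<open>CARD('n)\<close> so that gradients and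
    Hessians share one constant, later called \<open>G\<close>.\<close>
  also have "\<dots> = real (CARD('N) * CARD('n)) * 1 * m" by simp
  also have "\<dots> \<le> real (CARD('N) * CARD('n)) * real CARD('n) * m"
    using assms(2) by (intro mult_right_mono mult_left_mono) (auto simp: Suc_le_eq)
  finally show ?thesis by simp
qed

lemma norm_hessian_of:
  fixes h :: "real^'n \<Rightarrow> real^'n \<Rightarrow> real^'N"
  assumes "\<And>v w. norm (h v w) \<le> m * norm v * norm w"
  shows "norm (hessian_of h) \<le> real (CARD('N) * CARD('n) * CARD('n)) * m"
proof -
  have "norm (hessian_of h) \<le> (\<Sum>k\<in>UNIV. \<Sum>i\<in>UNIV. \<Sum>j\<in>UNIV. norm (hessian_of h $ k $ i $ j))"
    by (rule order_trans[OF norm_vec_le_sum sum_mono[OF order_trans[OF norm_vec_le_sum sum_mono[OF norm_vec_le_sum]]]])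
  also have "\<dots> \<le> (\<Sum>k\<in>(UNIV :: 'N set). \<Sum>i\<in>(UNIV :: 'n set). \<Sum>j\<in>(UNIV :: 'n set). m)"
  proof (intro sum_mono)
    fix k i j show "norm (hessian_of h $ k $ i $ j) \<le> m"
      using component_le_norm_cart[of "h (axis i 1) (axis j 1)" k] assms[of "axis i 1" "axis j 1"]
      by (simp add: hessian_of_def)
  qed
  finally show ?thesis by simp
qed

lemma contract_bound:
  fixes A :: "real^'n^'n" and h :: "'n \<Rightarrow> 'n \<Rightarrow> 'b::real_normed_vector"
  assumes "\<And>i j. \<bar>A $ i $ j\<bar> \<le> a" "\<And>i j. norm (h i j) \<le> m"
  shows "norm (contract A h) \<le> real (CARD('n) * CARD('n)) * (a * m)"
proof -
  have "norm (contract A h) \<le> (\<Sum>i\<in>(UNIV :: 'n set). \<Sum>j\<in>(UNIV :: 'n set). a * m)"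
    unfolding contract_def using assms
    by (intro sum_norm_le) (auto intro!: mult_mono order_trans[OF abs_ge_zero assms(1)])
  then show ?thesis by simp
qed

lemma norm_Pair4_le: "norm (x, p, q, r) \<le> norm x + norm p + norm q + norm r"
  using norm_Pair_le[of x "(p, q, r)"] norm_Pair_le[of p "(q, r)"] norm_Pair_le[of q r] by linarith

text \<open>In t = t^(1-\<alpha>) t^\<alpha> the first factor is at most 1 and at most
  (2R)^(1-\<alpha>). The range of \<open>t\<close> is that of distances in a ball of radius R; the
  second form supplies smallness where no other small factor is present.\<close>

lemma norm_le_powr:
  fixes t R \<alpha> :: real
  assumes "0 \<le> t" "t \<le> 2 * R" "R \<le> 1 / 2" "0 < \<alpha>" "\<alpha> < 1"
  shows "t \<le> t powr \<alpha>" "t \<le> 2 * R powr (1 - \<alpha>) * t powr \<alpha>"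
proof -
  have e: "t = t powr (1 - \<alpha>) * t powr \<alpha>"
    using assms by (cases "t = 0") (simp_all flip: powr_add)
  have "t powr (1 - \<alpha>) \<le> 1" using assms by (intro powr_le1) auto
  then have "t powr (1 - \<alpha>) * t powr \<alpha> \<le> 1 * t powr \<alpha>" by (intro mult_right_mono) auto
  then show "t \<le> t powr \<alpha>" using e by simp
  have "t powr (1 - \<alpha>) \<le> (2 * R) powr (1 - \<alpha>)" using assms by (intro powr_mono2) auto
  also have "\<dots> = 2 powr (1 - \<alpha>) * R powr (1 - \<alpha>)" using assms by (simp add: powr_mult)
  also have "\<dots> \<le> 2 powr 1 * R powr (1 - \<alpha>)" using assms by (intro mult_right_mono powr_mono) auto
  finally have "t powr (1 - \<alpha>) * t powr \<alpha> \<le> 2 * R powr (1 - \<alpha>) * t powr \<alpha>"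
    by (intro mult_right_mono) auto
  then show "t \<le> 2 * R powr (1 - \<alpha>) * t powr \<alpha>" using e by simp
qed

text \<open>\<open>C1\<close> bounds Hessians of \<open>u f\<close> by oscillation plus centre
  value, \<open>C2\<close> adds the polynomial, \<open>C3\<close> is the Hoelder constant of a jet
  and \<open>C4\<close> its size, where sizes are in units of \<open>R powr \<alpha>\<close>. None
  of them involves R or \<epsilon>. The assumption \<open>small\<close> keeps jets in the unit ball,
  where the estimates for \<open>DF\<close> hold.\<close>

locale local_problem =
  fixes A :: "real^'n \<Rightarrow> real^'n^'n"
    and F :: "(real^'n) \<times> (real^'N) \<times> (real^'n^'N) \<times> (real^'n^'n^'N) \<Rightarrow> real^'N"
    and DF :: "(real^'n) \<times> (real^'N) \<times> (real^'n^'N) \<times> (real^'n^'n^'N) \<Rightarrow>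
       (real^'n) \<times> (real^'N) \<times> (real^'n^'N) \<times> (real^'n^'n^'N) \<Rightarrow> real^'N"
    and L LA C \<eta> \<alpha> tr R \<epsilon> G C1 C2 C3 C4 :: real
    and u :: "(real^'n \<Rightarrow> real^'N) \<Rightarrow> real^'n \<Rightarrow> real^'N"
    and D1 :: "(real^'n \<Rightarrow> real^'N) \<Rightarrow> real^'n \<Rightarrow> real^'n \<Rightarrow> real^'N"
    and D2 :: "(real^'n \<Rightarrow> real^'N) \<Rightarrow> real^'n \<Rightarrow> real^'n \<Rightarrow> real^'n \<Rightarrow> real^'N"
    and Q :: "(real^'n \<Rightarrow> real^'N) \<Rightarrow> real^'n \<Rightarrow> real^'N"
    and h :: "real^'n \<Rightarrow> real^'n \<Rightarrow> real" and e :: "real^'N"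
  assumes \<alpha>: "0 < \<alpha>" "\<alpha> < 1" and R: "0 < R" "R \<le> 1 / 2" and eps: "0 \<le> \<epsilon>" "\<epsilon> \<le> R powr \<alpha>"
    and nn: "0 \<le> L" "0 \<le> LA" "0 \<le> C" "0 \<le> \<eta>" "0 < tr"
    and G: "G = real (CARD('N) * CARD('n) * CARD('n))"
    and C1: "C1 = C + 1 / tr" and C2: "C2 = C1 + \<eta>" and C3: "C3 = 1 + C2 + G * C2 + G * C"
    and C4: "C4 = 1 + C2 + G * C2 + G * C2" and small: "C4 * R powr \<alpha> \<le> 1"
    and op: "is_local_inverse (A 0) \<alpha> R tr C u D1 D2 Q"
    and A_l: "\<And>x y i j. x \<in> cball 0 1 \<Longrightarrow> y \<in> cball 0 1 \<Longrightarrow> \<bar>A x $ i $ j - A y $ i $ j\<bar> \<le> LA * norm (x - y)"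
    and dF: "\<And>X. (F has_derivative DF X) (at X)"
    and DF_l: "\<And>X Y Z. X \<in> cball 0 1 \<Longrightarrow> Y \<in> cball 0 1 \<Longrightarrow> norm (DF X Z - DF Y Z) \<le> L * norm (X - Y) * norm Z"
    and DF_b: "\<And>X Z. X \<in> cball 0 1 \<Longrightarrow> norm (DF X Z) \<le> L * norm Z"
    and DF0: "\<And>s. DF 0 (0, 0, 0, s) = 0" and F0: "F 0 = 0"
    and h_bil: "bounded_bilinear h" and h_sym: "\<And>v w. h v w = h w v"
    and h_b: "\<And>v w. \<bar>h v w\<bar> \<le> \<eta> * norm v * norm w"
    and h_tr: "contract (A 0) (\<lambda>i j. h (axis i 1) (axis j 1)) = 0"
    and norm_e: "norm e = 1"
begin

lemmas du = is_local_inverseD(1)[OF op]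
  and dD1 = is_local_inverseD(2)[OF op]
  and D2_sym = is_local_inverseD(3)[OF op]
  and u0 = is_local_inverseD(4)[OF op]
  and D10 = is_local_inverseD(5)[OF op]
  and D20 = is_local_inverseD(6)[OF op]
  and sol = is_local_inverseD(7)[OF op]
  and D2_h = is_local_inverseD(8)[OF op]
  and Q0 = is_local_inverseD(9)[OF op]
  and Q_l = is_local_inverseD(10)[OF op]
  and u_diff = is_local_inverse_diff(1)[OF op]
  and D1_diff = is_local_inverse_diff(2)[OF op]
  and D2_diff = is_local_inverse_diff(3)[OF op]
  and Q_diff = is_local_inverse_diff(4)[OF op]

text \<open>
  \<open>h\<close> is annihilated by the operator at the origin, so a fixed point \<open>f\<close> of \<open>\<Phi>\<close> gives a solution \<open>uF f\<close>.
\<close>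

definition "D2F f x v w = D2 f x v w + (\<epsilon> * h v w) *\<^sub>R e"
definition "D1F f x v = D1 f x v + (\<epsilon> * h x v) *\<^sub>R e"
definition "uF f x = u f x + (\<epsilon> / 2 * h x x) *\<^sub>R e"
definition "jet f x = (x, uF f x, gradient_of (D1F f x), hessian_of (D2F f x))"
definition "\<Phi> f x = F (jet f x) - contract (A x - A 0) (\<lambda>i j. D2F f x (axis i 1) (axis j 1)) + Q f x"

section \<open>Size and increments of trial solutions and their jets\<close>

lemma pos: "0 \<le> C1" "0 \<le> C2" "1 \<le> G" "1 \<le> C3" "1 \<le> C4" "0 \<le> R powr \<alpha>" "R powr \<alpha> \<le> 1" "R \<le> R powr \<alpha>"
proof -
  show c: "0 \<le> C1" "0 \<le> C2" using nn by (auto simp: C1 C2)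
  have "real 1 \<le> real (CARD('N) * CARD('n) * CARD('n))" by (rule of_nat_mono) (simp add: Suc_le_eq)
  then show g: "1 \<le> G" unfolding G by (simp only: of_nat_1)
  have "0 \<le> G * C2" "0 \<le> G * C" using c g nn by auto
  then show "1 \<le> C3" "1 \<le> C4" using c unfolding C3 C4 by linarith+
  show "0 \<le> R powr \<alpha>" by simp
  show "R powr \<alpha> \<le> 1" using R \<alpha> by (intro powr_le1) auto
  show "R \<le> R powr \<alpha>" using norm_le_powr(1)[of R R \<alpha>] R \<alpha> by auto
qed

lemma dist_le:
  assumes "x \<in> cball 0 R" "y \<in> cball 0 R"
  shows "norm (x - y :: real^'n) \<le> norm (x - y) powr \<alpha>"
    "norm (x - y) \<le> 2 * R powr (1 - \<alpha>) * norm (x - y) powr \<alpha>"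
  using norm_le_powr[of "norm (x - y)" R \<alpha>] norm_triangle_ineq4[of x y] assms R \<alpha> by auto

lemma ball_subset: "x \<in> cball 0 R \<Longrightarrow> (x :: real^'n) \<in> cball 0 1"
  using R by auto

lemma zero_in_ball: "(0 :: real^'n) \<in> cball 0 R" using R by simp

lemma k_nonneg: "hoelder_bound \<alpha> R k (f :: real^'n \<Rightarrow> real^'N) \<Longrightarrow> 0 \<le> k"
  using hoelder_bound_nonneg R(1) by blast

lemma duF: "hoelder_bound \<alpha> R k f \<Longrightarrow> (uF f has_derivative D1F f x) (at x)"
proof -
  assume f: "hoelder_bound \<alpha> R k f"
  have "((\<lambda>x. h x x) has_derivative (\<lambda>v. h x v + h v x)) (at x)"
    by (rule bounded_bilinear.FDERIV[OF h_bil has_derivative_ident has_derivative_ident])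
  then have "((\<lambda>x. u f x + (\<epsilon> / 2 * h x x) *\<^sub>R e) has_derivative
      (\<lambda>v. D1 f x v + (\<epsilon> / 2 * (h x v + h v x)) *\<^sub>R e)) (at x)"
    by (intro has_derivative_add du[OF f] has_derivative_scaleR_left has_derivative_mult_right)
  moreover have "(\<lambda>v. D1 f x v + (\<epsilon> / 2 * (h x v + h v x)) *\<^sub>R e) = D1F f x"
  proof (rule ext)
    fix v show "D1 f x v + (\<epsilon> / 2 * (h x v + h v x)) *\<^sub>R e = D1F f x v"
      using h_sym[of v x] by (simp add: D1F_def)
  qed
  ultimately show ?thesis by (simp only: uF_def[abs_def])
qed

lemma dD1F: "hoelder_bound \<alpha> R k f \<Longrightarrow> ((\<lambda>x. D1F f x v) has_derivative D2F f x v) (at x)"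
proof -
  assume f: "hoelder_bound \<alpha> R k f"
  have "((\<lambda>x. h x v) has_derivative (\<lambda>w. h w v)) (at x)"
    by (rule bounded_linear_imp_has_derivative[OF bounded_bilinear.bounded_linear_left[OF h_bil]])
  then have "((\<lambda>x. D1 f x v + (\<epsilon> * h x v) *\<^sub>R e) has_derivative (\<lambda>w. D2 f x v w + (\<epsilon> * h w v) *\<^sub>R e)) (at x)"
    by (intro has_derivative_add dD1[OF f] has_derivative_scaleR_left has_derivative_mult_right)
  moreover have "(\<lambda>w. D2 f x v w + (\<epsilon> * h w v) *\<^sub>R e) = D2F f x v"
    unfolding D2F_def[abs_def] h_sym[of v] ..
  ultimately show ?thesis by (simp add: D1F_def[abs_def])
qed

lemma uF_0: "hoelder_bound \<alpha> R k f \<Longrightarrow> uF f 0 = 0" "hoelder_bound \<alpha> R k f \<Longrightarrow> D1F f 0 v = 0"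
  using bounded_bilinear.zero_left[OF h_bil] by (simp_all add: uF_def D1F_def u0 D10)

text \<open>At the centre the Hessian is explicit, which gives the second bound; its oscillation
  over the ball adds \<open>C\<close> and gives the first.\<close>

lemma D2_bound:
  assumes f: "hoelder_bound \<alpha> R k f" and x: "x \<in> cball 0 R"
  shows "norm (D2 f x v w) \<le> C1 * k * R powr \<alpha> * norm v * norm w"
    and "norm (D2 f 0 v w) \<le> 1 / tr * k * R powr \<alpha> * norm v * norm w"
proof -
  have k: "0 \<le> k" by (rule k_nonneg[OF f])
  have "norm (D2 f 0 v w) = \<bar>v \<bullet> w\<bar> * (1 / tr * norm (f 0))"
    using nn D20[OF f] by simp
  also have "\<dots> \<le> (norm v * norm w) * (1 / tr * (k * R powr \<alpha>))"
    using f nn Cauchy_Schwarz_ineq2[of v w] unfolding hoelder_bound_def by (intro mult_mono) auto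
  finally show 0: "norm (D2 f 0 v w) \<le> 1 / tr * k * R powr \<alpha> * norm v * norm w" by (simp add: mult_ac)
  have "norm (D2 f x v w - D2 f 0 v w) \<le> C * k * norm (x - 0) powr \<alpha> * norm v * norm w"
    by (rule D2_h[OF f x zero_in_ball])
  also have "\<dots> \<le> C * k * R powr \<alpha> * norm v * norm w"
    using x k nn \<alpha> by (intro mult_right_mono mult_left_mono powr_mono2) auto
  finally show "norm (D2 f x v w) \<le> C1 * k * R powr \<alpha> * norm v * norm w"
    using 0 norm_triangle_sub[of "D2 f x v w" "D2 f 0 v w"] unfolding C1 distrib_right by linarith
qed

lemma D2F_bound:
  assumes f: "hoelder_bound \<alpha> R 1 f" and x: "x \<in> cball 0 R"
  shows "norm (D2F f x v w) \<le> C2 * R powr \<alpha> * norm v * norm w"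
proof -
  have "norm ((\<epsilon> * h v w) *\<^sub>R e) = \<epsilon> * \<bar>h v w\<bar>" using norm_e eps by (simp add: abs_mult)
  also have "\<dots> \<le> R powr \<alpha> * (\<eta> * norm v * norm w)" using eps h_b by (intro mult_mono) auto
  finally have "norm ((\<epsilon> * h v w) *\<^sub>R e) \<le> \<eta> * R powr \<alpha> * norm v * norm w" by (simp add: mult_ac)
  then show ?thesis
    using D2_bound(1)[OF f x, of v w] norm_triangle_ineq[of "D2 f x v w" "(\<epsilon> * h v w) *\<^sub>R e"]
    unfolding D2F_def C2 distrib_right by simp
qed

lemma bound_axis:
  fixes x :: "'b::real_normed_vector"
  shows "norm x \<le> m * norm (axis i 1 :: real^'n) * norm (axis j 1 :: real^'n) \<Longrightarrow> norm x \<le> m"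
  by simp

lemmas lower = lower_derivative_bounds[where R = R]

text \<open>Position, value and gradient are Lipschitz, the Hessian is only Hoelder. The parts are
  kept apart because a Lipschitz increment can still be traded for a power of R.\<close>

lemma jet_increment:
  assumes f: "hoelder_bound \<alpha> R 1 f" and xy: "x \<in> cball 0 R" "y \<in> cball 0 R"
  shows "norm (uF f x - uF f y) \<le> C2 * norm (x - y)"
    "norm (gradient_of (D1F f x) - gradient_of (D1F f y)) \<le> G * C2 * norm (x - y)"
    "norm (hessian_of (D2F f x) - hessian_of (D2F f y)) \<le> G * C * norm (x - y) powr \<alpha>"
    "norm (jet f x - jet f y) \<le> C3 * norm (x - y) powr \<alpha>"
    "norm (jet f x) \<le> C4 * R powr \<alpha>"
proof -
  have R1: "R \<le> 1" using R by simp
  have b: "0 \<le> C2 * R powr \<alpha>" using pos by simp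
  have b1: "C2 * R powr \<alpha> \<le> C2" using pos mult_left_mono[of "R powr \<alpha>" 1 C2] by simp
  have "\<forall>x\<in>cball 0 R. \<forall>v w. norm (D2F f x v w) \<le> C2 * R powr \<alpha> * norm v * norm w"
    using D2F_bound[OF f] by blast
  note low = lower[OF duF[OF f] dD1F[OF f] uF_0[OF f] R(1) R1 b this xy]
  have "C2 * R powr \<alpha> * norm (x - y) \<le> C2 * norm (x - y)" using b1 by (intro mult_right_mono) auto
  then show 1: "norm (uF f x - uF f y) \<le> C2 * norm (x - y)" using low(2) by linarith
  have "norm (gradient_of (\<lambda>v. D1F f x v - D1F f y v)) \<le> G * (C2 * norm (x - y))"
    unfolding G
  proof (rule norm_gradient_of)
    fix v :: "real^'n"
    have "C2 * R powr \<alpha> * norm v * norm (x - y) \<le> C2 * norm v * norm (x - y)"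
      using b1 by (intro mult_right_mono) auto
    then show "norm (D1F f x v - D1F f y v) \<le> C2 * norm (x - y) * norm v"
      using low(1)[of v] by (simp add: mult_ac)
  qed (use pos in simp)
  then show 2: "norm (gradient_of (D1F f x) - gradient_of (D1F f y)) \<le> G * C2 * norm (x - y)"
    by (simp add: gradient_of_diff mult.assoc)
  have "norm (hessian_of (\<lambda>v w. D2F f x v w - D2F f y v w)) \<le> G * (C * norm (x - y) powr \<alpha>)"
    unfolding G by (rule norm_hessian_of) (use D2_h[OF f xy] in \<open>simp add: D2F_def\<close>)
  then show 3: "norm (hessian_of (D2F f x) - hessian_of (D2F f y)) \<le> G * C * norm (x - y) powr \<alpha>"
    by (simp add: hessian_of_diff mult.assoc)
  have "norm (jet f x - jet f y) \<le> norm (x - y) + norm (uF f x - uF f y)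
      + norm (gradient_of (D1F f x) - gradient_of (D1F f y)) + norm (hessian_of (D2F f x) - hessian_of (D2F f y))"
    unfolding jet_def diff_Pair by (rule norm_Pair4_le)
  also have "\<dots> \<le> (1 + C2 + G * C2) * norm (x - y) + G * C * norm (x - y) powr \<alpha>"
    unfolding distrib_right using 1 2 3 by linarith
  also have "\<dots> \<le> (1 + C2 + G * C2) * norm (x - y) powr \<alpha> + G * C * norm (x - y) powr \<alpha>"
    using dist_le(1)[OF xy] pos by (intro add_right_mono mult_left_mono) auto
  finally show "norm (jet f x - jet f y) \<le> C3 * norm (x - y) powr \<alpha>" by (simp add: C3 distrib_right)
  have "norm (gradient_of (D1F f x)) \<le> G * (C2 * R powr \<alpha>)"
    unfolding G by (rule norm_gradient_of[OF low(3) b])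
  moreover have "norm (hessian_of (D2F f x)) \<le> G * (C2 * R powr \<alpha>)"
    unfolding G by (rule norm_hessian_of[OF D2F_bound[OF f xy(1)]])
  moreover have "norm x \<le> R powr \<alpha>" using xy(1) pos(8) by simp
  ultimately have "norm x + norm (uF f x) + norm (gradient_of (D1F f x)) + norm (hessian_of (D2F f x)) \<le> C4 * R powr \<alpha>"
    using low(4) unfolding C4 distrib_right mult_1 mult.assoc by linarith
  then show "norm (jet f x) \<le> C4 * R powr \<alpha>"
    unfolding jet_def using norm_Pair4_le order_trans by blast
qed

lemma jet_in_ball: "hoelder_bound \<alpha> R 1 f \<Longrightarrow> x \<in> cball 0 R \<Longrightarrow> jet f x \<in> cball 0 (C4 * R powr \<alpha>)"
  using jet_increment(5)[of f x x] by simp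

lemma unit_ball: "X \<in> cball 0 (C4 * R powr \<alpha>) \<Longrightarrow> X \<in> cball 0 1" for X :: "'z::real_normed_vector"
  using small by simp

text \<open>In the Hessian direction \<open>DF\<close> vanishes at 0, so its Lipschitz bound makes
  it at most \<open>L * (C4 * R powr \<alpha>)\<close> at jets of that size. The Hessian slot is the
  one slot with a small factor.\<close>

lemma DF_split:
  assumes X: "X \<in> cball 0 (C4 * R powr \<alpha>)"
  shows "norm (DF X (x, p, q, r)) \<le> L * (norm x + norm p + norm q) + L * (C4 * R powr \<alpha>) * norm r"
proof -
  have lin: "linear (DF X)" using dF by (rule has_derivative_linear)
  have X1: "X \<in> cball 0 1" using X by (rule unit_ball)
  have "DF X (x, p, q, r) = DF X (x, p, q, 0) + (DF X (0, 0, 0, r) - DF 0 (0, 0, 0, r))"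
    using linear_add[OF lin, of "(x, p, q, 0)" "(0, 0, 0, r)"] by (simp add: DF0)
  also have "norm \<dots> \<le> norm (DF X (x, p, q, 0)) + norm (DF X (0, 0, 0, r) - DF 0 (0, 0, 0, r))"
    by (rule norm_triangle_ineq)
  also have "\<dots> \<le> L * norm (x, p, q, 0 :: real^'n^'n^'N) + L * norm (X - 0) * norm (0 :: real^'n, 0 :: real^'N, 0 :: real^'n^'N, r)"
    by (intro add_mono DF_b DF_l X1) simp
  also have "\<dots> \<le> L * (norm x + norm p + norm q) + L * (C4 * R powr \<alpha>) * norm r"
  proof (intro add_mono mult_left_mono mult_mono)
    show "norm (x, p, q, 0 :: real^'n^'n^'N) \<le> norm x + norm p + norm q"
      using norm_Pair4_le[of x p q "0 :: real^'n^'n^'N"] by simp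
    show "norm (0 :: real^'n, 0 :: real^'N, 0 :: real^'n^'N, r) \<le> norm r"
      using norm_Pair4_le[of "0 :: real^'n" "0 :: real^'N" "0 :: real^'n^'N" r] by simp
  qed (use X nn pos in auto)
  finally show ?thesis .
qed

text \<open>The four-point bound with its second pair collapsed to 0, which removes the correction
  term.\<close>

lemma F_increment:
  assumes "X1 \<in> cball 0 (C4 * R powr \<alpha>)" "X2 \<in> cball 0 (C4 * R powr \<alpha>)"
    and "X1 - X2 = (x, p, q, r)"
  shows "norm (F X1 - F X2) \<le> L * (norm x + norm p + norm q) + L * (C4 * R powr \<alpha>) * norm r"
proof -
  have 0: "0 \<in> cball (0 :: (real^'n) \<times> (real^'N) \<times> (real^'n^'N) \<times> (real^'n^'n^'N)) (C4 * R powr \<alpha>)"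
    using pos by simp
  have "norm (F X1 - F X2 - (F 0 - F 0)) \<le> (L * (norm x + norm p + norm q) + L * (C4 * R powr \<alpha>) * norm r)
     + L * (norm (X1 - 0) + norm (X2 - 0)) * norm (0 - 0 :: (real^'n) \<times> (real^'N) \<times> (real^'n^'N) \<times> (real^'n^'n^'N))"
    by (rule four_point_bound[OF dF convex_cball assms(1,2) 0 0 DF_l nn(1)])
       (use DF_split unit_ball assms(3) in auto)
  then show ?thesis by simp
qed

text \<open>A discrete product rule: the coefficient deviation from the centre, at most
  \<open>LA * R powr \<alpha>\<close>, meets the increment of \<open>T\<close>, and the coefficient
  increment between x and y meets the size of \<open>T\<close>.\<close>

lemma contract_increment:
  fixes T :: "real^'n \<Rightarrow> 'n \<Rightarrow> 'n \<Rightarrow> real^'N"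
  assumes xy: "x \<in> cball 0 R" "y \<in> cball 0 R" and "0 \<le> m"
    and h: "\<And>i j. norm (T x i j - T y i j) \<le> c * norm (x - y) powr \<alpha>" and b: "\<And>i j. norm (T y i j) \<le> m * R powr \<alpha>"
    and c: "0 \<le> c"
  shows "norm (contract (A x - A 0) (T x) - contract (A y - A 0) (T y))
    \<le> real (CARD('n) * CARD('n)) * LA * (c + m) * R powr \<alpha> * norm (x - y) powr \<alpha>"
proof -
  have e: "contract (A x - A 0) (T x) - contract (A y - A 0) (T y)
      = contract (A x - A 0) (\<lambda>i j. T x i j - T y i j) + contract (A x - A y) (T y)"
    by (simp add: contract_diff contract_matrix_diff)
  have "norm (contract (A x - A 0) (\<lambda>i j. T x i j - T y i j))
      \<le> real (CARD('n) * CARD('n)) * ((LA * R powr \<alpha>) * (c * norm (x - y) powr \<alpha>))"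
  proof (rule contract_bound[OF _ h])
    fix i j
    have "\<bar>A x $ i $ j - A 0 $ i $ j\<bar> \<le> LA * norm (x - 0)"
      using xy R by (intro A_l ball_subset) auto
    also have "\<dots> \<le> LA * R powr \<alpha>" using xy nn pos(8) by (intro mult_left_mono) auto
    finally show "\<bar>(A x - A 0) $ i $ j\<bar> \<le> LA * R powr \<alpha>" by simp
  qed
  moreover have "norm (contract (A x - A y) (T y))
      \<le> real (CARD('n) * CARD('n)) * ((LA * norm (x - y) powr \<alpha>) * (m * R powr \<alpha>))"
  proof (rule contract_bound[OF _ b])
    fix i j
    have "\<bar>A x $ i $ j - A y $ i $ j\<bar> \<le> LA * norm (x - y)"
      using xy R by (intro A_l ball_subset) auto
    also have "\<dots> \<le> LA * norm (x - y) powr \<alpha>" using dist_le(1)[OF xy] nn by (intro mult_left_mono) auto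
    finally show "\<bar>(A x - A y) $ i $ j\<bar> \<le> LA * norm (x - y) powr \<alpha>" by simp
  qed
  ultimately show ?thesis
    unfolding e by (intro order_trans[OF norm_triangle_ineq]) (simp add: algebra_simps)
qed

lemma Q_increment:
  assumes f: "hoelder_bound \<alpha> R k f" and xy: "x \<in> cball 0 R" "y \<in> cball 0 R"
  shows "norm (Q f x - Q f y) \<le> C * R powr \<alpha> * k * norm (x - y) powr \<alpha>"
proof -
  have "norm (Q f x - Q f y) \<le> C * k * R powr \<alpha> * norm (x - y)" by (rule Q_l[OF f xy])
  also have "\<dots> \<le> C * k * R powr \<alpha> * norm (x - y) powr \<alpha>"
    using dist_le(1)[OF xy] nn k_nonneg[OF f] by (intro mult_left_mono) auto
  finally show ?thesis by (simp add: mult_ac)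
qed

text \<open>The summands are, in order, the four-point bound for \<open>F\<close>, the variable
  coefficients, the error \<open>Q\<close>, and the value at the centre.\<close>

definition "K1 = L * ((1 + G) * C1 + C4 * G * C + 2 * C3 * ((1 + 2 * G) * C1))
  + real (CARD('n) * CARD('n)) * LA * (C + C1) + C + L * C4 * G * (1 / tr)"

text \<open>The first summand belongs to the Lipschitz entries of a single jet and is the one paired
  with \<open>R powr (1 - \<alpha>)\<close>.\<close>

definition "K2 = 2 * L * (1 + C2 + G * C2) + L * C4 * G * C
  + real (CARD('n) * CARD('n)) * LA * (C + C2) + C + L * C4 * G * C2"

lemma \<Phi>_diff_norm:
  "norm (\<Phi> f x - \<Phi> g x - (\<Phi> f y - \<Phi> g y)) \<le> norm (F (jet f x) - F (jet g x) - (F (jet f y) - F (jet g y)))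
    + norm (contract (A x - A 0) (\<lambda>i j. D2F f x (axis i 1) (axis j 1) - D2F g x (axis i 1) (axis j 1))
        - contract (A y - A 0) (\<lambda>i j. D2F f y (axis i 1) (axis j 1) - D2F g y (axis i 1) (axis j 1)))
    + norm (Q f x - Q g x - (Q f y - Q g y))"
proof -
  have t: "norm (a - b + c) \<le> norm a + norm b + norm c" for a b c :: "real^'N"
    using norm_triangle_ineq[of "a - b" c] norm_triangle_ineq4[of a b] by linarith
  show ?thesis
    unfolding contract_diff
    by (rule order_trans[OF _ t]) (simp add: \<Phi>_def algebra_simps)
qed

lemma \<Phi>_at_0:
  assumes "hoelder_bound \<alpha> R k f"
  shows "\<Phi> f 0 = F (0, 0, 0, hessian_of (D2F f 0))"
proof -
  have "gradient_of (D1F f 0) = 0" using uF_0[OF assms] by (simp add: gradient_of_def vec_eq_iff)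
  then show ?thesis using uF_0[OF assms] Q0[OF assms] by (simp add: \<Phi>_def jet_def contract_def)
qed

lemma jet_at_0:
  assumes "hoelder_bound \<alpha> R k f"
  shows "jet f 0 = (0, 0, 0, hessian_of (D2F f 0))"
  using uF_0[OF assms] by (simp add: jet_def gradient_of_def vec_eq_iff)

text \<open>In a difference of two jets at one point the position cancels and the other entries are
  those of \<open>u \<delta>\<close>. A factor \<open>R powr \<alpha> * k\<close> then appears
  everywhere: in the lower orders from the size of the Hessian of \<open>u \<delta>\<close>, in the
  Hessian from \<open>DF_split\<close>, and in the change of base point from the size of the jet
  difference.\<close>

lemma contraction:
  assumes f: "hoelder_bound \<alpha> R 1 f" and g: "hoelder_bound \<alpha> R 1 g" and d: "hoelder_bound \<alpha> R k (\<lambda>x. f x - g x)"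
  shows "hoelder_bound \<alpha> R (K1 * R powr \<alpha> * k) (\<lambda>x. \<Phi> f x - \<Phi> g x)"
proof -
  define \<delta> where "\<delta> = (\<lambda>x. f x - g x)"
  have d: "hoelder_bound \<alpha> R k \<delta>" using d by (simp add: \<delta>_def)
  have k: "0 \<le> k" by (rule k_nonneg[OF d])
  have ud: "uF f x - uF g x = u \<delta> x" and D1d: "D1F f x v - D1F g x v = D1 \<delta> x v"
    and D2d: "D2F f x v w - D2F g x v w = D2 \<delta> x v w" and Qd: "Q f x - Q g x = Q \<delta> x" for x v w
    using u_diff[OF f g] D1_diff[OF f g] D2_diff[OF f g] Q_diff[OF f g]
    by (simp_all add: uF_def D1F_def D2F_def \<delta>_def)
  have jd: "jet f x - jet g x = (0, u \<delta> x, gradient_of (D1 \<delta> x), hessian_of (D2 \<delta> x))" for x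
  proof -
    have "(\<lambda>v. D1F f x v - D1F g x v) = D1 \<delta> x" "(\<lambda>v w. D2F f x v w - D2F g x v w) = D2 \<delta> x"
      by (simp_all add: D1d D2d)
    then show ?thesis by (simp add: jet_def ud flip: gradient_of_diff hessian_of_diff)
  qed
  define b where "b = C1 * k * R powr \<alpha>"
  have b: "0 \<le> b" using pos k by (simp add: b_def)
  have R1: "R \<le> 1" using R by simp
  have D2b: "norm (D2 \<delta> x v w) \<le> b * norm v * norm w" if "x \<in> cball 0 R" for x v w
    using D2_bound(1)[OF d that] by (simp add: b_def)
  have "\<forall>x\<in>cball 0 R. \<forall>v w. norm (D2 \<delta> x v w) \<le> b * norm v * norm w"
    using D2b by blast
  note low = lower[OF du[OF d] dD1[OF d] u0[OF d] D10[OF d] R(1) R1 b this]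
  show ?thesis
    unfolding hoelder_bound_def
  proof (intro conjI ballI)
    have s: "norm (hessian_of (D2 \<delta> 0)) \<le> G * (1 / tr * k * R powr \<alpha>)"
      unfolding G by (rule norm_hessian_of[OF D2_bound(2)[OF d zero_in_ball]])
    have "norm (F (jet f 0) - F (jet g 0)) \<le> L * (norm (0 :: real^'n) + norm (0 :: real^'N) + norm (0 :: real^'n^'N))
       + L * (C4 * R powr \<alpha>) * norm (hessian_of (D2 \<delta> 0))"
      by (rule F_increment[OF jet_in_ball[OF f zero_in_ball] jet_in_ball[OF g zero_in_ball]])
         (simp add: jet_at_0[OF f] jet_at_0[OF g] D2d flip: hessian_of_diff)
    also have "\<dots> \<le> L * (C4 * R powr \<alpha>) * (G * (1 / tr * k * R powr \<alpha>))"
    proof -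
      have "L * (C4 * R powr \<alpha>) * norm (hessian_of (D2 \<delta> 0)) \<le> L * (C4 * R powr \<alpha>) * (G * (1 / tr * k * R powr \<alpha>))"
        by (rule mult_left_mono[OF s]) (use nn pos in simp)
      then show ?thesis by simp
    qed
    also have "\<dots> = (L * C4 * G * (1 / tr)) * (R powr \<alpha> * k * R powr \<alpha>)" by (simp add: mult_ac)
    also have "\<dots> \<le> K1 * (R powr \<alpha> * k * R powr \<alpha>)"
      using k nn pos by (intro mult_right_mono) (auto simp: K1_def)
    finally show "norm (\<Phi> f 0 - \<Phi> g 0) \<le> K1 * R powr \<alpha> * k * R powr \<alpha>"
      by (simp add: \<Phi>_at_0[OF f] \<Phi>_at_0[OF g] jet_at_0[OF f] jet_at_0[OF g] mult.assoc)
  next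
    fix x y :: "real^'n" assume x: "x \<in> cball 0 R" and y: "y \<in> cball 0 R"
    define t where "t = norm (x - y) powr \<alpha>"
    define \<tau> where "\<tau> = R powr \<alpha> * k * t"
    have t: "0 \<le> t" "norm (x - y) \<le> t" using dist_le(1)[OF x y] by (simp_all add: t_def)
    have \<tau>: "0 \<le> \<tau>" using k t by (simp add: \<tau>_def)
    have bt: "b * norm (x - y) \<le> C1 * \<tau>"
      using mult_left_mono[OF t(2) b] by (simp add: b_def \<tau>_def mult_ac)
    have p: "norm (u \<delta> x - u \<delta> y) \<le> C1 * \<tau>" using low(2)[OF x y] bt by linarith
    have "norm (gradient_of (\<lambda>v. D1 \<delta> x v - D1 \<delta> y v)) \<le> G * (b * norm (x - y))"
      unfolding G using low(1)[OF x y] b by (intro norm_gradient_of) (auto simp: mult_ac)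
    also have "\<dots> \<le> G * (C1 * \<tau>)" using bt pos by (intro mult_left_mono) auto
    finally have q: "norm (gradient_of (D1 \<delta> x) - gradient_of (D1 \<delta> y)) \<le> G * (C1 * \<tau>)"
      by (simp add: gradient_of_diff)
    have "norm (hessian_of (\<lambda>v w. D2 \<delta> x v w - D2 \<delta> y v w)) \<le> G * (C * k * t)"
      unfolding G t_def by (rule norm_hessian_of[OF D2_h[OF d x y]])
    then have r: "norm (hessian_of (D2 \<delta> x) - hessian_of (D2 \<delta> y)) \<le> G * (C * k * t)"
      by (simp add: hessian_of_diff)
    have jy: "norm (jet f y - jet g y) \<le> (1 + 2 * G) * b"
    proof -
      have "norm (jet f y - jet g y) \<le> norm (0 :: real^'n) + norm (u \<delta> y) + norm (gradient_of (D1 \<delta> y)) + norm (hessian_of (D2 \<delta> y))"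
        unfolding jd by (rule norm_Pair4_le)
      moreover have "norm (gradient_of (D1 \<delta> y)) \<le> G * b"
        unfolding G by (rule norm_gradient_of[OF low(3)[OF y y] b])
      moreover have "norm (hessian_of (D2 \<delta> y)) \<le> G * b"
        unfolding G by (rule norm_hessian_of[OF D2b[OF y]])
      ultimately show ?thesis using low(4)[OF y y] by (simp add: algebra_simps)
    qed
    have "norm (F (jet f x) - F (jet g x) - (F (jet f y) - F (jet g y)))
      \<le> (L * (C1 * \<tau> + G * (C1 * \<tau>)) + L * (C4 * R powr \<alpha>) * (G * (C * k * t)))
        + L * (norm (jet f x - jet f y) + norm (jet g x - jet g y)) * norm (jet f y - jet g y)"
    proof (rule four_point_bound[OF dF convex_cball jet_in_ball[OF f x] jet_in_ball[OF g x]
          jet_in_ball[OF f y] jet_in_ball[OF g y] DF_l nn(1)])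
      fix X :: "(real^'n) \<times> (real^'N) \<times> (real^'n^'N) \<times> (real^'n^'n^'N)"
      assume X: "X \<in> cball 0 (C4 * R powr \<alpha>)"
      have "norm (DF X (jet f x - jet g x - (jet f y - jet g y)))
        \<le> L * (norm (0 :: real^'n) + norm (u \<delta> x - u \<delta> y) + norm (gradient_of (D1 \<delta> x) - gradient_of (D1 \<delta> y)))
         + L * (C4 * R powr \<alpha>) * norm (hessian_of (D2 \<delta> x) - hessian_of (D2 \<delta> y))"
      proof -
        have "jet f x - jet g x - (jet f y - jet g y) = (0, u \<delta> x - u \<delta> y,
          gradient_of (D1 \<delta> x) - gradient_of (D1 \<delta> y), hessian_of (D2 \<delta> x) - hessian_of (D2 \<delta> y))"
          unfolding jd by simp
        then show ?thesis by (simp only:) (rule DF_split[OF X])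
      qed
      also have "\<dots> \<le> L * (C1 * \<tau> + G * (C1 * \<tau>)) + L * (C4 * R powr \<alpha>) * (G * (C * k * t))"
        using p q r nn pos by (intro add_mono mult_left_mono) auto
      finally show "norm (DF X (jet f x - jet g x - (jet f y - jet g y)))
        \<le> L * (C1 * \<tau> + G * (C1 * \<tau>)) + L * (C4 * R powr \<alpha>) * (G * (C * k * t))" .
    qed (use unit_ball in auto)
    also have "\<dots> \<le> (L * (C1 * \<tau> + G * (C1 * \<tau>)) + L * (C4 * R powr \<alpha>) * (G * (C * k * t)))
        + L * (C3 * t + C3 * t) * ((1 + 2 * G) * b)"
      using jet_increment(4)[OF f x y] jet_increment(4)[OF g x y] jy nn pos t
      by (intro add_left_mono mult_mono mult_left_mono add_mono) (auto simp: t_def)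
    also have "\<dots> = L * ((1 + G) * C1 + C4 * G * C + 2 * C3 * ((1 + 2 * G) * C1)) * \<tau>"
      by (simp add: \<tau>_def b_def algebra_simps)
    finally have 1: "norm (F (jet f x) - F (jet g x) - (F (jet f y) - F (jet g y)))
      \<le> L * ((1 + G) * C1 + C4 * G * C + 2 * C3 * ((1 + 2 * G) * C1)) * \<tau>" .
    have "norm (contract (A x - A 0) (\<lambda>i j. D2 \<delta> x (axis i 1) (axis j 1))
        - contract (A y - A 0) (\<lambda>i j. D2 \<delta> y (axis i 1) (axis j 1)))
      \<le> real (CARD('n) * CARD('n)) * LA * (C * k + C1 * k) * R powr \<alpha> * norm (x - y) powr \<alpha>"
      using pos nn k
      by (intro contract_increment[OF x y] bound_axis[OF D2_h[OF d x y]] bound_axis[OF D2_bound(1)[OF d y]]) auto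
    also have "\<dots> = real (CARD('n) * CARD('n)) * LA * (C + C1) * \<tau>" by (simp add: \<tau>_def t_def algebra_simps)
    finally have 2: "norm (contract (A x - A 0) (\<lambda>i j. D2 \<delta> x (axis i 1) (axis j 1))
        - contract (A y - A 0) (\<lambda>i j. D2 \<delta> y (axis i 1) (axis j 1)))
      \<le> real (CARD('n) * CARD('n)) * LA * (C + C1) * \<tau>" .
    have 3: "norm (Q \<delta> x - Q \<delta> y) \<le> C * \<tau>"
      using Q_increment[OF d x y] by (simp add: \<tau>_def t_def mult_ac)
    have "norm (\<Phi> f x - \<Phi> g x - (\<Phi> f y - \<Phi> g y)) \<le>
      L * ((1 + G) * C1 + C4 * G * C + 2 * C3 * ((1 + 2 * G) * C1)) * \<tau>
      + real (CARD('n) * CARD('n)) * LA * (C + C1) * \<tau> + C * \<tau>"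
      using \<Phi>_diff_norm[of f x g y] 1 2 3 unfolding D2d Qd by linarith
    \<comment> \<open>The increments use all of \<open>K1\<close> except its last summand, which was
      spent on the value at the centre.\<close>
    also have "\<dots> = (K1 - L * C4 * G * (1 / tr)) * \<tau>" by (simp add: K1_def algebra_simps)
    also have "\<dots> \<le> K1 * \<tau>" using \<tau> nn pos by (intro mult_right_mono) auto
    finally show "norm (\<Phi> f x - \<Phi> g x - (\<Phi> f y - \<Phi> g y)) \<le> K1 * R powr \<alpha> * k * norm (x - y) powr \<alpha>"
      by (simp add: \<tau>_def t_def mult.assoc)
  qed
qed

text \<open>A single jet keeps its position entry, whose increment has no factor
  \<open>R powr \<alpha>\<close>; the second form of \<open>dist_le\<close> pays for it with
  \<open>R powr (1 - \<alpha>)\<close>. At f = 0 this starts the iteration.\<close>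

lemma initial_bound:
  assumes f: "hoelder_bound \<alpha> R 1 f"
  shows "hoelder_bound \<alpha> R (K2 * (R powr \<alpha> + R powr (1 - \<alpha>))) (\<Phi> f)"
  unfolding hoelder_bound_def
proof (intro conjI ballI)
  define \<rho> where "\<rho> = R powr \<alpha> + R powr (1 - \<alpha>)"
  have \<rho>: "R powr \<alpha> \<le> \<rho>" "R powr (1 - \<alpha>) \<le> \<rho>" "0 \<le> \<rho>" by (simp_all add: \<rho>_def)
  {
    have s: "norm (hessian_of (D2F f 0)) \<le> G * (C2 * R powr \<alpha>)"
      unfolding G by (rule norm_hessian_of[OF D2F_bound[OF f zero_in_ball]])
    have 0: "0 \<in> cball (0 :: (real^'n) \<times> (real^'N) \<times> (real^'n^'N) \<times> (real^'n^'n^'N)) (C4 * R powr \<alpha>)"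
      using pos by simp
    have "norm (F (jet f 0) - F 0) \<le> L * (norm (0 :: real^'n) + norm (0 :: real^'N) + norm (0 :: real^'n^'N))
       + L * (C4 * R powr \<alpha>) * norm (hessian_of (D2F f 0))"
      by (rule F_increment[OF jet_in_ball[OF f zero_in_ball] 0]) (simp add: jet_at_0[OF f])
    also have "\<dots> \<le> L * (C4 * R powr \<alpha>) * (G * (C2 * R powr \<alpha>))"
      using s nn pos by (auto intro!: mult_left_mono)
    also have "\<dots> = (L * C4 * G * C2) * (R powr \<alpha> * R powr \<alpha>)" by (simp add: mult_ac)
    also have "\<dots> \<le> K2 * (\<rho> * R powr \<alpha>)"
      using nn pos \<rho> by (intro mult_mono) (auto simp: K2_def)
    finally show "norm (\<Phi> f 0) \<le> K2 * (R powr \<alpha> + R powr (1 - \<alpha>)) * R powr \<alpha>"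
      by (simp add: \<Phi>_at_0[OF f] jet_at_0[OF f] F0 \<rho>_def mult.assoc)
  }
  fix x y :: "real^'n" assume x: "x \<in> cball 0 R" and y: "y \<in> cball 0 R"
  define t where "t = norm (x - y) powr \<alpha>"
  have t: "0 \<le> t" "norm (x - y) \<le> 2 * R powr (1 - \<alpha>) * t" using dist_le(2)[OF x y] by (simp_all add: t_def)
  note j = jet_increment[OF f x y]
  have "norm (F (jet f x) - F (jet f y)) \<le> L * (norm (x - y) + norm (uF f x - uF f y)
      + norm (gradient_of (D1F f x) - gradient_of (D1F f y)))
      + L * (C4 * R powr \<alpha>) * norm (hessian_of (D2F f x) - hessian_of (D2F f y))"
    by (rule F_increment[OF jet_in_ball[OF f x] jet_in_ball[OF f y]]) (simp add: jet_def)
  also have "\<dots> \<le> L * ((1 + C2 + G * C2) * norm (x - y)) + L * (C4 * R powr \<alpha>) * (G * C * t)"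
    using j(1-3) nn pos by (intro add_mono mult_left_mono) (auto simp: distrib_right t_def)
  also have "\<dots> \<le> L * ((1 + C2 + G * C2) * (2 * R powr (1 - \<alpha>) * t)) + L * (C4 * R powr \<alpha>) * (G * C * t)"
    using t nn pos by (intro add_right_mono mult_left_mono) auto
  also have "\<dots> = (2 * L * (1 + C2 + G * C2)) * (R powr (1 - \<alpha>) * t) + (L * C4 * G * C) * (R powr \<alpha> * t)"
    by (simp add: algebra_simps)
  also have "\<dots> \<le> (2 * L * (1 + C2 + G * C2)) * (\<rho> * t) + (L * C4 * G * C) * (\<rho> * t)"
    using t nn pos \<rho> by (intro add_mono mult_left_mono mult_right_mono) auto
  finally have 1: "norm (F (jet f x) - F (jet f y)) \<le> (2 * L * (1 + C2 + G * C2)) * (\<rho> * t) + (L * C4 * G * C) * (\<rho> * t)" .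
  have "norm (contract (A x - A 0) (\<lambda>i j. D2F f x (axis i 1) (axis j 1))
        - contract (A y - A 0) (\<lambda>i j. D2F f y (axis i 1) (axis j 1)))
      \<le> real (CARD('n) * CARD('n)) * LA * (C + C2) * R powr \<alpha> * norm (x - y) powr \<alpha>"
  proof (rule contract_increment[OF x y])
    show "norm (D2F f x (axis i 1) (axis j 1) - D2F f y (axis i 1) (axis j 1)) \<le> C * norm (x - y) powr \<alpha>" for i j
      using D2_h[OF f x y, of "axis i 1" "axis j 1"] by (simp add: D2F_def)
  qed (use pos nn bound_axis[OF D2F_bound[OF f y]] in auto)
  also have "\<dots> = (real (CARD('n) * CARD('n)) * LA * (C + C2)) * (R powr \<alpha> * t)" by (simp add: t_def mult.assoc)
  also have "\<dots> \<le> (real (CARD('n) * CARD('n)) * LA * (C + C2)) * (\<rho> * t)"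
    using t nn pos \<rho> by (intro mult_left_mono mult_right_mono) auto
  finally have 2: "norm (contract (A x - A 0) (\<lambda>i j. D2F f x (axis i 1) (axis j 1))
        - contract (A y - A 0) (\<lambda>i j. D2F f y (axis i 1) (axis j 1)))
      \<le> (real (CARD('n) * CARD('n)) * LA * (C + C2)) * (\<rho> * t)" .
  have "norm (Q f x - Q f y) \<le> C * (R powr \<alpha> * t)" using Q_increment[OF f x y] by (simp add: t_def mult.assoc)
  also have "\<dots> \<le> C * (\<rho> * t)" using t nn \<rho> by (intro mult_left_mono mult_right_mono) auto
  finally have 3: "norm (Q f x - Q f y) \<le> C * (\<rho> * t)" .
  have tri: "norm (a - b + c) \<le> norm a + norm b + norm c" for a b c :: "real^'N"
    using norm_triangle_ineq[of "a - b" c] norm_triangle_ineq4[of a b] by linarith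
  have "\<Phi> f x - \<Phi> f y = (F (jet f x) - F (jet f y))
     - (contract (A x - A 0) (\<lambda>i j. D2F f x (axis i 1) (axis j 1))
        - contract (A y - A 0) (\<lambda>i j. D2F f y (axis i 1) (axis j 1))) + (Q f x - Q f y)"
    by (simp add: \<Phi>_def)
  then have "norm (\<Phi> f x - \<Phi> f y) \<le> (2 * L * (1 + C2 + G * C2)) * (\<rho> * t) + (L * C4 * G * C) * (\<rho> * t)
     + (real (CARD('n) * CARD('n)) * LA * (C + C2)) * (\<rho> * t) + C * (\<rho> * t)"
    using 1 2 3 tri by (simp only:) (smt (verit))
  also have "\<dots> = (K2 - L * C4 * G * C2) * (\<rho> * t)" by (simp add: K2_def algebra_simps)
  also have "\<dots> \<le> K2 * (\<rho> * t)" using mult_nonneg_nonneg[OF \<rho>(3) t(1)] nn pos by (intro mult_right_mono) auto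
  finally show "norm (\<Phi> f x - \<Phi> f y) \<le> K2 * (R powr \<alpha> + R powr (1 - \<alpha>)) * norm (x - y) powr \<alpha>"
    by (simp add: \<rho>_def t_def mult.assoc)
qed

lemma solution_exists:
  assumes "K1 * R powr \<alpha> \<le> 1 / 2" "K2 * (R powr \<alpha> + R powr (1 - \<alpha>)) \<le> 1 / 2"
  obtains U U1 U2 c B where "\<And>x. (U has_derivative U1 x) (at x)" "\<And>x v. ((\<lambda>x. U1 x v) has_derivative U2 x v) (at x)"
    "\<And>x v w. U2 x v w = U2 x w v" "U 0 = 0" "\<And>v. U1 0 v = 0"
    "\<And>v w. U2 0 v w = ((v \<bullet> w) / tr) *\<^sub>R c + (\<epsilon> * h v w) *\<^sub>R e"
    "\<And>x y v w. x \<in> cball 0 R \<Longrightarrow> y \<in> cball 0 R \<Longrightarrow>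
       norm (U2 x v w - U2 y v w) \<le> B * norm (x - y) powr \<alpha> * norm v * norm w"
    "\<And>x. x \<in> cball 0 R \<Longrightarrow> contract (A x) (\<lambda>i j. U2 x (axis i 1) (axis j 1))
       = F (x, U x, gradient_of (U1 x), hessian_of (U2 x))"
proof -
  have z: "hoelder_bound \<alpha> R 1 (\<lambda>_. 0 :: real^'N)" by (simp add: hoelder_bound_def)
  have start: "hoelder_bound \<alpha> R (1 / 2) (\<Phi> (\<lambda>_. 0))"
    using initial_bound[OF z] assms(2) by (rule hoelder_bound_mono)
  have contr: "hoelder_bound \<alpha> R (k / 2) (\<lambda>x. \<Phi> f x - \<Phi> g x)"
    if "hoelder_bound \<alpha> R 1 f" "hoelder_bound \<alpha> R 1 g" "hoelder_bound \<alpha> R k (\<lambda>x. f x - g x)" for f g k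
  proof (rule hoelder_bound_mono[OF contraction[OF that]])
    show "K1 * R powr \<alpha> * k \<le> k / 2"
      using mult_right_mono[OF assms(1) k_nonneg[OF that(3)]] by simp
  qed
  have "\<exists>f. hoelder_bound \<alpha> R 1 f \<and> (\<forall>x\<in>cball 0 R. \<Phi> f x = f x)"
    by (rule hoelder_fixed_point[of R \<alpha> \<Phi>, OF R(1) less_imp_le[OF \<alpha>(1)] start contr]) auto
  then obtain f where f: "hoelder_bound \<alpha> R 1 f" and fix_f: "\<And>x. x \<in> cball 0 R \<Longrightarrow> \<Phi> f x = f x"
    by blast
  show ?thesis
  proof (rule that[of "uF f" "D1F f" "D2F f" "f 0" C])
    show "D2F f x v w = D2F f x w v" for x v w
      using D2_sym[OF f, of x v w] h_sym[of v w] by (simp add: D2F_def)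
    show "D2F f 0 v w = ((v \<bullet> w) / tr) *\<^sub>R f 0 + (\<epsilon> * h v w) *\<^sub>R e" for v w
      by (simp add: D2F_def D20[OF f])
    show "norm (D2F f x v w - D2F f y v w) \<le> C * norm (x - y) powr \<alpha> * norm v * norm w"
      if "x \<in> cball 0 R" "y \<in> cball 0 R" for x y v w
      using D2_h[OF f that, of v w] by (simp add: D2F_def)
    fix x :: "real^'n" assume x: "x \<in> cball 0 R"
    have "contract (A 0) (\<lambda>i j. D2F f x (axis i 1) (axis j 1))
        = f x - Q f x + (\<epsilon> * contract (A 0) (\<lambda>i j. h (axis i 1) (axis j 1))) *\<^sub>R e"
      unfolding D2F_def contract_add sol[OF f x] by (simp add: contract_def scaleR_sum_left sum_distrib_left mult_ac)
    then have 1: "contract (A 0) (\<lambda>i j. D2F f x (axis i 1) (axis j 1)) = f x - Q f x" by (simp add: h_tr)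
    have "F (jet f x) - (contract (A x) (\<lambda>i j. D2F f x (axis i 1) (axis j 1)) - (f x - Q f x)) + Q f x = f x"
      using fix_f[OF x] unfolding \<Phi>_def contract_matrix_diff 1 .
    then have "F (jet f x) - contract (A x) (\<lambda>i j. D2F f x (axis i 1) (axis j 1)) = 0"
      by (simp add: algebra_simps)
    then show "contract (A x) (\<lambda>i j. D2F f x (axis i 1) (axis j 1))
       = F (x, uF f x, gradient_of (D1F f x), hessian_of (D2F f x))"
      by (simp add: jet_def)
  qed (rule duF[OF f] dD1F[OF f] uF_0[OF f])+
qed

end

section \<open>Derivatives within balls and on the jet space\<close>

text \<open>Segments into \<open>S\<close> determine the derivative on all differences
  \<open>z - x\<close>, even at a boundary point \<open>x\<close>. Linearity extends this to
  differences of interior points, which take every direction.\<close>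

lemma has_derivative_unique_within_convex:
  fixes f :: "'a::euclidean_space \<Rightarrow> 'b::real_normed_vector"
  assumes S: "convex S" "interior S \<noteq> {}" "x \<in> S"
    and f: "(f has_derivative f1) (at x within S)" "(f has_derivative f2) (at x within S)"
  shows "f1 = f2"
proof -
  define T where "T h = f1 h - f2 h" for h
  have "((\<lambda>y. f y - f y) has_derivative T) (at x within S)"
    unfolding T_def[abs_def] by (rule has_derivative_diff[OF f])
  then have T: "((\<lambda>y. 0 :: 'b) has_derivative T) (at x within S)" by simp
  have lin: "linear T" using T by (rule has_derivative_linear)
  have zero: "T (z - x) = 0" if z: "z \<in> S" for z
  proof (rule ccontr)
    assume nz: "T (z - x) \<noteq> 0"
    then have zx: "z \<noteq> x" using linear_0[OF lin] by auto
    \<comment> \<open>Half the growth rate of \<open>T\<close> along \<open>z - x\<close>: a short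
      step would make a nonzero norm at most half of itself.\<close>
    define e where "e = norm (T (z - x)) / (2 * norm (z - x))"
    have "e > 0" using nz zx by (simp add: e_def)
    then obtain d where d: "d > 0" "\<And>y. y \<in> S \<Longrightarrow> norm (y - x) < d \<Longrightarrow> norm (T (y - x)) \<le> e * norm (y - x)"
      using T unfolding has_derivative_within_alt by (auto simp: norm_minus_commute)
    define t where "t = min 1 (d / (2 * norm (z - x)))"
    have t: "0 < t" "t \<le> 1" using d zx by (auto simp: t_def)
    have "t * norm (z - x) \<le> d / (2 * norm (z - x)) * norm (z - x)"
      by (intro mult_right_mono) (auto simp: t_def)
    then have tn: "t * norm (z - x) < d" using zx d by simp
    define y where "y = x + t *\<^sub>R (z - x)"
    have "y = (1 - t) *\<^sub>R x + t *\<^sub>R z" by (simp add: y_def algebra_simps)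
    then have "y \<in> S" using S(1,3) z t by (auto intro!: convexD)
    then have "norm (T (t *\<^sub>R (z - x))) \<le> e * norm (t *\<^sub>R (z - x))"
      using d(2)[of y] tn t by (simp add: y_def)
    then have "t * norm (T (z - x)) \<le> t * (norm (T (z - x)) / 2)"
      using t zx by (simp add: linear_scale[OF lin] e_def)
    then show False using t nz by simp
  qed
  obtain y r where r: "r > 0" "ball y r \<subseteq> S" using S(2) by (meson equals0I mem_interior)
  have "T h = 0" for h
  proof (cases "h = 0")
    case True then show ?thesis using linear_0[OF lin] by simp
  next
    case False
    define s where "s = r / (2 * norm h)"
    have s: "s > 0" "norm (s *\<^sub>R h) < r" using r False by (auto simp: s_def)
    have "y \<in> S" "y + s *\<^sub>R h \<in> S" using r s by (auto simp: dist_norm subset_iff)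
    then have "T (y + s *\<^sub>R h - x) - T (y - x) = 0" by (simp only: zero) simp
    then have "T ((y + s *\<^sub>R h - x) - (y - x)) = 0" by (simp only: linear_diff[OF lin])
    then show ?thesis using s by (simp add: linear_scale[OF lin])
  qed
  then show ?thesis by (simp add: T_def fun_eq_iff)
qed

lemma dirderiv_cball:
  fixes u :: "'a::euclidean_space \<Rightarrow> 'b::real_normed_vector"
  assumes "0 < R" "x \<in> cball 0 R" "\<And>y. y \<in> cball 0 R \<Longrightarrow> u y = U y" "(U has_derivative D) (at x)"
  shows "(u has_derivative D) (at x within cball 0 R)" "dirderiv (cball 0 R) v u x = D v"
proof -
  have "(U has_derivative D) (at x within cball 0 R)" using assms(4) by (rule has_derivative_at_withinI)
  then show d: "(u has_derivative D) (at x within cball 0 R)"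
    by (rule has_derivative_transform[rotated 2]) (use assms in auto)
  then have "(u has_derivative frechet_derivative u (at x within cball 0 R)) (at x within cball 0 R)"
    using differentiableI frechet_derivative_works by blast
  then have "frechet_derivative u (at x within cball 0 R) = D"
    using assms d by (intro has_derivative_unique_within_convex[of "cball 0 R" x u]) auto
  then show "dirderiv (cball 0 R) v u x = D v" by (simp add: dirderiv_def)
qed

lemma span_cball: "0 < R \<Longrightarrow> span (cball (0 :: 'a::euclidean_space) R) = UNIV"
proof -
  assume R: "0 < R"
  have "v \<in> span (cball 0 R)" for v :: 'a
  proof -
    have "(R / (norm v + 1)) *\<^sub>R v \<in> cball 0 R"
      using R by (simp add: divide_le_eq abs_of_pos add_nonneg_pos)
    then have "((norm v + 1) / R) *\<^sub>R (R / (norm v + 1)) *\<^sub>R v \<in> span (cball 0 R)"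
      by (intro span_scale span_base)
    moreover have "norm v + 1 \<noteq> 0" using norm_ge_zero[of v] by linarith
    ultimately show ?thesis using R by simp
  qed
  then show ?thesis by blast
qed

text \<open>Composing with a linear map into \<open>S\<close> turns derivatives along
  \<open>S\<close> into full derivatives on the ambient space, where the mean value estimates
  apply.\<close>

lemma C2_on_subspace:
  fixes a :: "'a::euclidean_space \<Rightarrow> 'b::real_normed_vector" and p :: "'a \<Rightarrow> 'a"
  assumes S: "subspace S" and p: "linear p" "\<And>X. p X \<in> S" and a: "Ck_on 2 S a"
  defines "D \<equiv> \<lambda>X Z. dirderiv S (p Z) a (p X)"
  shows "((\<lambda>X. a (p X)) has_derivative D X) (at X)"
    and "((\<lambda>X. D X v) has_derivative (\<lambda>w. dirderiv S (p w) (dirderiv S (p v) a) (p X))) (at X)"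
    and "continuous_on UNIV (\<lambda>X. dirderiv S (p w) (dirderiv S (p v) a) (p X))"
proof -
  have sp: "span S = S" using S by (rule span_eq_iff[THEN iffD2])
  have bl: "bounded_linear p" using p(1) by (simp add: linear_conv_bounded_linear)
  have a': "a differentiable_on S" "\<And>v. v \<in> S \<Longrightarrow> dirderiv S v a differentiable_on S"
    "\<And>v w. v \<in> S \<Longrightarrow> w \<in> S \<Longrightarrow> continuous_on S (dirderiv S w (dirderiv S v a))"
    using a by (auto simp: numeral_2_eq_2 sp)
  have chain: "((\<lambda>X. g (p X)) has_derivative (\<lambda>w. dirderiv S (p w) g (p X))) (at X)"
    if g: "g differentiable_on S" for g :: "'a \<Rightarrow> 'b" and X
  proof -
    have "(g has_derivative frechet_derivative g (at (p X) within S)) (at (p X) within S)"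
      using g p(2) unfolding differentiable_on_def by (simp add: frechet_derivative_works)
    then have "(g has_derivative frechet_derivative g (at (p X) within S)) (at (p X) within range p)"
      by (rule has_derivative_subset) (use p(2) in auto)
    from has_derivative_in_compose[OF bounded_linear_imp_has_derivative[OF bl] this]
    show ?thesis by (simp add: dirderiv_def)
  qed
  show "((\<lambda>X. a (p X)) has_derivative D X) (at X)" unfolding D_def by (rule chain[OF a'(1)])
  show "((\<lambda>X. D X v) has_derivative (\<lambda>w. dirderiv S (p w) (dirderiv S (p v) a) (p X))) (at X)"
    unfolding D_def by (rule chain[OF a'(2)[OF p(2)]])
  show "continuous_on UNIV (\<lambda>X. dirderiv S (p w) (dirderiv S (p v) a) (p X))"
    by (rule continuous_on_compose2[OF a'(3)[OF p(2) p(2)] linear_continuous_on[OF bl]]) (use p(2) in auto)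
qed

text \<open>The projection onto \<open>jet_space\<close>; composing with it extends the nonlinearity
  from the subspace to all jets.\<close>

definition symmetric_jet ::
  "(real^'n) \<times> (real^'N) \<times> (real^'n^'N) \<times> (real^'n^'n^'N) \<Rightarrow> (real^'n) \<times> (real^'N) \<times> (real^'n^'N) \<times> (real^'n^'n^'N)" where
  "symmetric_jet = (\<lambda>(x, p, q, r). (x, p, q, \<chi> k. (1/2) *\<^sub>R (r $ k + transpose (r $ k))))"

lemma linear_symmetric_jet: "linear symmetric_jet"
  by (rule linearI) (simp_all add: symmetric_jet_def split_beta prod_eq_iff vec_eq_iff transpose_def algebra_simps)

lemma symmetric_jet_in_jet_space: "symmetric_jet X \<in> jet_space"
  by (auto simp: symmetric_jet_def jet_space_def sym_tensors_def vec_eq_iff transpose_def split: prod.splits)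

lemma symmetric_jet_id: "X \<in> jet_space \<Longrightarrow> symmetric_jet X = X"
  by (auto simp: symmetric_jet_def jet_space_def sym_tensors_def vec_eq_iff transpose_def split: prod.splits)

lemma subspace_jet_space: "subspace jet_space"
  by (auto simp: subspace_def jet_space_def sym_tensors_def zero_prod_def vec_eq_iff transpose_def)

lemma C1_lipschitz_on_unit_ball:
  fixes f :: "'a::euclidean_space \<Rightarrow> real"
  assumes f: "Ck_holder_on 1 \<alpha> (cball 0 1) f" and \<alpha>: "0 \<le> \<alpha>"
  obtains L where "L \<ge> 0" "\<And>x y. x \<in> cball 0 1 \<Longrightarrow> y \<in> cball 0 1 \<Longrightarrow> \<bar>f x - f y\<bar> \<le> L * norm (x - y)"
proof -
  let ?S = "cball (0::'a) 1"
  have d: "(f has_derivative (\<lambda>v. dirderiv ?S v f x)) (at x within ?S)" if "x \<in> ?S" for x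
    using f that by (simp add: differentiable_on_def frechet_derivative_works dirderiv_def[abs_def])
  have "\<exists>B\<ge>0. \<forall>x\<in>?S. norm (dirderiv ?S v f x) \<le> B" for v
  proof -
    have "holder_on \<alpha> ?S (dirderiv ?S v f)" using f by (simp add: span_cball)
    then obtain c where c: "\<And>x y. x \<in> ?S \<Longrightarrow> y \<in> ?S \<Longrightarrow> dist (dirderiv ?S v f x) (dirderiv ?S v f y) \<le> c * dist x y powr \<alpha>"
      unfolding holder_on_def by blast
    \<comment> \<open>\<open>holder_on\<close> does not assert that its constant is nonnegative,
      hence the absolute value.\<close>
    have "norm (dirderiv ?S v f x) \<le> norm (dirderiv ?S v f 0) + \<bar>c\<bar>" if x: "x \<in> ?S" for x
    proof -
      have "norm (dirderiv ?S v f x - dirderiv ?S v f 0) \<le> c * norm x powr \<alpha>"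
        using c[OF x, of 0] by (simp add: dist_norm)
      also have "\<dots> \<le> \<bar>c\<bar> * 1"
        using x \<alpha> by (intro mult_mono powr_le1) auto
      finally show ?thesis using norm_triangle_sub[of "dirderiv ?S v f x" "dirderiv ?S v f 0"] by linarith
    qed
    then show ?thesis by (intro exI[of _ "norm (dirderiv ?S v f 0) + \<bar>c\<bar>"]) auto
  qed
  then obtain B where B: "\<And>v. B v \<ge> 0" "\<And>v x. x \<in> ?S \<Longrightarrow> norm (dirderiv ?S v f x) \<le> B v" by metis
  show ?thesis
  proof (rule that[of "\<Sum>b\<in>Basis. B b"])
    show "0 \<le> (\<Sum>b\<in>Basis. B b)" by (simp add: sum_nonneg B)
    fix x y assume xy: "x \<in> ?S" "y \<in> ?S"
    have "norm (f x - f y) \<le> (\<Sum>b\<in>Basis. B b) * norm (x - y)"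
    proof (rule mean_value_bound[OF convex_cball d _ xy])
      show "norm (dirderiv ?S h f x) \<le> (\<Sum>b\<in>Basis. B b) * norm h" if x: "x \<in> ?S" for x h
        by (rule linear_basis_bound[OF has_derivative_linear[OF d[OF x]] B(2)[OF x]])
    qed
    then show "\<bar>f x - f y\<bar> \<le> (\<Sum>b\<in>Basis. B b) * norm (x - y)" by simp
  qed
qed

text \<open>Radial symmetry makes \<open>U\<close> equal at \<open>t *\<^sub>R p\<close> and
  \<open>t *\<^sub>R q\<close> for all small t of either sign; both sides are differentiated twice
  in t at 0.\<close>

lemma radial_second_derivative:
  fixes U :: "'a::euclidean_space \<Rightarrow> 'b::real_normed_vector"
  assumes U: "\<And>x. (U has_derivative U1 x) (at x)" and U1: "\<And>x v. ((\<lambda>x. U1 x v) has_derivative U2 x v) (at x)"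
    and R: "0 < R" and rad: "\<And>x y. x \<in> cball 0 R \<Longrightarrow> y \<in> cball 0 R \<Longrightarrow> norm x = norm y \<Longrightarrow> U x = U y"
    and pq: "norm p = 1" "norm q = 1"
  shows "U2 0 p p = U2 0 q q"
proof -
  have line: "((\<lambda>t. t *\<^sub>R v) has_derivative (\<lambda>s. s *\<^sub>R v)) (at t)" for v :: 'a and t :: real
    by (auto intro!: derivative_eq_intros)
  have dU: "((\<lambda>t. U (t *\<^sub>R v)) has_derivative (\<lambda>s. U1 (t *\<^sub>R v) (s *\<^sub>R v))) (at t)" for v t
    by (rule has_derivative_compose[OF line U])
  have dU1: "((\<lambda>t. U1 (t *\<^sub>R v) w) has_derivative (\<lambda>s. U2 (t *\<^sub>R v) w (s *\<^sub>R v))) (at t)" for v w t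
    by (rule has_derivative_compose[OF line U1])
  have eq1: "U1 (t *\<^sub>R p) p = U1 (t *\<^sub>R q) q" if t: "t \<in> {-R<..<R}" for t
  proof -
    have "((\<lambda>t. U (t *\<^sub>R q)) has_derivative (\<lambda>s. U1 (t *\<^sub>R p) (s *\<^sub>R p))) (at t)"
      by (rule has_derivative_transform_within_open[OF dU open_greaterThanLessThan t])
         (rule rad; use pq in auto)
    then have "(\<lambda>s. U1 (t *\<^sub>R p) (s *\<^sub>R p)) = (\<lambda>s. U1 (t *\<^sub>R q) (s *\<^sub>R q))"
      by (rule has_derivative_unique[OF _ dU])
    from fun_cong[OF this, of 1] show ?thesis by simp
  qed
  have "((\<lambda>t. U1 (t *\<^sub>R q) q) has_derivative (\<lambda>s. U2 (0 *\<^sub>R p) p (s *\<^sub>R p))) (at 0)"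
    by (rule has_derivative_transform_within_open[OF dU1 open_greaterThanLessThan _ eq1]) (use R in auto)
  then have "(\<lambda>s. U2 (0 *\<^sub>R p) p (s *\<^sub>R p)) = (\<lambda>s. U2 (0 *\<^sub>R q) q (s *\<^sub>R q))"
    by (rule has_derivative_unique[OF _ dU1])
  from fun_cong[OF this, of 1] show ?thesis by simp
qed

text \<open>The assumption \<open>neq\<close> does double duty: it makes the Hessian at the origin
  nonzero and, by \<open>radial_second_derivative\<close>, excludes radial symmetry. Restriction
  provides the extensional representative.\<close>

lemma restricted_solution:
  fixes A :: "real^'n \<Rightarrow> real^'n^'n"
    and a :: "(real^'n) \<times> (real^'N) \<times> (real^'n^'N) \<times> (real^'n^'n^'N) \<Rightarrow> real^'N"
  assumes R: "0 < R"
    and U: "\<And>x. (U has_derivative U1 x) (at x)" and U1: "\<And>x v. ((\<lambda>x. U1 x v) has_derivative U2 x v) (at x)"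
    and sym: "\<And>x v w. U2 x v w = U2 x w v" and zero: "U 0 = 0" "\<And>v. U1 0 v = 0"
    and hoelder: "\<And>x y v w. x \<in> cball 0 R \<Longrightarrow> y \<in> cball 0 R \<Longrightarrow>
       norm (U2 x v w - U2 y v w) \<le> B * norm (x - y) powr \<alpha> * norm v * norm w"
    and eq: "\<And>x. x \<in> cball 0 R \<Longrightarrow> contract (A x) (\<lambda>i j. U2 x (axis i 1) (axis j 1))
       = a (symmetric_jet (x, U x, gradient_of (U1 x), hessian_of (U2 x)))"
    and neq: "U2 0 (axis i 1) (axis i 1) \<noteq> U2 0 (axis j 1) (axis j 1)"
  defines "u \<equiv> restrict U (cball 0 R)"
  shows "is_solution A a \<alpha> R u" "vanishing_order_two (cball 0 R) u" "\<not> radially_symmetric_on (cball 0 R) u"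
    "hessian (cball 0 R) u 0 = hessian_of (U2 0)"
proof -
  let ?S = "cball (0 :: real^'n) R"
  have uU: "u y = U y" if "y \<in> ?S" for y using that by (simp add: u_def)
  have d1: "(u has_derivative U1 x) (at x within ?S)" "dirderiv ?S v u x = U1 x v" if "x \<in> ?S" for x v
    by (rule dirderiv_cball[OF R that _ U], erule uU)+
  have d2: "(dirderiv ?S v u has_derivative U2 x v) (at x within ?S)"
    "dirderiv ?S w (dirderiv ?S v u) x = U2 x v w" if "x \<in> ?S" for x v w
    by (rule dirderiv_cball[OF R that _ U1], erule d1(2))+
  have grad: "gradient ?S u x = gradient_of (U1 x)" if "x \<in> ?S" for x
    using that by (simp add: gradient_def gradient_of_def d1(2))
  have hess: "hessian ?S u x = hessian_of (U2 x)" if "x \<in> ?S" for x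
  proof -
    \<comment> \<open>\<open>hessian\<close> differentiates in direction j first, whereas
      \<open>hessian_of\<close> feeds direction i first; the symmetry of \<open>U2\<close>
      reconciles them.\<close>
    have "hessian ?S u x $ k $ i $ j = hessian_of (U2 x) $ k $ i $ j" for k i j
      using sym[of x "axis j 1" "axis i 1"] that by (simp add: hessian_def hessian_of_def d2(2))
    then show ?thesis by (simp add: vec_eq_iff)
  qed
  have 0: "0 \<in> ?S" using R by simp
  show "hessian ?S u 0 = hessian_of (U2 0)" by (rule hess[OF 0])
  have sym_jet: "symmetric_jet (x, U x, gradient_of (U1 x), hessian_of (U2 x)) = (x, U x, gradient_of (U1 x), hessian_of (U2 x))" for x
  proof (rule symmetric_jet_id)
    have "transpose (hessian_of (U2 x) $ k) $ i $ j = hessian_of (U2 x) $ k $ i $ j" for k i j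
      using sym[of x "axis j 1" "axis i 1"] by (simp add: hessian_of_def transpose_def)
    then have "transpose (hessian_of (U2 x) $ k) = hessian_of (U2 x) $ k" for k
      by (simp add: vec_eq_iff)
    then show "(x, U x, gradient_of (U1 x), hessian_of (U2 x)) \<in> jet_space"
      by (simp add: jet_space_def sym_tensors_def)
  qed
  show "is_solution A a \<alpha> R u"
    unfolding is_solution_def
  proof (intro conjI ballI)
    show "u \<in> extensional ?S" by (simp add: u_def)
    show "Ck_holder_on 2 \<alpha> ?S u"
    proof -
      have "u differentiable_on ?S" using d1(1) differentiableI unfolding differentiable_on_def by blast
      moreover have "dirderiv ?S v u differentiable_on ?S" for v
        using d2(1) differentiableI unfolding differentiable_on_def by blast
      moreover have "holder_on \<alpha> ?S (dirderiv ?S w (dirderiv ?S v u))" for v w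
        unfolding holder_on_def
      proof (intro exI ballI)
        fix x y assume "x \<in> ?S" "y \<in> ?S"
        then show "dist (dirderiv ?S w (dirderiv ?S v u) x) (dirderiv ?S w (dirderiv ?S v u) y)
            \<le> (B * norm v * norm w) * dist x y powr \<alpha>"
          using hoelder[of x y v w] by (simp add: d2(2) dist_norm mult_ac)
      qed
      ultimately show ?thesis by (simp add: numeral_2_eq_2)
    qed
    fix x assume x: "x \<in> ?S"
    have "second_order_op A ?S u x = contract (A x) (\<lambda>i j. U2 x (axis i 1) (axis j 1))"
      unfolding second_order_op_def hess[OF x]
      by (simp add: contract_def hessian_of_def vec_eq_iff)
    then show "second_order_op A ?S u x = a (x, u x, gradient ?S u x, hessian ?S u x)"
      using eq[OF x] by (simp add: sym_jet uU[OF x] grad[OF x] hess[OF x])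
  qed
  show "vanishing_order_two ?S u"
  proof -
    have "hessian_of (U2 0) \<noteq> 0"
    proof
      assume "hessian_of (U2 0) = 0"
      then have "U2 0 (axis l 1) (axis l 1) = 0" for l :: 'n
        by (simp add: hessian_of_def vec_eq_iff)
      then show False using neq by simp
    qed
    then show ?thesis
      using zero by (simp add: vanishing_order_two_def uU[OF 0] grad[OF 0] hess[OF 0] gradient_of_def vec_eq_iff)
  qed
  show "\<not> radially_symmetric_on ?S u"
  proof
    assume "radially_symmetric_on ?S u"
    then have rad: "U x = U y" if "x \<in> ?S" "y \<in> ?S" "norm x = norm y" for x y
      using that uU unfolding radially_symmetric_on_def by metis
    have "U2 0 (axis i 1) (axis i 1) = U2 0 (axis j 1) (axis j 1)"
      by (rule radial_second_derivative[OF U U1 R rad]) auto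
    then show False using neq by simp
  qed
qed

section \<open>Infinitely many nonradial solutions\<close>

lemma eventually_powr_small:
  fixes a K c :: real
  assumes "0 < a" "0 < c"
  shows "\<forall>\<^sub>F R in at_right 0. K * R powr a \<le> c"
proof -
  have id: "((\<lambda>R::real. R) \<longlongrightarrow> 0) (at_right 0)" by (rule tendsto_ident_at)
  have "((\<lambda>R. R powr a) \<longlongrightarrow> 0) (at_right (0::real))"
    by (rule tendsto_zero_powrI[OF id tendsto_const _ assms(1)])
       (simp add: eventually_at_right_less eventually_mono[OF eventually_at_right_less])
  then have "((\<lambda>R. K * R powr a) \<longlongrightarrow> 0) (at_right (0::real))" by (rule tendsto_mult_right_zero)
  then have "\<forall>\<^sub>F R in at_right 0. K * R powr a < c" using assms(2) by (rule order_tendstoD)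
  then show ?thesis by eventually_elim simp
qed

lemma contract_axis: "contract M (\<lambda>k l. (axis k 1 :: real^'n) $ i * (axis l 1 :: real^'n) $ i) = M $ i $ i"
proof -
  have "contract M (\<lambda>k l. (axis k 1 :: real^'n) $ i * (axis l 1 :: real^'n) $ i)
      = (\<Sum>k\<in>UNIV. if k = i then (\<Sum>l\<in>UNIV. if l = i then M $ k $ l else 0) else 0)"
    unfolding contract_def by (intro sum.cong refl) (simp add: axis_def if_distrib cong: if_cong)
  then show ?thesis by simp
qed

theorem theoremB:
  fixes A :: "real^'n \<Rightarrow> real^'n^'n"
    and a :: "(real^'n) \<times> (real^'N) \<times> (real^'n^'N) \<times> (real^'n^'n^'N) \<Rightarrow> real^'N"
    and \<alpha> lam :: real
  assumes "CARD('n) \<ge> 2"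
    and "0 < \<alpha>" and "\<alpha> < 1"
    and "\<And>\<rho> i j. \<rho> > 0 \<Longrightarrow> Ck_holder_on 1 \<alpha> (cball 0 \<rho>) (\<lambda>x. A x $ i $ j)"
    and "lam > 0"
    and "\<And>x \<xi>. (\<Sum>i\<in>UNIV. \<Sum>j\<in>UNIV. A x $ i $ j * \<xi> $ i * \<xi> $ j) \<ge> lam * (norm \<xi>)\<^sup>2"
    and "Ck_on 2 jet_space a"
    and "a (0, 0, 0, 0) = 0"
    and "\<And>s. s \<in> sym_tensors \<Longrightarrow> dirderiv jet_space (0, 0, 0, s) a (0, 0, 0, 0) = 0"
    and "\<And>s t. s \<in> sym_tensors \<Longrightarrow> t \<in> sym_tensors \<Longrightarrow>
           dirderiv jet_space (0, 0, 0, s) (dirderiv jet_space (0, 0, 0, t) a) (0, 0, 0, 0) = 0"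
  shows "\<forall>\<^sub>F R in at_right 0.
           \<exists>F. infinite F \<and>
               (\<forall>u\<in>F. is_solution A a \<alpha> R u \<and> vanishing_order_two (cball 0 R) u) \<and>
               (\<forall>u\<in>F. \<not> radially_symmetric_on (cball 0 R) u)"
proof -
  note \<alpha> = assms(2,3)
  \<comment> \<open>Two axes give room for a Hessian that contracts to zero with \<open>A 0\<close>
    without being a multiple of the identity.\<close>
  obtain i1 i2 :: 'n where i12: "i1 \<noteq> i2"
    using assms(1) card_le_Suc0_iff_eq[of "UNIV :: 'n set"] by auto
  have ell: "contract (A 0) (\<lambda>i j. \<xi> $ i * \<xi> $ j) \<ge> lam * (norm \<xi>)\<^sup>2" for \<xi>
    using assms(6)[of \<xi> 0] by (simp add: contract_def mult.assoc)
  have diag: "A 0 $ i $ i > 0" for i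
  proof -
    have "(axis i 1 :: real^'n) $ k = (axis k 1 :: real^'n) $ i" for k by (simp add: axis_def)
    then have "contract (A 0) (\<lambda>k l. (axis i 1 :: real^'n) $ k * (axis i 1 :: real^'n) $ l) = A 0 $ i $ i"
      using contract_axis[of "A 0" i] by simp
    then show ?thesis using ell[of "axis i 1"] assms(5) by simp
  qed
  define tr where "tr = (\<Sum>i\<in>UNIV. A 0 $ i $ i)"
  have tr: "tr > 0" unfolding tr_def by (rule sum_pos) (auto simp: diag)
  obtain C r where C: "C \<ge> 0" and r: "r > 0" and op:
    "\<And>R. 0 < R \<Longrightarrow> R \<le> r \<Longrightarrow>
      \<exists>(u :: (real^'n \<Rightarrow> real^'N) \<Rightarrow> real^'n \<Rightarrow> real^'N) D1 D2 Q. is_local_inverse (A 0) \<alpha> R tr C u D1 D2 Q"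
    using tr by (rule_tac local_solution_operator[OF \<alpha> assms(5) ell tr_def, where 'b = "real^'N"]) auto
  have "\<exists>L\<ge>0. \<forall>x\<in>cball 0 1. \<forall>y\<in>cball 0 1. \<bar>A x $ i $ j - A y $ i $ j\<bar> \<le> L * norm (x - y)" for i j
    using C1_lipschitz_on_unit_ball[OF assms(4)[of 1 i j]] \<alpha> by (metis less_imp_le zero_less_one)
  then obtain l where l: "\<And>i j. l i j \<ge> 0"
    "\<And>i j x y. x \<in> cball 0 1 \<Longrightarrow> y \<in> cball 0 1 \<Longrightarrow> \<bar>A x $ i $ j - A y $ i $ j\<bar> \<le> l i j * norm (x - y)"
    by metis
  define LA where "LA = (\<Sum>i\<in>UNIV. \<Sum>j\<in>UNIV. l i j)"
  have LA: "0 \<le> LA" unfolding LA_def by (intro sum_nonneg l(1))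
  have l_le: "l i j \<le> LA" for i j
  proof -
    have "l i j \<le> (\<Sum>j\<in>UNIV. l i j)" by (rule member_le_sum) (auto simp: l)
    also have "\<dots> \<le> LA" unfolding LA_def by (rule member_le_sum) (auto simp: l sum_nonneg)
    finally show ?thesis .
  qed
  have A_l: "\<bar>A x $ i $ j - A y $ i $ j\<bar> \<le> LA * norm (x - y)" if "x \<in> cball 0 1" "y \<in> cball 0 1" for x y i j
    using l(2)[OF that, of i j] mult_right_mono[OF l_le norm_ge_zero, of i j "x - y"] by linarith

  \<comment> \<open>The extended nonlinearity agrees with \<open>a\<close> at symmetric Hessians,
    hence along the jets of the solutions to be found.\<close>
  define F where "F X = a (symmetric_jet X)" for X
  define DF where "DF X Z = dirderiv jet_space (symmetric_jet Z) a (symmetric_jet X)" for X Z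
  note C2 = C2_on_subspace[OF subspace_jet_space linear_symmetric_jet symmetric_jet_in_jet_space assms(7)]
  have dF: "(F has_derivative DF X) (at X)" for X
    unfolding F_def[abs_def] DF_def[abs_def] by (rule C2(1))
  obtain L where L: "L \<ge> 0"
    and DF_l: "\<And>X Y Z. X \<in> cball 0 1 \<Longrightarrow> Y \<in> cball 0 1 \<Longrightarrow> norm (DF X Z - DF Y Z) \<le> L * norm (X - Y) * norm Z"
    and DF_b: "\<And>X Z. X \<in> cball 0 1 \<Longrightarrow> norm (DF X Z) \<le> L * norm Z"
    using C2_derivative_lipschitz[OF dF C2(2)[folded DF_def] C2(3)] by metis
  have sj0: "symmetric_jet 0 = (0 :: (real^'n) \<times> (real^'N) \<times> (real^'n^'N) \<times> (real^'n^'n^'N))"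
    by (rule linear_0[OF linear_symmetric_jet])
  have "a 0 = 0" using assms(8) by (simp add: zero_prod_def)
  then have F0: "F 0 = 0" by (simp add: F_def sj0)
  have DF0: "DF 0 (0, 0, 0, s) = 0" for s
  proof -
    obtain s' where s': "symmetric_jet (0, 0, 0, s) = ((0, 0, 0, s') :: (real^'n) \<times> (real^'N) \<times> (real^'n^'N) \<times> (real^'n^'n^'N))"
      by (simp add: symmetric_jet_def)
    then have "s' \<in> sym_tensors"
      using symmetric_jet_in_jet_space[of "(0, 0, 0, s)"] by (simp add: jet_space_def)
    then have "dirderiv jet_space (0, 0, 0, s') a 0 = 0" using assms(9) by (simp add: zero_prod_def)
    then show ?thesis by (simp add: DF_def s' sj0)
  qed

  \<comment> \<open>The two diagonal coefficients are interchanged as weights, so the contraction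
    with \<open>A 0\<close> cancels, while the values on the two axes have opposite signs and differ
    by \<open>\<eta>\<close>.\<close>
  define h where "h v w = A 0 $ i2 $ i2 * (v $ i1 * w $ i1) - A 0 $ i1 $ i1 * (v $ i2 * w $ i2)" for v w :: "real^'n"
  define \<eta> where "\<eta> = A 0 $ i2 $ i2 + A 0 $ i1 $ i1"
  have \<eta>: "0 < \<eta>" using diag by (simp add: \<eta>_def add_pos_pos)
  have h_bil: "bounded_bilinear h"
  proof -
    have "bilinear h" unfolding bilinear_def
      by (auto intro!: linearI simp: h_def algebra_simps)
    then show ?thesis by (simp add: bilinear_conv_bounded_bilinear)
  qed
  have h_sym: "h v w = h w v" for v w by (simp add: h_def mult.commute)
  have h_b: "\<bar>h v w\<bar> \<le> \<eta> * norm v * norm w" for v w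
  proof -
    have c: "\<bar>A 0 $ i $ i * (v $ j * w $ j)\<bar> \<le> A 0 $ i $ i * (norm v * norm w)" for i j
      unfolding abs_mult using diag[of i]
      by (intro mult_mono mult_nonneg_nonneg component_le_norm_cart) auto
    show ?thesis
      using c[of i2 i1] c[of i1 i2] abs_triangle_ineq4[of "A 0 $ i2 $ i2 * (v $ i1 * w $ i1)" "A 0 $ i1 $ i1 * (v $ i2 * w $ i2)"]
      unfolding h_def \<eta>_def by (simp add: distrib_right mult.assoc)
  qed
  have h_tr: "contract (A 0) (\<lambda>i j. h (axis i 1) (axis j 1)) = 0"
  proof -
    have "contract (A 0) (\<lambda>i j. h (axis i 1) (axis j 1))
      = A 0 $ i2 $ i2 * contract (A 0) (\<lambda>i j. (axis i 1 :: real^'n) $ i1 * (axis j 1 :: real^'n) $ i1)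
       - A 0 $ i1 $ i1 * contract (A 0) (\<lambda>i j. (axis i 1 :: real^'n) $ i2 * (axis j 1 :: real^'n) $ i2)"
      unfolding h_def contract_diff by (simp add: contract_def sum_distrib_left mult_ac)
    then show ?thesis by (simp add: contract_axis)
  qed
  \<comment> \<open>An arbitrary component of the system; the polynomial is placed in it.\<close>
  define k0 :: 'N where "k0 = undefined"
  define e :: "real^'N" where "e = axis k0 1"
  have norm_e: "norm e = 1" by (simp add: e_def)

  define G where "G = real (CARD('N) * CARD('n) * CARD('n))"
  define C1 where "C1 = C + 1 / tr"
  define C2 where "C2 = C1 + \<eta>"
  define C3 where "C3 = 1 + C2 + G * C2 + G * C"
  define C4 where "C4 = 1 + C2 + G * C2 + G * C2"
  \<comment> \<open>The locale constants \<open>K1\<close> and \<open>K2\<close> written out in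
    advance: R has to be chosen before the locale can be interpreted, and these values depend on
    neither R nor \<epsilon>.\<close>
  define k1 where "k1 = L * ((1 + G) * C1 + C4 * G * C + 2 * C3 * ((1 + 2 * G) * C1))
    + real (CARD('n) * CARD('n)) * LA * (C + C1) + C + L * C4 * G * (1 / tr)"
  define k2 where "k2 = 2 * L * (1 + C2 + G * C2) + L * C4 * G * C
    + real (CARD('n) * CARD('n)) * LA * (C + C2) + C + L * C4 * G * C2"

  have "\<exists>u. is_solution A a \<alpha> R u \<and> vanishing_order_two (cball 0 R) u \<and>
      \<not> radially_symmetric_on (cball 0 R) u \<and>
      hessian (cball 0 R) u 0 $ k0 $ i1 $ i1 - hessian (cball 0 R) u 0 $ k0 $ i2 $ i2 = \<epsilon> * \<eta>"
    if R: "0 < R" "R \<le> r" "R \<le> 1 / 2" and small: "C4 * R powr \<alpha> \<le> 1" "k1 * R powr \<alpha> \<le> 1 / 2"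
      "k2 * R powr \<alpha> \<le> 1 / 4" "k2 * R powr (1 - \<alpha>) \<le> 1 / 4"
      and eps: "0 < \<epsilon>" "\<epsilon> \<le> R powr \<alpha>" for R \<epsilon>
  proof -
    obtain u :: "(real^'n \<Rightarrow> real^'N) \<Rightarrow> real^'n \<Rightarrow> real^'N" and D1 D2 Q
      where inv: "is_local_inverse (A 0) \<alpha> R tr C u D1 D2 Q"
      using op[OF R(1,2)] by blast
    interpret lp: local_problem A F DF L LA C \<eta> \<alpha> tr R \<epsilon> G C1 C2 C3 C4 u D1 D2 Q h e
      by (rule local_problem.intro[OF \<alpha> R(1,3) less_imp_le[OF eps(1)] eps(2) L LA C less_imp_le[OF \<eta>] tr
           G_def C1_def C2_def C3_def C4_def small(1) inv A_l dF DF_l DF_b DF0 F0 h_bil h_sym h_b h_tr norm_e])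
    have 1: "lp.K1 * R powr \<alpha> \<le> 1 / 2" using small(2) unfolding lp.K1_def k1_def .
    have "k2 * (R powr \<alpha> + R powr (1 - \<alpha>)) \<le> 1 / 2" using small(3,4) unfolding distrib_left by linarith
    then have 2: "lp.K2 * (R powr \<alpha> + R powr (1 - \<alpha>)) \<le> 1 / 2" unfolding lp.K2_def k2_def .
    show ?thesis
    proof (rule lp.solution_exists[OF 1 2])
      fix U :: "real^'n \<Rightarrow> real^'N" and U1 U2 c B
      assume U: "\<And>x. (U has_derivative U1 x) (at x)" "\<And>x v. ((\<lambda>x. U1 x v) has_derivative U2 x v) (at x)"
        "\<And>x v w. U2 x v w = U2 x w v" "U 0 = 0" "\<And>v. U1 0 v = 0"
        and U20: "\<And>v w. U2 0 v w = ((v \<bullet> w) / tr) *\<^sub>R c + (\<epsilon> * h v w) *\<^sub>R e"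
        and hoelder: "\<And>x y v w. x \<in> cball 0 R \<Longrightarrow> y \<in> cball 0 R \<Longrightarrow>
           norm (U2 x v w - U2 y v w) \<le> B * norm (x - y) powr \<alpha> * norm v * norm w"
        and eq: "\<And>x. x \<in> cball 0 R \<Longrightarrow> contract (A x) (\<lambda>i j. U2 x (axis i 1) (axis j 1))
           = F (x, U x, gradient_of (U1 x), hessian_of (U2 x))"
      \<comment> \<open>The multiple of the identity is the same on both axes and cancels; only the
        polynomial remains.\<close>
      have "U2 0 (axis i1 1) (axis i1 1) - U2 0 (axis i2 1) (axis i2 1) = (\<epsilon> * \<eta>) *\<^sub>R e"
      proof -
        have "h (axis i1 1) (axis i1 1) = A 0 $ i2 $ i2" "h (axis i2 1) (axis i2 1) = - (A 0 $ i1 $ i1)"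
          using i12 by (simp_all add: h_def axis_def)
        then show ?thesis
          unfolding U20 by (simp add: inner_axis_axis \<eta>_def algebra_simps)
      qed
      moreover from this have neq: "U2 0 (axis i1 1) (axis i1 1) \<noteq> U2 0 (axis i2 1) (axis i2 1)"
        using eps \<eta> norm_e by auto
      note rs = restricted_solution[OF R(1) U hoelder eq[unfolded F_def] neq]
      ultimately show ?thesis
        using rs by (intro exI[of _ "restrict U (cball 0 R)"])
          (simp add: hessian_of_def e_def vector_minus_component[symmetric] del: vector_minus_component)
    qed
  qed
  note solutions = this

  have "\<forall>\<^sub>F R in at_right 0. R \<le> r" "\<forall>\<^sub>F R in at_right 0. R \<le> (1 / 2 :: real)" "\<forall>\<^sub>F R in at_right 0. (0 :: real) < R"
    using r by (auto simp: eventually_at_right intro: exI[of _ r] exI[of _ "1/2"] exI[of _ 1])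
  \<comment> \<open>The two bounds by 1/4 add up to the starting bound 1/2 required by the fixed
    point iteration.\<close>
  moreover have "\<forall>\<^sub>F R in at_right 0. C4 * R powr \<alpha> \<le> 1" "\<forall>\<^sub>F R in at_right 0. k1 * R powr \<alpha> \<le> 1 / 2"
    "\<forall>\<^sub>F R in at_right 0. k2 * R powr \<alpha> \<le> 1 / 4" "\<forall>\<^sub>F R in at_right 0. k2 * R powr (1 - \<alpha>) \<le> 1 / 4"
    using \<alpha> by (intro eventually_powr_small; simp)+
  ultimately show ?thesis
  proof eventually_elim
    case (elim R)
    have "\<forall>\<epsilon>\<in>{0<..R powr \<alpha>}. \<exists>u. is_solution A a \<alpha> R u \<and> vanishing_order_two (cball 0 R) u \<and>
      \<not> radially_symmetric_on (cball 0 R) u \<and>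
      hessian (cball 0 R) u 0 $ k0 $ i1 $ i1 - hessian (cball 0 R) u 0 $ k0 $ i2 $ i2 = \<epsilon> * \<eta>"
      using solutions elim by auto
    then obtain w where w: "\<And>\<epsilon>. \<epsilon> \<in> {0<..R powr \<alpha>} \<Longrightarrow> is_solution A a \<alpha> R (w \<epsilon>) \<and> vanishing_order_two (cball 0 R) (w \<epsilon>) \<and>
      \<not> radially_symmetric_on (cball 0 R) (w \<epsilon>) \<and>
      hessian (cball 0 R) (w \<epsilon>) 0 $ k0 $ i1 $ i1 - hessian (cball 0 R) (w \<epsilon>) 0 $ k0 $ i2 $ i2 = \<epsilon> * \<eta>"
      by metis
    \<comment> \<open>The Hessian at the origin reveals \<epsilon> because \<eta> > 0, so distinct
      parameters give distinct solutions.\<close>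
    have "inj_on w {0<..R powr \<alpha>}"
    proof (rule inj_onI)
      fix x y assume x: "x \<in> {0<..R powr \<alpha>}" and y: "y \<in> {0<..R powr \<alpha>}" and "w x = w y"
      then have "x * \<eta> = y * \<eta>" using w[OF x] w[OF y] by metis
      then show "x = y" using \<eta> by simp
    qed
    moreover have "infinite {0<..R powr \<alpha>}" using elim by (simp add: infinite_Ioc)
    ultimately have "infinite (w ` {0<..R powr \<alpha>})" by (simp add: finite_image_iff)
    then show ?case using w by (intro exI[of _ "w ` {0<..R powr \<alpha>}"]) auto
  qed
qed

end
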